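(* Let $k$ be a positive integer and let $H$ be a claw-free graph with $\chi(H)\le k$. Suppose that, for all sufficiently large $n$, there is an $n$-vertex $K_{k+1}$-free graph $G_n$ with $\mathcal N(H,G_n)=\mathrm{ex}(n,H,K_{k+1})$ such that $G_n$ can be transformed into a complete $k$-partite graph by adding and deleting $o(n^2)$ edges (as $n\to\infty$). Then $H$ is $K_{k+1}$-Turán-good.
   Context: All graphs are finite and simple. A graph is claw-free if it has no induced subgraph isomorphic to $K_{1,3}$. $\chi(H)$ is the chromatic number. $\mathcal N(H,G)$ is the number of (not necessarily induced) subgraphs of $G$ isomorphic to $H$. A graph is $K_{k+1}$-free if it does not contain the complete graph $K_{k+1}$ as a subgraph. $\mathrm{ex}(n,H,K_{k+1})$ is the maximum of $\mathcal N(H,G)$ over all $n$-vertex $K_{k+1}$-free graphs $G$. A complete $k$-partite graph on $n$ vertices may have arbitrary part sizes. $T_k(n)$ is the Turán graph: the complete $k$-partite graph on $n$ vertices whose part sizes are $\lfloor n/k\rfloor$ or $\lceil n/k\rceil$. $H$ is $K_{k+1}$-Turán-good if, for all sufficiently large $n$, $\mathrm{ex}(n,H,K_{k+1})=\mathcal N(H,T_k(n))$. *)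

theory Defs
  imports Complex_Main "HOL-Library.Landau_Symbols"
begin

datatype 'a graph = Graph (verts: "'a set") (edges: "'a set set")

definition simple_graph :: "'a graph \<Rightarrow> bool" where
  "simple_graph G \<longleftrightarrow> finite (verts G) \<and> (\<forall>e\<in>edges G. e \<subseteq> verts G \<and> card e = 2)"

definition subgraph :: "'a graph \<Rightarrow> 'a graph \<Rightarrow> bool" where
  "subgraph S G \<longleftrightarrow> simple_graph S \<and> verts S \<subseteq> verts G \<and> edges S \<subseteq> edges G"

definition induced_subgraph :: "'a graph \<Rightarrow> 'a graph \<Rightarrow> bool" where
  "induced_subgraph S G \<longleftrightarrow> verts S \<subseteq> verts G \<and> edges S = {e \<in> edges G. e \<subseteq> verts S}"

definition graph_iso :: "'a graph \<Rightarrow> 'b graph \<Rightarrow> bool" where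
  "graph_iso G H \<longleftrightarrow> (\<exists>f. bij_betw f (verts G) (verts H) \<and>
     (\<forall>u\<in>verts G. \<forall>v\<in>verts G. {u, v} \<in> edges G \<longleftrightarrow> {f u, f v} \<in> edges H))"

definition complete_graph :: "nat \<Rightarrow> nat graph" where
  "complete_graph m = Graph {..<m} {e. e \<subseteq> {..<m} \<and> card e = 2}"

definition claw :: "nat graph" where
  "claw = Graph {0, 1, 2, 3} {{0, 1}, {0, 2}, {0, 3}}"

definition claw_free :: "'a graph \<Rightarrow> bool" where
  "claw_free H \<longleftrightarrow> \<not> (\<exists>S. induced_subgraph S H \<and> graph_iso S claw)"

definition colorable :: "nat \<Rightarrow> 'a graph \<Rightarrow> bool" where
  "colorable k G \<longleftrightarrow> (\<exists>c :: 'a \<Rightarrow> nat. (\<forall>v\<in>verts G. c v < k) \<and>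
     (\<forall>u\<in>verts G. \<forall>v\<in>verts G. {u, v} \<in> edges G \<longrightarrow> c u \<noteq> c v))"

definition chromatic_number :: "'a graph \<Rightarrow> nat" where
  "chromatic_number G = (LEAST k. colorable k G)"

definition subgraph_count :: "'a graph \<Rightarrow> 'b graph \<Rightarrow> nat" where
  "subgraph_count H G = card {S. subgraph S G \<and> graph_iso S H}"

definition free_of :: "'a graph \<Rightarrow> 'b graph \<Rightarrow> bool" where
  "free_of F G \<longleftrightarrow> \<not> (\<exists>S. subgraph S G \<and> graph_iso S F)"

text \<open>Up to isomorphism every finite graph has its vertices in \<open>nat\<close>, so the host graphs
  are taken there.\<close>

definition ex_number :: "nat \<Rightarrow> 'a graph \<Rightarrow> 'b graph \<Rightarrow> nat" where
  "ex_number n H F = Max {subgraph_count H G | G :: nat graph.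
     simple_graph G \<and> card (verts G) = n \<and> free_of F G}"

text \<open>The partition is given by the map \<open>c\<close> into \<open>{..<k}\<close>; parts may be empty.\<close>

definition multipartite_by :: "('a \<Rightarrow> nat) \<Rightarrow> nat \<Rightarrow> 'a graph \<Rightarrow> bool" where
  "multipartite_by c k G \<longleftrightarrow> (\<forall>v\<in>verts G. c v < k) \<and>
     edges G = {{u, v} | u v. u \<in> verts G \<and> v \<in> verts G \<and> c u \<noteq> c v}"

definition complete_multipartite :: "nat \<Rightarrow> 'a graph \<Rightarrow> bool" where
  "complete_multipartite k G \<longleftrightarrow> simple_graph G \<and> (\<exists>c. multipartite_by c k G)"

definition turan_graph :: "nat \<Rightarrow> nat \<Rightarrow> nat graph" where
  "turan_graph k n = Graph {..<n} {{u, v} | u v. u < n \<and> v < n \<and> u mod k \<noteq> v mod k}"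

definition turan_good :: "nat \<Rightarrow> 'a graph \<Rightarrow> bool" where
  "turan_good k H \<longleftrightarrow> (\<forall>\<^sub>F n in sequentially.
     ex_number n H (complete_graph (k + 1)) = subgraph_count H (turan_graph k n))"

text \<open>The residue classes modulo \<open>k\<close> are the parts of the Turan graph.\<close>

lemma turan_graph_complete_multipartite:
  assumes "k > 0"
  shows "complete_multipartite k (turan_graph k n)"
    and "multipartite_by (\<lambda>v. v mod k) k (turan_graph k n)"
proof -
  show "multipartite_by (\<lambda>v. v mod k) k (turan_graph k n)"
    using assms by (simp add: multipartite_by_def turan_graph_def)
  moreover have "simple_graph (turan_graph k n)"
    by (auto simp: simple_graph_def turan_graph_def card_insert_if)
  ultimately show "complete_multipartite k (turan_graph k n)"
    unfolding complete_multipartite_def by blast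
qed

lemma turan_graph_part_sizes:
  assumes "k > 0" "i < k"
  shows "int (card {v \<in> verts (turan_graph k n). v mod k = i})
           \<in> {\<lfloor>real n / real k\<rfloor>, \<lceil>real n / real k\<rceil>}"
proof -
  define q r where "q = n div k" and "r = n mod k"
  have n: "n = q * k + r" and r: "r < k"
    using assms by (simp_all add: q_def r_def)
  have "{v \<in> verts (turan_graph k n). v mod k = i}
      = (\<lambda>j. j * k + i) ` {..<(if i < r then q + 1 else q)}" (is "?A = ?B")
  proof
    show "?A \<subseteq> ?B"
    proof
      fix v assume "v \<in> ?A"
      then have v: "v < n" "v mod k = i" by (auto simp: turan_graph_def)
      have eq: "v = v div k * k + i" using v(2) div_mult_mod_eq[of v k] by simp
      have "v div k \<le> q" using v(1) unfolding q_def by (simp add: div_le_mono)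
      moreover have "v div k < q" if "\<not> i < r"
      proof (rule ccontr)
        assume "\<not> v div k < q"
        then have "q * k \<le> v div k * k" by simp
        then show False using eq v(1) n that by linarith
      qed
      ultimately have "v div k \<in> {..<(if i < r then q + 1 else q)}" by auto
      then show "v \<in> ?B" using eq by blast
    qed
    show "?B \<subseteq> ?A"
    proof
      fix v assume "v \<in> ?B"
      then obtain j where j: "j < (if i < r then q + 1 else q)" and v: "v = j * k + i" by auto
      have "v < n"
      proof (cases "i < r")
        case True
        then have "j * k \<le> q * k" using j by simp
        then show ?thesis using v n True by linarith
      next
        case False
        then have "Suc j * k \<le> q * k" using j by (intro mult_le_mono1) simp
        then show ?thesis using v n assms by simp
      qed
      then show "v \<in> ?A" using v assms by (simp add: turan_graph_def)
    qed
  qed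
  moreover have "inj_on (\<lambda>j. j * k + i) X" for X
    using assms by (auto simp: inj_on_def)
  ultimately have c: "card {v \<in> verts (turan_graph k n). v mod k = i}
      = (if i < r then q + 1 else q)"
    by (simp add: card_image)
  have fl: "\<lfloor>real n / real k\<rfloor> = int q"
    unfolding q_def by (simp add: floor_divide_of_nat_eq)
  have "\<lceil>real n / real k\<rceil> = int q + 1" if "i < r"
  proof (rule ceiling_unique)
    have "real n = real q * real k + real r" using n by (metis of_nat_add of_nat_mult)
    then show "real_of_int (int q + 1) - 1 < real n / real k"
        "real n / real k \<le> real_of_int (int q + 1)"
      using that r assms by (simp_all add: field_simps)
  qed
  then show ?thesis using c fl by auto
qed

text \<open>The maximum in \<open>ex_number\<close> is over a finite nonempty set.\<close>

lemma ex_number_Max_attained: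
  assumes "k > 0"
  shows "finite {subgraph_count H G | G :: nat graph.
           simple_graph G \<and> card (verts G) = n \<and> free_of (complete_graph (k + 1)) G}"
    and "{subgraph_count H G | G :: nat graph.
           simple_graph G \<and> card (verts G) = n \<and> free_of (complete_graph (k + 1)) G} \<noteq> {}"
proof -
  have bound: "subgraph_count H G \<le> 2 ^ n * 2 ^ 2 ^ n"
    if G: "simple_graph G" "card (verts G) = n" for G :: "nat graph"
  proof -
    have fin: "finite (verts G)" using G by (simp add: simple_graph_def)
    let ?P = "Pow (verts G) \<times> Pow (Pow (verts G))"
    have finP: "finite ?P" using fin by simp
    have sub: "{S. subgraph S G \<and> graph_iso S H} \<subseteq> (\<lambda>(V, E). Graph V E) ` ?P"
    proof
      fix S assume "S \<in> {S. subgraph S G \<and> graph_iso S H}"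
      then have "verts S \<subseteq> verts G" "edges S \<subseteq> Pow (verts G)"
        by (auto simp: subgraph_def simple_graph_def)
      then show "S \<in> (\<lambda>(V, E). Graph V E) ` ?P"
        by (intro image_eqI[of _ _ "(verts S, edges S)"]) auto
    qed
    have "card {S. subgraph S G \<and> graph_iso S H} \<le> card ((\<lambda>(V, E). Graph V E) ` ?P)"
      by (intro card_mono sub finite_imageI finP)
    also have "\<dots> \<le> card ?P" by (rule card_image_le[OF finP])
    also have "\<dots> = 2 ^ n * 2 ^ 2 ^ n"
      using fin G by (simp add: card_cartesian_product card_Pow)
    finally show ?thesis by (simp add: subgraph_count_def)
  qed
  show "finite {subgraph_count H G | G :: nat graph.
           simple_graph G \<and> card (verts G) = n \<and> free_of (complete_graph (k + 1)) G}"
    by (rule finite_subset[of _ "{..2 ^ n * 2 ^ 2 ^ n}"]) (use bound in auto)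
  have "free_of (complete_graph (k + 1)) (Graph {..<n} {} :: nat graph)"
    unfolding free_of_def
  proof
    assume "\<exists>S. subgraph S (Graph {..<n} {}) \<and> graph_iso S (complete_graph (k + 1))"
    then obtain S :: "nat graph" where S: "edges S = {}" and iso: "graph_iso S (complete_graph (k + 1))"
      by (auto simp: subgraph_def)
    from iso obtain f where f: "bij_betw f (verts S) (verts (complete_graph (k + 1)))"
      and e: "\<And>u v. u \<in> verts S \<Longrightarrow> v \<in> verts S \<Longrightarrow>
        {u, v} \<in> edges S \<longleftrightarrow> {f u, f v} \<in> edges (complete_graph (k + 1))"
      unfolding graph_iso_def by blast
    have "0 \<in> f ` verts S" "1 \<in> f ` verts S"
      using f assms by (simp_all add: bij_betw_def complete_graph_def)
    then obtain u v where "u \<in> verts S" "v \<in> verts S" "f u = 0" "f v = 1" by (metis imageE)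
    then show False using e[of u v] S assms by (simp add: complete_graph_def)
  qed
  moreover have "simple_graph (Graph {..<n} {})" by (simp add: simple_graph_def)
  ultimately show "{subgraph_count H G | G :: nat graph.
      simple_graph G \<and> card (verts G) = n \<and> free_of (complete_graph (k + 1)) G} \<noteq> {}"
    by (metis (mono_tags, lifting) Collect_empty_eq card_lessThan graph.sel(1))
qed

end

theory Submission
  imports Defs "HOL-Library.FuncSet" "HOL-Combinatorics.Transposition"
begin

text \<open>Copies of \<open>H\<close> are counted by injective homomorphisms, and complete multipartite hosts are
  given by colourings of their vertices.

  Among complete \<open>k\<close>-partite hosts the balanced one is best. Fix an injection \<open>\<phi>\<close> of \<open>H\<close> into the
  vertex set and count the colourings with prescribed class sizes for which \<open>\<phi>\<close> is a homomorphism.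
  In a claw-free graph a vertex has at most two neighbours in any other colour class, so the
  \<open>i\<close>-\<open>j\<close> Kempe components are paths or cycles whose two sides differ by at most one. Swapping a
  component with one more vertex of colour \<open>i\<close> moves one unit from class \<open>i\<close> to class \<open>j\<close>; double
  counting these swaps shows that moving a vertex from a larger class to a smaller one never
  decreases the number of homomorphisms.

  Hence an extremal \<open>G\<close> close to a complete \<open>k\<close>-partite graph has all parts of linear size.
  Replacing a vertex by a twin of another one keeps \<open>G\<close> free of \<open>K\<^bsub>k+1\<^esub>\<close>, so all vertices lie in
  about equally many copies of \<open>H\<close>. Every vertex has few neighbours in some part, as otherwise
  it would lie in a \<open>K\<^bsub>k+1\<^esub>\<close>, and then it must be adjacent to almost everything in the other parts,
  as otherwise it would lie in too few copies. Two adjacent vertices with the same sparse part would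
  extend to a \<open>K\<^bsub>k+1\<^esub>\<close>. So \<open>G\<close> is \<open>k\<close>-partite, and the first part of the argument applies.\<close>

section \<open>Kempe swaps in claw-free graphs\<close>

text \<open>A swap changes the colouring and hence the host, so swaps do not act on the embeddings
  into one fixed host. The roles are therefore exchanged: an injection is fixed, and the colouring
  that defines the host runs over all colourings with given class sizes. All of these hosts admit
  the same number of embeddings, so averaging loses nothing. For each injection the swap count gives
  an inequality with factors \<open>Suc a\<close> and \<open>Suc b\<close>; the number of all
  colourings changes by exactly this ratio, so the factors cancel.

  A count that merely does not decrease under balancing cannot exclude tiny parts; a gain of order
  n^h is needed, h being the number of vertices of \<open>H\<close>. It comes from copies with an
  edge between two chosen classes, which is why \<open>H\<close> without edges is treated apart.

  Extremality is used only against two competitors, the balanced host and the host with a cloned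
  vertex. The constants are fixed in the order \<gamma>, \<beta>, \<alpha>, and \<epsilon>
  last.\<close>

definition claw_free_rel :: "'b set \<Rightarrow> ('b \<Rightarrow> 'b \<Rightarrow> bool) \<Rightarrow> bool" where
  "claw_free_rel V Q \<longleftrightarrow> (\<forall>x\<in>V. \<forall>y1\<in>V. \<forall>y2\<in>V. \<forall>y3\<in>V. distinct [y1, y2, y3] \<longrightarrow>
     Q x y1 \<longrightarrow> Q x y2 \<longrightarrow> Q x y3 \<longrightarrow> Q y1 y2 \<or> Q y1 y3 \<or> Q y2 y3)"

definition part :: "'b set \<Rightarrow> ('b \<Rightarrow> nat) \<Rightarrow> nat \<Rightarrow> 'b set" where
  "part V c l = {v \<in> V. c v = l}"

lemma finite_part [simp]: "finite V \<Longrightarrow> finite (part V c l)"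
  by (simp add: part_def)

definition colorings :: "'b set \<Rightarrow> nat set \<Rightarrow> (nat \<Rightarrow> nat) \<Rightarrow> ('b \<Rightarrow> nat) set" where
  "colorings V K X = {c \<in> V \<rightarrow>\<^sub>E K. \<forall>l\<in>K. card (part V c l) = X l}"

definition proper :: "'b set \<Rightarrow> ('b \<Rightarrow> 'b \<Rightarrow> bool) \<Rightarrow> ('b \<Rightarrow> nat) \<Rightarrow> bool" where
  "proper V Q c \<longleftrightarrow> (\<forall>x\<in>V. \<forall>y\<in>V. Q x y \<longrightarrow> c x \<noteq> c y)"

lemma finite_colorings [simp]: "finite V \<Longrightarrow> finite K \<Longrightarrow> finite (colorings V K X)"
  by (simp add: colorings_def finite_PiE)

locale kempe =
  fixes V :: "'b set" and Q :: "'b \<Rightarrow> 'b \<Rightarrow> bool" and i j :: nat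
  assumes fin: "finite V" and sym: "Q x y \<Longrightarrow> Q y x"
    and cf: "claw_free_rel V Q" and ij: "i \<noteq> j"
begin

text \<open>Edges inside one colour are kept: the relation depends on \<open>c\<close> only through
  membership of colours in \<open>{i, j}\<close>, so a swap leaves it, and with it the components,
  unchanged.\<close>

definition krel :: "('b \<Rightarrow> nat) \<Rightarrow> ('b \<times> 'b) set" where
  "krel c = {(x, y). x \<in> V \<and> y \<in> V \<and> c x \<in> {i, j} \<and> c y \<in> {i, j} \<and> Q x y}"

definition comps :: "('b \<Rightarrow> nat) \<Rightarrow> 'b set set" where
  "comps c = (\<lambda>x. (krel c)\<^sup>* `` {x}) ` {x \<in> V. c x \<in> {i, j}}"

definition swap :: "('b \<Rightarrow> nat) \<Rightarrow> 'b set \<Rightarrow> 'b \<Rightarrow> nat" where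
  "swap c C = (\<lambda>x. if x \<in> C then (if c x = i then j else if c x = j then i else c x) else c x)"

lemma krel_rtrancl_sym: "(x, y) \<in> (krel c)\<^sup>* \<Longrightarrow> (y, x) \<in> (krel c)\<^sup>*"
proof -
  have "Relation.sym (krel c)" by (auto simp: Relation.sym_def krel_def sym)
  then show "(x, y) \<in> (krel c)\<^sup>* \<Longrightarrow> (y, x) \<in> (krel c)\<^sup>*"
    by (meson sym_rtrancl symD)
qed

lemma krel_rtrancl_in: "(x, y) \<in> (krel c)\<^sup>* \<Longrightarrow> x \<in> V \<Longrightarrow> c x \<in> {i, j} \<Longrightarrow> y \<in> V \<and> c y \<in> {i, j}"
  by (induction rule: rtrancl_induct) (auto simp: krel_def)

lemma comps_sub: "C \<in> comps c \<Longrightarrow> C \<subseteq> {x \<in> V. c x \<in> {i, j}}"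
  unfolding comps_def using krel_rtrancl_in by fastforce

lemma finite_comps [simp]: "finite (comps c)"
  unfolding comps_def using fin by simp

lemma comps_finite: "C \<in> comps c \<Longrightarrow> finite C"
  by (rule finite_subset[OF comps_sub]) (use fin in auto)

lemma comps_disjoint: "C \<in> comps c \<Longrightarrow> D \<in> comps c \<Longrightarrow> C \<noteq> D \<Longrightarrow> C \<inter> D = {}"
proof (rule ccontr)
  assume CD: "C \<in> comps c" "D \<in> comps c" "C \<noteq> D" and "C \<inter> D \<noteq> {}"
  then obtain z where z: "z \<in> C" "z \<in> D" by blast
  obtain x y where C: "C = (krel c)\<^sup>* `` {x}" and D: "D = (krel c)\<^sup>* `` {y}"
    using CD(1,2) unfolding comps_def by blast
  have "(x, z) \<in> (krel c)\<^sup>*" "(y, z) \<in> (krel c)\<^sup>*" using z C D by auto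
  then have "(x, y) \<in> (krel c)\<^sup>*" "(y, x) \<in> (krel c)\<^sup>*"
    by (meson krel_rtrancl_sym rtrancl_trans)+
  then have "C = D" unfolding C D by (intro set_eqI) (metis Image_singleton_iff rtrancl_trans)
  then show False using CD by simp
qed

lemma comps_Union: "\<Union> (comps c) = {x \<in> V. c x \<in> {i, j}}"
proof
  show "\<Union> (comps c) \<subseteq> {x \<in> V. c x \<in> {i, j}}" using comps_sub by blast
  show "{x \<in> V. c x \<in> {i, j}} \<subseteq> \<Union> (comps c)" unfolding comps_def by blast
qed

text \<open>Neighbours of \<open>x\<close> with a common colour are pairwise non-adjacent, so three
  of them would form an induced claw with \<open>x\<close>.\<close>

lemma degree_le_2:
  assumes "proper V Q c" "x \<in> V"
  shows "card {y \<in> V. c y = l \<and> Q x y} \<le> 2"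
proof (rule ccontr)
  assume "\<not> ?thesis"
  then have "3 \<le> card {y \<in> V. c y = l \<and> Q x y}" by simp
  then obtain T where T: "T \<subseteq> {y \<in> V. c y = l \<and> Q x y}" "card T = 3"
    by (meson obtain_subset_with_card_n)
  then obtain y1 y2 y3 where "T = {y1, y2, y3}" "y1 \<noteq> y2" "y1 \<noteq> y3" "y2 \<noteq> y3"
    by (auto simp: card_3_iff)
  then show False using T assms cf unfolding claw_free_rel_def proper_def
    by (smt (verit) distinct_length_2_or_more distinct_singleton insert_subset mem_Collect_eq)
qed

text \<open>A connected graph on \<open>m\<close> vertices has at least \<open>m - 1\<close> edges: take a largest subset of the
  component containing its root for which this holds.\<close>

lemma comp_edges:
  assumes "C \<in> comps c" "proper V Q c"
  shows "card C \<le> Suc (card {(x, y). x \<in> C \<and> y \<in> C \<and> c x = i \<and> c y = j \<and> Q x y})"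
proof -
  define e where "e D = card {(x, y). x \<in> D \<and> y \<in> D \<and> c x = i \<and> c y = j \<and> Q x y}" for D
  obtain r where r: "r \<in> V" "c r \<in> {i, j}" and C: "C = (krel c)\<^sup>* `` {r}"
    using assms unfolding comps_def by blast
  have finC: "finite C" using assms comps_finite by blast
  have fe: "finite {(x, y). x \<in> D \<and> y \<in> D \<and> c x = i \<and> c y = j \<and> Q x y}" if "D \<subseteq> C" for D
    by (rule finite_subset[of _ "C \<times> C"]) (use that finC in auto)
  let ?P = "\<lambda>D. D \<subseteq> C \<and> r \<in> D \<and> card D \<le> Suc (e D)"
  have "?P {r}" using C by auto
  moreover have "\<forall>D. ?P D \<longrightarrow> card D < Suc (card C)"
    using finC by (simp add: card_mono le_imp_less_Suc)
  ultimately obtain D where D: "?P D" and max: "\<And>D'. ?P D' \<Longrightarrow> card D' \<le> card D"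
    using ex_has_greatest_nat[of ?P "{r}" card] by metis
  have "C \<subseteq> D"
  proof (rule ccontr)
    assume "\<not> C \<subseteq> D"
    then obtain z where z: "(r, z) \<in> (krel c)\<^sup>*" "z \<notin> D" using C by auto
    have "\<exists>x y. x \<in> D \<and> y \<notin> D \<and> (r, y) \<in> (krel c)\<^sup>* \<and> (x, y) \<in> krel c"
      using z D
    proof (induction rule: rtrancl_induct)
      case (step y z)
      then show ?case by (metis rtrancl.rtrancl_into_rtrancl)
    qed auto
    then obtain x y where xy: "x \<in> D" "y \<notin> D" "y \<in> C" "(x, y) \<in> krel c" using C by auto
    then have k: "c x \<in> {i, j}" "c y \<in> {i, j}" "Q x y" "Q y x" "c x \<noteq> c y"
      using assms(2) sym unfolding krel_def proper_def by auto
    \<comment> \<open>Edges are counted as pairs running from colour \<open>i\<close> to colour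
      \<open>j\<close>; the new edge is oriented accordingly.\<close>
    define p where "p = (if c x = i then (x, y) else (y, x))"
    have "insert p {(x, y). x \<in> D \<and> y \<in> D \<and> c x = i \<and> c y = j \<and> Q x y} \<subseteq>
      {(u, v). u \<in> insert y D \<and> v \<in> insert y D \<and> c u = i \<and> c v = j \<and> Q u v}"
      using k xy ij by (auto simp: p_def)
    moreover have "p \<notin> {(x, y). x \<in> D \<and> y \<in> D \<and> c x = i \<and> c y = j \<and> Q x y}"
      using xy by (auto simp: p_def)
    ultimately have "Suc (e D) \<le> e (insert y D)"
      unfolding e_def using fe[of "insert y D"] fe[of D] D xy
      by (metis (no_types, lifting) card_insert_disjoint card_mono insert_subset)
    moreover have "card (insert y D) = Suc (card D)"
      using xy D finC finite_subset by (metis card_insert_disjoint)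
    ultimately have "?P (insert y D)" using D xy by auto
    from max[OF this] show False using \<open>card (insert y D) = Suc (card D)\<close> by simp
  qed
  then have "D = C" using D by simp
  then show ?thesis using D unfolding e_def by simp
qed

text \<open>With sides of sizes p and q, connectedness gives at least p + q - 1 edges, while the
  degree bound gives at most 2p and at most 2q. Hence q \<le> p + 1 and p \<le> q + 1.\<close>

lemma comp_balance:
  assumes "C \<in> comps c" "proper V Q c"
  shows "card (part C c i) \<le> Suc (card (part C c j))"
    and "card (part C c j) \<le> Suc (card (part C c i))"
proof -
  have CV: "C \<subseteq> V" "finite C" and cij: "\<And>x. x \<in> C \<Longrightarrow> c x \<in> {i, j}"
    using comps_sub comps_finite assms by blast+
  let ?E = "{(x, y). x \<in> C \<and> y \<in> C \<and> c x = i \<and> c y = j \<and> Q x y}"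
  have "C = part C c i \<union> part C c j" using cij by (auto simp: part_def)
  moreover have "part C c i \<inter> part C c j = {}" using ij by (auto simp: part_def)
  ultimately have cC: "card C = card (part C c i) + card (part C c j)"
    using card_Un_disjoint[of "part C c i" "part C c j"] CV by auto
  have d: "card {y \<in> C. c y = l \<and> Q x y} \<le> 2" if "x \<in> C" for x l
    using degree_le_2[OF assms(2), of x l] that CV fin
    by (smt (verit, best) Collect_mono_iff card_mono finite_Collect_conjI finite_code
        le_trans mem_Collect_eq rev_finite_subset subset_eq)
  have "?E = Sigma (part C c i) (\<lambda>x. {y \<in> C. c y = j \<and> Q x y})" by (auto simp: part_def)
  then have "card ?E = (\<Sum>x\<in>part C c i. card {y \<in> C. c y = j \<and> Q x y})"
    using CV by simp
  also have "\<dots> \<le> (\<Sum>x\<in>part C c i. 2)" by (rule sum_mono) (use d in \<open>auto simp: part_def\<close>)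
  finally have e1: "card ?E \<le> 2 * card (part C c i)" by simp
  have "bij_betw prod.swap ?E (Sigma (part C c j) (\<lambda>x. {y \<in> C. c y = i \<and> Q x y}))"
    by (rule bij_betwI[where g = prod.swap]) (auto simp: part_def sym)
  then have "card ?E = (\<Sum>x\<in>part C c j. card {y \<in> C. c y = i \<and> Q x y})"
    using CV by (simp add: bij_betw_same_card)
  also have "\<dots> \<le> (\<Sum>x\<in>part C c j. 2)" by (rule sum_mono) (use d in \<open>auto simp: part_def\<close>)
  finally have e2: "card ?E \<le> 2 * card (part C c j)" by simp
  show "card (part C c i) \<le> Suc (card (part C c j))"
    and "card (part C c j) \<le> Suc (card (part C c i))"
    using comp_edges[OF assms] e1 e2 cC by simp_all
qed

section \<open>Majority components and the swap invariant\<close>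

definition smin :: "('b \<Rightarrow> nat) \<Rightarrow> nat" where
  "smin c = (\<Sum>C\<in>comps c. min (card (part C c i)) (card (part C c j)))"

definition maj :: "nat \<Rightarrow> nat \<Rightarrow> ('b \<Rightarrow> nat) \<Rightarrow> 'b set set" where
  "maj p q c = {C \<in> comps c. card (part C c p) = Suc (card (part C c q))}"

lemma part_comps:
  assumes "l \<in> {i, j}"
  shows "card (part V c l) = (\<Sum>C\<in>comps c. card (part C c l))"
proof -
  have "part V c l = (\<Union>C\<in>comps c. part C c l)"
    using comps_Union[of c] assms unfolding part_def by blast
  moreover have "card (\<Union>C\<in>comps c. part C c l) = (\<Sum>C\<in>comps c. card (part C c l))"
    using comps_disjoint comps_finite by (intro card_UN_disjoint) (auto simp: part_def)
  ultimately show ?thesis by simp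
qed

text \<open>By \<open>comp_balance\<close> each component contributes its smaller side plus at most
  one surplus vertex. The number of components available for a swap is thus the class size minus
  \<open>smin c\<close>, which swaps do not change.\<close>

lemma part_maj:
  assumes "proper V Q c"
  shows "card (part V c i) = smin c + card (maj i j c)" "card (part V c j) = smin c + card (maj j i c)"
proof -
  have eq: "card (part C c i) = min (card (part C c i)) (card (part C c j)) + (if C \<in> maj i j c then 1 else 0)"
    "card (part C c j) = min (card (part C c i)) (card (part C c j)) + (if C \<in> maj j i c then 1 else 0)"
    if "C \<in> comps c" for C
    using comp_balance[OF that assms] that by (auto simp: maj_def)
  have m: "(\<Sum>C\<in>comps c. if C \<in> maj p q c then 1 else 0) = card (maj p q c)" for p q
    by (simp add: maj_def sum.If_cases Int_def)
  show "card (part V c i) = smin c + card (maj i j c)"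
    unfolding part_comps[of i c, simplified] smin_def m[symmetric] sum.distrib[symmetric]
    by (rule sum.cong[OF refl]) (rule eq)
  show "card (part V c j) = smin c + card (maj j i c)"
    unfolding part_comps[of j c, simplified] smin_def m[symmetric] sum.distrib[symmetric]
    by (rule sum.cong[OF refl]) (rule eq)
qed

context
  fixes c C assumes C: "C \<in> comps c"
begin

lemma swap_ij_iff: "swap c C x \<in> {i, j} \<longleftrightarrow> c x \<in> {i, j}"
  using ij by (auto simp: swap_def)

lemma krel_swap: "krel (swap c C) = krel c"
  unfolding krel_def swap_ij_iff ..

lemma comps_swap: "comps (swap c C) = comps c"
  unfolding comps_def krel_swap swap_ij_iff ..

lemma swap_swap: "swap (swap c C) C = c"
  using ij by (auto simp: swap_def)

lemma part_swap_same: "part C (swap c C) i = part C c j" "part C (swap c C) j = part C c i"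
  using ij by (auto simp: swap_def part_def)

lemma part_swap_other: "D \<in> comps c \<Longrightarrow> D \<noteq> C \<Longrightarrow> part D (swap c C) l = part D c l"
  using comps_disjoint[of D c C] C by (auto simp: swap_def part_def)

lemma smin_swap: "smin (swap c C) = smin c"
  unfolding smin_def comps_swap
proof (rule sum.cong[OF refl])
  fix D assume "D \<in> comps c"
  then show "min (card (part D (swap c C) i)) (card (part D (swap c C) j)) = min (card (part D c i)) (card (part D c j))"
    by (cases "D = C") (auto simp: part_swap_same part_swap_other)
qed

text \<open>An edge with both colours in \<open>{i, j}\<close> lies within one component, so both
  ends are exchanged or neither. Any other edge has an end coloured outside the pair, which keeps
  its colour, and a swap never moves a colour into or out of the pair.\<close>

lemma proper_swap:
  assumes "proper V Q c"
  shows "proper V Q (swap c C)"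
  unfolding proper_def
proof (intro ballI impI)
  fix x y assume xy: "x \<in> V" "y \<in> V" "Q x y"
  have ne: "c x \<noteq> c y" using assms xy by (auto simp: proper_def)
  show "swap c C x \<noteq> swap c C y"
  proof (cases "c x \<in> {i, j} \<and> c y \<in> {i, j}")
    case True
    then have "(x, y) \<in> krel c" "(y, x) \<in> krel c" using xy sym by (auto simp: krel_def)
    then have "x \<in> C \<longleftrightarrow> y \<in> C" using C unfolding comps_def
      by (auto intro: rtrancl.rtrancl_into_rtrancl)
    then show ?thesis using ne ij by (auto simp: swap_def)
  next
    case False
    then show ?thesis using ne swap_ij_iff[of x] swap_ij_iff[of y]
      by (auto simp: swap_def split: if_splits)
  qed
qed

lemma swap_PiE:
  assumes "c \<in> V \<rightarrow>\<^sub>E K" "i \<in> K" "j \<in> K"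
  shows "swap c C \<in> V \<rightarrow>\<^sub>E K"
  using assms comps_sub[OF C] by (auto simp: swap_def PiE_iff extensional_def)

lemma part_swap:
  assumes "l \<notin> {i, j}"
  shows "part V (swap c C) l = part V c l"
  using assms by (auto simp: swap_def part_def)

lemma card_part_swap:
  assumes pq: "p = i \<and> q = j \<or> p = j \<and> q = i"
    and "card (part C c p) = Suc (card (part C c q))"
  shows "Suc (card (part V (swap c C) p)) = card (part V c p)"
    "card (part V (swap c C) q) = Suc (card (part V c q))"
proof -
  have "(\<Sum>D\<in>comps c - {C}. card (part D (swap c C) l)) = (\<Sum>D\<in>comps c - {C}. card (part D c l))" for l
    by (rule sum.cong) (auto simp: part_swap_other)
  then show "Suc (card (part V (swap c C) p)) = card (part V c p)"
    "card (part V (swap c C) q) = Suc (card (part V c q))"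
    using assms C by (elim disjE; simp add: part_comps comps_swap sum.remove[of "comps c" C] part_swap_same)+
qed

end

text \<open>By \<open>colorings_move_count\<close> the numbers of all colourings, proper or not,
  satisfy the same relation with equality. So the proportion of proper colourings does not drop when
  a vertex leaves the larger class.\<close>

lemma colorings_swap_count:
  assumes "finite K" "i \<in> K" "j \<in> K" "X i = Suc a" "X j = b" "b \<le> a"
  shows "Suc a * card {c \<in> colorings V K X. proper V Q c}
       \<le> Suc b * card {c \<in> colorings V K (X(i := a, j := Suc b)). proper V Q c}"
proof -
  define S where "S = {c \<in> colorings V K X. proper V Q c}"
  define S' where "S' = {c \<in> colorings V K (X(i := a, j := Suc b)). proper V Q c}"
  \<comment> \<open>A colouring \<open>c\<close> in \<open>S\<close> has \<open>Suc a - smin c\<close> outgoing swaps and one in \<open>S'\<close> has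
    \<open>Suc b - smin c\<close> incoming ones; \<open>smin\<close> is invariant, so this weight gives each element of \<open>S'\<close>
    total incoming weight at most \<open>1\<close>.\<close>
  define w where "w c = 1 / (real (Suc b) - real (smin c))" for c
  have finS: "finite S" "finite S'" unfolding S_def S'_def using fin assms by auto
  have Si: "Suc a = smin c + card (maj i j c)" "b = smin c + card (maj j i c)" if "c \<in> S" for c
    using that part_maj[of c] assms by (auto simp: S_def colorings_def)
  have Si': "Suc b = smin c + card (maj j i c)" if "c \<in> S'" for c
    using that part_maj[of c] assms ij by (auto simp: S'_def colorings_def)
  have fm: "finite (maj p q c)" for p q c by (simp add: maj_def)
  have "real (Suc a) / real (Suc b) \<le> real (card (maj i j c)) * w c" if "c \<in> S" for c
  proof -
    have "real (card (maj i j c)) = real (Suc a) - real (smin c)" "real (smin c) \<le> real b"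
      using Si[OF that] by linarith+
    moreover have "real (smin c) * real b \<le> real (smin c) * real a" using assms by (intro mult_left_mono) auto
    \<comment> \<open>Subtracting the same \<open>s\<close> from numerator and denominator does not
      decrease a fraction that is at least 1; \<open>s \<le> b\<close> keeps the denominator
      positive.\<close>
    moreover have "real (Suc a) / real (Suc b) \<le> (real (Suc a) - s) / (real (Suc b) - s)"
      if "s \<le> real b" "s * real b \<le> s * real a" for s
      using that by (simp add: divide_simps) (simp add: algebra_simps)
    ultimately show ?thesis unfolding w_def by simp
  qed
  then have "real (card S) * (real (Suc a) / real (Suc b)) \<le> (\<Sum>c\<in>S. real (card (maj i j c)) * w c)"
    using sum_mono[of S "\<lambda>_. real (Suc a) / real (Suc b)"] by simp
  also have "\<dots> = (\<Sum>(c, C)\<in>Sigma S (maj i j). w c)"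
    using finS fm by (simp flip: sum.Sigma)
  also have "\<dots> = (\<Sum>(c, C)\<in>Sigma S' (maj j i). w c)"
  \<comment> \<open>Swapping the same component twice is the identity, so one map serves as its own
    inverse.\<close>
  proof (rule sum.reindex_bij_witness[where i = "\<lambda>(c, C). (swap c C, C)" and j = "\<lambda>(c, C). (swap c C, C)"])
    fix p assume "p \<in> Sigma S (maj i j)"
    then obtain c C where p: "p = (c, C)" and c: "c \<in> S" and C: "C \<in> comps c"
      and m: "card (part C c i) = Suc (card (part C c j))" by (auto simp: maj_def)
    show "(case case p of (c, C) \<Rightarrow> (swap c C, C) of (c, C) \<Rightarrow> (swap c C, C)) = p"
      using p swap_swap[OF C] by simp
    show "(case case p of (c, C) \<Rightarrow> (swap c C, C) of (c, C) \<Rightarrow> w c) = (case p of (c, C) \<Rightarrow> w c)"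
      using p smin_swap[OF C] by (simp add: w_def)
    have "swap c C \<in> S'" using c card_part_swap[OF C _ m] part_swap[OF C] swap_PiE[OF C] proper_swap[OF C]
        assms ij by (auto simp: S_def S'_def colorings_def)
    then show "(case p of (c, C) \<Rightarrow> (swap c C, C)) \<in> Sigma S' (maj j i)"
      using p m C by (simp add: maj_def comps_swap part_swap_same)
  next
    fix p assume "p \<in> Sigma S' (maj j i)"
    then obtain c C where p: "p = (c, C)" and c: "c \<in> S'" and C: "C \<in> comps c"
      and m: "card (part C c j) = Suc (card (part C c i))" by (auto simp: maj_def)
    show "(case case p of (c, C) \<Rightarrow> (swap c C, C) of (c, C) \<Rightarrow> (swap c C, C)) = p"
      using p swap_swap[OF C] by simp
    have "card (part V (swap c C) l) = X l" if "l \<in> K" for l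
      using that c card_part_swap[OF C _ m] part_swap[OF C, of l] assms ij 
      by (cases "l = i"; cases "l = j") (auto simp: S'_def colorings_def)
    then have "swap c C \<in> S" using c swap_PiE[OF C] proper_swap[OF C]
        assms by (auto simp: S_def S'_def colorings_def)
    then show "(case p of (c, C) \<Rightarrow> (swap c C, C)) \<in> Sigma S (maj i j)"
      using p m C by (simp add: maj_def comps_swap part_swap_same)
  qed
  also have "\<dots> = (\<Sum>c\<in>S'. real (card (maj j i c)) * w c)"
    using finS fm by (simp flip: sum.Sigma)
  also have "\<dots> \<le> (\<Sum>c\<in>S'. 1)"
  proof (rule sum_mono)
    fix c assume "c \<in> S'"
    then have "real (card (maj j i c)) = real (Suc b) - real (smin c)" using Si' by fastforce
    \<comment> \<open>If \<open>smin c = Suc b\<close>, the weight is \<open>1 / 0 = 0\<close> and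
      the product vanishes; otherwise it equals 1.\<close>
    then show "real (card (maj j i c)) * w c \<le> 1" by (simp add: w_def)
  qed
  finally have "real (card S) * (real (Suc a) / real (Suc b)) \<le> real (card S')"
    by simp
  then have "real (card S) * real (Suc a) \<le> real (card S') * real (Suc b)"
    unfolding times_divide_eq_right by (subst (asm) pos_divide_le_eq) simp_all
  then have "card S * Suc a \<le> card S' * Suc b"
    unfolding of_nat_mult[symmetric] of_nat_le_iff .
  then show ?thesis unfolding S_def S'_def by (simp only: mult.commute)
qed

end

section \<open>Recolouring a single vertex\<close>

lemma card_part_fun_upd:
  assumes "finite V" "v \<in> part V c p" "p \<noteq> q"
  shows "card (part V (c(v := q)) l) = (if l = q then Suc (card (part V c l)) else
      if l = p then card (part V c l) - 1 else card (part V c l))"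
proof -
  have "part V (c(v := q)) l = (if l = q then insert v (part V c l) else
      if l = p then part V c l - {v} else part V c l)"
    using assms by (auto simp: part_def)
  moreover have "v \<notin> part V c q" using assms by (auto simp: part_def)
  ultimately show ?thesis using assms by (simp add: card_Diff_singleton)
qed

text \<open>Double counting of pairs of a colouring and a vertex of the class concerned: recolouring
  this vertex is a bijection between the two kinds of pairs, and on either side the number of
  vertices to choose from is constant.\<close>

lemma colorings_move_count:
  assumes "finite V" "finite K" "i \<in> K" "j \<in> K" "i \<noteq> j" "X i = Suc a" "X j = b"
  shows "Suc a * card (colorings V K X) = Suc b * card (colorings V K (X(i := a, j := Suc b)))"
proof -
  define S where "S = colorings V K X"
  define S' where "S' = colorings V K (X(i := a, j := Suc b))"
  have finS: "finite S" "finite S'" unfolding S_def S'_def using assms by auto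

  have e: "c(v := q) \<in> V \<rightarrow>\<^sub>E K" if "c \<in> V \<rightarrow>\<^sub>E K" "v \<in> V" "q \<in> K" for c v q
    using that by (auto simp: PiE_iff extensional_def)
  have V: "v \<in> V" if "v \<in> part V c l" for v c l using that by (simp add: part_def)
  have "card (SIGMA c:S. part V c i) = card (SIGMA c:S'. part V c j)"
  proof (rule bij_betw_same_card[of "\<lambda>(c, v). (c(v := j), v)"],
      rule bij_betw_byWitness[where f' = "\<lambda>(c, v). (c(v := i), v)"])
    show "(\<lambda>(c, v). (c(v := j), v)) ` (SIGMA c:S. part V c i) \<subseteq> (SIGMA c:S'. part V c j)"
    proof safe
      fix c v assume c: "c \<in> S" and v: "v \<in> part V c i"
      have "card (part V (c(v := j)) l) = (X(i := a, j := Suc b)) l" if "l \<in> K" for l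
        unfolding card_part_fun_upd[OF assms(1) v \<open>i \<noteq> j\<close>] using that c assms by (auto simp: S_def colorings_def)
      then show "c(v := j) \<in> S'" using c v e V assms by (simp add: S_def S'_def colorings_def)
      show "v \<in> part V (c(v := j)) j" using v by (simp add: part_def)
    qed
    show "(\<lambda>(c, v). (c(v := i), v)) ` (SIGMA c:S'. part V c j) \<subseteq> (SIGMA c:S. part V c i)"
    proof safe
      fix c v assume c: "c \<in> S'" and v: "v \<in> part V c j"
      have "card (part V (c(v := i)) l) = X l" if "l \<in> K" for l
        unfolding card_part_fun_upd[OF assms(1) v \<open>i \<noteq> j\<close>[symmetric]] using that c assms by (auto simp: S'_def colorings_def)
      then show "c(v := i) \<in> S" using c v e V assms by (simp add: S_def S'_def colorings_def)
      show "v \<in> part V (c(v := i)) i" using v by (simp add: part_def)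
    qed
  qed (auto simp: part_def)
  moreover have "card (SIGMA c:S. part V c i) = card S * Suc a"
    using finS assms by (simp add: S_def colorings_def)
  moreover have "card (SIGMA c:S'. part V c j) = card S' * Suc b"
    using finS assms by (simp add: S'_def colorings_def)
  ultimately show ?thesis by (simp add: S_def S'_def mult.commute)
qed

section \<open>Embeddings into complete multipartite graphs\<close>

text \<open>Adjacency in the host is an arbitrary relation, so the same set describes copies in a
  graph, in a multipartite host given by a colouring, and in a host with a cloned vertex.\<close>

definition emb :: "'a set \<Rightarrow> ('a \<Rightarrow> 'a \<Rightarrow> bool) \<Rightarrow> 'b set \<Rightarrow> ('b \<Rightarrow> 'b \<Rightarrow> bool) \<Rightarrow> ('a \<Rightarrow> 'b) set" where
  "emb W R V A = {\<phi> \<in> W \<rightarrow>\<^sub>E V. inj_on \<phi> W \<and> (\<forall>a\<in>W. \<forall>b\<in>W. R a b \<longrightarrow> A (\<phi> a) (\<phi> b))}"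

abbreviation emb_multi :: "'a set \<Rightarrow> ('a \<Rightarrow> 'a \<Rightarrow> bool) \<Rightarrow> 'b set \<Rightarrow> ('b \<Rightarrow> nat) \<Rightarrow> ('a \<Rightarrow> 'b) set" where
  "emb_multi W R V c \<equiv> emb W R V (\<lambda>x y. c x \<noteq> c y)"

lemma finite_emb [simp]: "finite W \<Longrightarrow> finite V \<Longrightarrow> finite (emb W R V A)"
  by (simp add: emb_def finite_PiE)

lemma card_emb_le:
  assumes "finite V'" "finite W" "inj_on \<pi> V" "\<pi> ` V \<subseteq> V'"
    and "\<And>x y. x \<in> V \<Longrightarrow> y \<in> V \<Longrightarrow> A x y \<Longrightarrow> A' (\<pi> x) (\<pi> y)"
  shows "card (emb W R V A) \<le> card (emb W R V' A')"
proof (rule card_inj_on_le[of "\<lambda>\<phi>. restrict (\<pi> \<circ> \<phi>) W"])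
  show "inj_on (\<lambda>\<phi>. restrict (\<pi> \<circ> \<phi>) W) (emb W R V A)"
  proof (rule inj_onI)
    fix f g assume fg: "f \<in> emb W R V A" "g \<in> emb W R V A" "restrict (\<pi> \<circ> f) W = restrict (\<pi> \<circ> g) W"
    show "f = g"
    proof (rule PiE_ext[of f W "\<lambda>_. V" g])
      fix x assume "x \<in> W"
      then have "\<pi> (f x) = \<pi> (g x)" "f x \<in> V" "g x \<in> V"
        using fg(1,2) fun_cong[OF fg(3), of x] by (auto simp: emb_def)
      then show "f x = g x" using assms(3) by (simp add: inj_on_def)
    qed (use fg in \<open>auto simp: emb_def\<close>)
  qed
  show "(\<lambda>\<phi>. restrict (\<pi> \<circ> \<phi>) W) ` emb W R V A \<subseteq> emb W R V' A'"
  proof safe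
    fix f assume f: "f \<in> emb W R V A"
    then have fV: "\<And>x. x \<in> W \<Longrightarrow> f x \<in> V" by (auto simp: emb_def)
    have "inj_on (\<pi> \<circ> f) W"
      using f assms(3) fV by (intro comp_inj_on) (auto simp: emb_def elim!: inj_on_subset)
    then show "restrict (\<pi> \<circ> f) W \<in> emb W R V' A'"
      using f fV assms by (auto simp: emb_def inj_on_def)
  qed
qed (use assms in simp)

lemma card_emb_bij:
  assumes "finite V" "finite V'" "finite W" "bij_betw \<pi> V V'"
    and "\<And>x y. x \<in> V \<Longrightarrow> y \<in> V \<Longrightarrow> A x y \<longleftrightarrow> A' (\<pi> x) (\<pi> y)"
  shows "card (emb W R V A) = card (emb W R V' A')"
proof (rule antisym)
  show "card (emb W R V A) \<le> card (emb W R V' A')"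
    using assms by (intro card_emb_le[of _ _ \<pi>]) (auto simp: bij_betw_def)
  have b: "bij_betw (inv_into V \<pi>) V' V" using assms by (simp add: bij_betw_inv_into)
  have "inv_into V \<pi> x \<in> V" "\<pi> (inv_into V \<pi> x) = x" if "x \<in> V'" for x
    using that assms(4) b bij_betw_apply bij_betw_inv_into_right by fastforce+
  then show "card (emb W R V' A') \<le> card (emb W R V A)"
    using assms b by (intro card_emb_le[of _ _ "inv_into V \<pi>"]) (auto simp: bij_betw_def)
qed

lemma ex_bij_parts:
  assumes "finite V" "finite V'" "c \<in> V \<rightarrow> K" "c' \<in> V' \<rightarrow> K"
    and "\<And>l. l \<in> K \<Longrightarrow> card (part V c l) = card (part V' c' l)"
  shows "\<exists>\<pi>. bij_betw \<pi> V V' \<and> (\<forall>x\<in>V. c' (\<pi> x) = c x)"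
proof -
  have "\<exists>f. bij_betw f (part V c l) (part V' c' l)" if "l \<in> K" for l
    using finite_same_card_bij assms that by (metis finite_part)
  then obtain f where f: "\<And>l. l \<in> K \<Longrightarrow> bij_betw (f l) (part V c l) (part V' c' l)" by metis
  have in_part: "x \<in> part V c (c x)" "c x \<in> K" if "x \<in> V" for x using that assms by (auto simp: part_def)
  have fp: "f (c x) x \<in> V'" "c' (f (c x) x) = c x" if "x \<in> V" for x
    using bij_betw_apply[OF f[of "c x"], of x] in_part[OF that] by (auto simp: part_def)
  have "bij_betw (\<lambda>x. f (c x) x) V V'"
  proof (rule bij_betw_imageI)
    show "inj_on (\<lambda>x. f (c x) x) V"
    proof (rule inj_onI)
      fix x y assume xy: "x \<in> V" "y \<in> V" "f (c x) x = f (c y) y"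
      then have c: "c x = c y" using fp by metis
      then show "x = y" using xy f[of "c x"] in_part[of x] in_part[of y]
        unfolding bij_betw_def inj_on_def by metis
    qed
    show "(\<lambda>x. f (c x) x) ` V = V'"
    proof
      show "V' \<subseteq> (\<lambda>x. f (c x) x) ` V"
      proof
        fix y assume y: "y \<in> V'"
        then have "y \<in> part V' c' (c' y)" "c' y \<in> K" using assms by (auto simp: part_def)
        then obtain x where x: "x \<in> part V c (c' y)" "f (c' y) x = y"
          using f[of "c' y"] unfolding bij_betw_def by (metis imageE)
        then show "y \<in> (\<lambda>x. f (c x) x) ` V" by (intro image_eqI[of _ _ x]) (auto simp: part_def)
      qed
    qed (use fp in auto)
  qed
  then show ?thesis using fp by blast
qed

text \<open>The class sizes determine the host up to isomorphism. This makes the average over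
  \<open>colorings V K X\<close> a single value.\<close>

lemma card_emb_multi_cong:
  assumes "finite V" "finite V'" "finite W" "c \<in> V \<rightarrow> K" "c' \<in> V' \<rightarrow> K"
    and "\<And>l. l \<in> K \<Longrightarrow> card (part V c l) = card (part V' c' l)"
  shows "card (emb_multi W R V c) = card (emb_multi W R V' c')"
proof -
  obtain \<pi> where "bij_betw \<pi> V V'" "\<forall>x\<in>V. c' (\<pi> x) = c x" using ex_bij_parts[OF assms(1,2,4-6)] by blast
  then show ?thesis by (intro card_emb_bij[OF assms(1-3)]) auto
qed

section \<open>Averaging over colourings\<close>

lemma sum_card_swap:
  assumes "finite S" "finite T"
  shows "(\<Sum>x\<in>S. card {y \<in> T. P x y}) = (\<Sum>y\<in>T. card {x \<in> S. P x y})"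
proof -
  have "(\<Sum>x\<in>S. card {y \<in> T. P x y}) = (\<Sum>x\<in>S. \<Sum>y\<in>T. if P x y then 1 else 0)"
    using assms by (simp add: sum.If_cases Int_def)
  also have "\<dots> = (\<Sum>y\<in>T. \<Sum>x\<in>S. if P x y then 1 else 0)" by (rule sum.swap)
  also have "\<dots> = (\<Sum>y\<in>T. card {x \<in> S. P x y})"
    using assms by (simp add: sum.If_cases Int_def)
  finally show ?thesis .
qed

text \<open>The pattern transported to the host. An injection embeds the pattern into the host of
  \<open>c\<close> exactly when \<open>c\<close> is proper for this relation, which exchanges the
  roles of map and colouring.\<close>

definition image_rel :: "'a set \<Rightarrow> ('a \<Rightarrow> 'a \<Rightarrow> bool) \<Rightarrow> ('a \<Rightarrow> 'b) \<Rightarrow> 'b \<Rightarrow> 'b \<Rightarrow> bool" where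
  "image_rel W R \<phi> x y \<longleftrightarrow> (\<exists>a\<in>W. \<exists>b\<in>W. R a b \<and> \<phi> a = x \<and> \<phi> b = y)"

lemma claw_free_image_rel:
  assumes "claw_free_rel W R" "inj_on \<phi> W"
  shows "claw_free_rel V (image_rel W R \<phi>)"
  unfolding claw_free_rel_def
proof (intro ballI impI)
  fix x y1 y2 y3
  assume d: "distinct [y1, y2, y3]" and "image_rel W R \<phi> x y1" "image_rel W R \<phi> x y2" "image_rel W R \<phi> x y3"
  then obtain a b1 a2 b2 a3 b3 where *: "a \<in> W" "b1 \<in> W" "a2 \<in> W" "b2 \<in> W" "a3 \<in> W" "b3 \<in> W"
    "R a b1" "R a2 b2" "R a3 b3" "\<phi> a = x" "\<phi> a2 = x" "\<phi> a3 = x" "\<phi> b1 = y1" "\<phi> b2 = y2" "\<phi> b3 = y3"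
    unfolding image_rel_def by blast
  then have "a2 = a" "a3 = a" using assms(2) by (auto simp: inj_on_def)
  moreover have "distinct [b1, b2, b3]" using d * by auto
  ultimately have "R b1 b2 \<or> R b1 b3 \<or> R b2 b3"
    using * assms(1)[unfolded claw_free_rel_def, rule_format, of a b1 b2 b3] by simp
  then show "image_rel W R \<phi> y1 y2 \<or> image_rel W R \<phi> y1 y3 \<or> image_rel W R \<phi> y2 y3"
    using * unfolding image_rel_def by blast
qed

lemma sum_emb_colorings:
  assumes "finite W" "finite V" "finite K"
  shows "(\<Sum>c\<in>colorings V K X. card (emb_multi W R V c)) =
    (\<Sum>\<phi>\<in>{\<phi> \<in> W \<rightarrow>\<^sub>E V. inj_on \<phi> W}. card {c \<in> colorings V K X. proper V (image_rel W R \<phi>) c})"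
proof -
  have "proper V (image_rel W R \<phi>) c \<longleftrightarrow> (\<forall>a\<in>W. \<forall>b\<in>W. R a b \<longrightarrow> c (\<phi> a) \<noteq> c (\<phi> b))"
    if "\<phi> \<in> W \<rightarrow>\<^sub>E V" for \<phi> c
    using that unfolding proper_def image_rel_def by (blast dest: PiE_mem)
  then have "emb_multi W R V c = {\<phi> \<in> {\<phi> \<in> W \<rightarrow>\<^sub>E V. inj_on \<phi> W}. proper V (image_rel W R \<phi>) c}" for c
    by (auto simp: emb_def)
  then show ?thesis using assms
    by (simp only:) (rule sum_card_swap, auto simp: finite_PiE)
qed

text \<open>Summing \<open>colorings_swap_count\<close> over all injections bounds
  \<open>Suc a\<close> times one total by \<open>Suc (X j)\<close> times another. Each total is a
  number of colourings times a constant number of embeddings, and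
  \<open>colorings_move_count\<close> cancels the factors.\<close>

lemma card_emb_move:
  assumes W: "finite W" "claw_free_rel W R" "\<And>a b. R a b \<Longrightarrow> R b a"
    and V: "finite V" "finite K" "c \<in> V \<rightarrow> K" "v \<in> V" "j \<in> K" "j \<noteq> c v"
    and less: "card (part V c j) < card (part V c (c v))"
  shows "card (emb_multi W R V c) \<le> card (emb_multi W R V (c(v := j)))"
proof -
  define i where "i = c v"
  define X where "X l = card (part V c l)" for l
  obtain a where a: "X i = Suc a" "X j \<le> a" using less unfolding X_def i_def
    by (cases "card (part V c (c v))") auto
  define X' where "X' = X(i := a, j := Suc (X j))"
  have iK: "i \<in> K" "j \<in> K" "i \<noteq> j" using V by (auto simp: i_def)
  have const: "card (emb_multi W R V d) = card (emb_multi W R V e)"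
    if "d \<in> colorings V K Y" "e \<in> V \<rightarrow> K" "\<And>l. l \<in> K \<Longrightarrow> card (part V e l) = Y l" for d e Y
    using that V W by (intro card_emb_multi_cong[of _ _ _ _ K]) (auto simp: colorings_def)
  have cX: "(\<Sum>d\<in>colorings V K X. card (emb_multi W R V d)) = card (colorings V K X) * card (emb_multi W R V c)"
    using const[of _ X c] V by (simp add: X_def)
  have up: "card (part V (c(v := j)) l) = X' l" if "l \<in> K" for l
    using card_part_fun_upd[of V v c i j l] V iK a by (auto simp: X'_def X_def i_def part_def)
  have "c(v := j) \<in> V \<rightarrow> K" using V by auto
  then have cX': "(\<Sum>d\<in>colorings V K X'. card (emb_multi W R V d)) = card (colorings V K X') * card (emb_multi W R V (c(v := j)))"
    using const[of _ X' "c(v := j)"] up by simp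
  let ?I = "{\<phi> \<in> W \<rightarrow>\<^sub>E V. inj_on \<phi> W}"
  \<comment> \<open>A witness that there are colourings at all, so that their number may be
    cancelled; the restriction makes \<open>c\<close> extensional.\<close>
  have "restrict c V \<in> colorings V K X"
  proof -
    have "part V (restrict c V) l = part V c l" for l by (auto simp: part_def)
    then show ?thesis using V by (auto simp: colorings_def X_def)
  qed
  then have pos: "card (colorings V K X) > 0" using V by (metis card_gt_0_iff empty_iff finite_colorings)
  have "Suc a * (card (colorings V K X) * card (emb_multi W R V c)) =
      (\<Sum>\<phi>\<in>?I. Suc a * card {d \<in> colorings V K X. proper V (image_rel W R \<phi>) d})"
    using sum_emb_colorings[OF W(1) V(1,2), of R X] unfolding cX by (simp add: sum_distrib_left del: mult_Suc)
  also have "\<dots> \<le> (\<Sum>\<phi>\<in>?I. Suc (X j) * card {d \<in> colorings V K X'. proper V (image_rel W R \<phi>) d})"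
  proof (rule sum_mono)
    fix \<phi> assume \<phi>: "\<phi> \<in> ?I"
    have "image_rel W R \<phi> y x" if "image_rel W R \<phi> x y" for x y
      using that W(3) unfolding image_rel_def by blast
    then interpret kempe V "image_rel W R \<phi>" i j
      using V(1) iK(3) \<phi> claw_free_image_rel[OF W(2)] by unfold_locales auto
    show "Suc a * card {d \<in> colorings V K X. proper V (image_rel W R \<phi>) d}
        \<le> Suc (X j) * card {d \<in> colorings V K X'. proper V (image_rel W R \<phi>) d}"
      unfolding X'_def using colorings_swap_count[of K X a "X j"] V iK a by blast
  qed
  also have "\<dots> = Suc (X j) * card (colorings V K X') * card (emb_multi W R V (c(v := j)))"
    using sum_emb_colorings[OF W(1) V(1,2), of R X'] unfolding cX'
    by (simp add: sum_distrib_left mult.assoc del: mult_Suc)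
  also have "Suc (X j) * card (colorings V K X') = Suc a * card (colorings V K X)"
    unfolding X'_def using colorings_move_count[of V K i j X a "X j"] V iK a by simp
  finally have "Suc a * card (colorings V K X) * card (emb_multi W R V c)
      \<le> Suc a * card (colorings V K X) * card (emb_multi W R V (c(v := j)))"
    by (simp only: mult.assoc)
  then show ?thesis using pos by (simp del: mult_Suc)
qed

lemma card_parts:
  assumes "finite V" "finite K" "c \<in> V \<rightarrow> K"
  shows "(\<Sum>l\<in>K. card (part V c l)) = card V"
proof -
  have "V = (\<Union>l\<in>K. part V c l)" using assms by (auto simp: part_def)
  moreover have "card (\<Union>l\<in>K. part V c l) = (\<Sum>l\<in>K. card (part V c l))"
    using assms by (intro card_UN_disjoint) (auto simp: part_def)
  ultimately show ?thesis by simp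
qed

text \<open>Moves from oversized to undersized classes lead from the sizes of \<open>c\<close> to
  those of \<open>t\<close>. Balance of \<open>t\<close> ensures that each such move goes from a
  larger class to a smaller one, so that \<open>card_emb_move\<close> applies.\<close>

lemma card_emb_le_balanced:
  assumes W: "finite W" "claw_free_rel W R" "\<And>a b. R a b \<Longrightarrow> R b a"
    and V: "finite V" "finite V'" "card V = card V'" "finite K" "c \<in> V \<rightarrow> K" "t \<in> V' \<rightarrow> K"
    and J: "\<And>l. l \<in> K - J \<Longrightarrow> card (part V c l) = card (part V' t l)"
    and bal: "\<And>p q. p \<in> J \<Longrightarrow> q \<in> J \<Longrightarrow> card (part V' t p) \<le> Suc (card (part V' t q))"
  shows "card (emb_multi W R V c) \<le> card (emb_multi W R V' t)"
  using V(5) J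
\<comment> \<open>Truncated subtraction makes this the total excess of the oversized
  classes.\<close>
proof (induction "\<Sum>l\<in>K. card (part V c l) - card (part V' t l)" arbitrary: c rule: less_induct)
  case less
  have sums: "(\<Sum>l\<in>K. card (part V c l)) = (\<Sum>l\<in>K. card (part V' t l))"
    using card_parts V less.prems by metis
  show ?case
  proof (cases "\<forall>l\<in>K. card (part V c l) \<le> card (part V' t l)")
    case True
    then have "card (part V c l) = card (part V' t l)" if "l \<in> K" for l
      using sum_mono_inv[OF sums _ that V(4)] True by blast
    then show ?thesis using card_emb_multi_cong[OF V(1,2) W(1) less.prems(1) V(6)] by simp
  next
    case False
    then obtain i where i: "i \<in> K" "card (part V' t i) < card (part V c i)" by force
    have "\<exists>j\<in>K. card (part V c j) < card (part V' t j)"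
    proof (rule ccontr)
      assume "\<not> ?thesis"
      then have "\<forall>j\<in>K. card (part V' t j) \<le> card (part V c j)" by force
      then show False using sum_mono_inv[OF sums[symmetric] _ i(1) V(4)] i(2) by simp
    qed
    then obtain j where j: "j \<in> K" "card (part V c j) < card (part V' t j)" by blast
    have "i \<in> J" "j \<in> J" using i j less.prems(2) by (metis DiffI less_irrefl)+
    have ij: "j \<noteq> i" using i j by auto
    \<comment> \<open>By balance the undersized class has at most \<open>card (part V' t i)\<close>
      elements, and the oversized one has more.\<close>
    have lt: "card (part V c j) < card (part V c i)" using bal[OF \<open>j \<in> J\<close> \<open>i \<in> J\<close>] i j by linarith
    then obtain v where v: "v \<in> part V c i" by (metis card.empty ex_in_conv not_less_zero)
    then have vV: "v \<in> V" "c v = i" by (auto simp: part_def)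
    note up = card_part_fun_upd[OF V(1) v ij[symmetric]]
    have "(\<Sum>l\<in>K. card (part V (c(v := j)) l) - card (part V' t l))
        < (\<Sum>l\<in>K. card (part V c l) - card (part V' t l))"
      using i j ij lt V(4) by (intro sum_strict_mono_ex1) (auto simp: up)
    moreover have "c(v := j) \<in> V \<rightarrow> K" using less.prems j by auto
    moreover have "card (part V (c(v := j)) l) = card (part V' t l)" if "l \<in> K - J" for l
      using that less.prems(2)[OF that] \<open>i \<in> J\<close> \<open>j \<in> J\<close> by (auto simp: up)
    ultimately have "card (emb_multi W R V (c(v := j))) \<le> card (emb_multi W R V' t)"
      by (rule less.hyps)
    moreover have "card (emb_multi W R V c) \<le> card (emb_multi W R V (c(v := j)))"
      using card_emb_move[OF W V(1,4) less.prems(1) vV(1) j(1)] ij lt vV(2) by simp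
    ultimately show ?thesis by simp
  qed
qed

section \<open>Counting maps; small parts are costly\<close>

text \<open>The values are chosen one after another: at any time at most \<open>card W\<close>
  elements of \<open>X w\<close> are taken, so at least \<open>N w\<close> choices remain.\<close>

lemma card_inj_PiE_ge:
  assumes "finite W" "\<And>w. w \<in> W \<Longrightarrow> finite (X w) \<and> N w + card W \<le> card (X w)"
  shows "(\<Prod>w\<in>W. N w) \<le> card {\<phi> \<in> Pi\<^sub>E W X. inj_on \<phi> W}"
  using assms
proof (induction W rule: finite_induct)
  case empty
  have "{\<phi> \<in> Pi\<^sub>E {} X. inj_on \<phi> {}} = {\<lambda>_. undefined}" by auto
  then show ?case by simp
next
  case (insert w W)
  define S where "S = {\<phi> \<in> Pi\<^sub>E W X. inj_on \<phi> W}"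
  have fX: "\<And>u. u \<in> insert w W \<Longrightarrow> finite (X u)" using insert.prems by blast
  have fS: "finite S" unfolding S_def using insert.hyps fX by (simp add: finite_PiE)
  have IH: "(\<Prod>w\<in>W. N w) \<le> card S"
    unfolding S_def using insert.prems insert.hyps by (intro insert.IH) fastforce
  have N: "N w \<le> card (X w - \<phi> ` W)" for \<phi>
  proof -
    have "card (X w) - card (\<phi> ` W) \<le> card (X w - \<phi> ` W)"
      using insert.hyps by (intro diff_card_le_card_Diff) auto
    moreover have "card (\<phi> ` W) \<le> card W" using insert.hyps by (intro card_image_le)
    moreover have "Suc (N w + card W) \<le> card (X w)" using insert.prems[of w] insert.hyps by simp
    ultimately show ?thesis by linarith
  qed
  have "(\<Prod>u\<in>insert w W. N u) \<le> (\<Sum>\<phi>\<in>S. N w)" using insert.hyps IH by simp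
  also have "\<dots> \<le> (\<Sum>\<phi>\<in>S. card (X w - \<phi> ` W))" by (intro sum_mono N)
  also have "\<dots> = card (SIGMA \<phi>:S. X w - \<phi> ` W)" using fS fX by simp
  also have "\<dots> \<le> card {\<phi> \<in> Pi\<^sub>E (insert w W) X. inj_on \<phi> (insert w W)}"
  proof (rule card_inj_on_le[of "\<lambda>(\<phi>, x). \<phi>(w := x)"])
    show "inj_on (\<lambda>(\<phi>, x). \<phi>(w := x)) (SIGMA \<phi>:S. X w - \<phi> ` W)"
    proof (rule inj_onI)
      fix p q assume "p \<in> (SIGMA \<phi>:S. X w - \<phi> ` W)" "q \<in> (SIGMA \<phi>:S. X w - \<phi> ` W)"
        "(case p of (\<phi>, x) \<Rightarrow> \<phi>(w := x)) = (case q of (\<phi>, x) \<Rightarrow> \<phi>(w := x))"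
      then obtain f x g y where pq: "p = (f, x)" "q = (g, y)"
        and f: "f \<in> S" and g: "g \<in> S" and eq: "f(w := x) = g(w := y)" by auto
      have "f u = g u" for u
      proof (cases "u = w")
        case True
        then show ?thesis using f g insert.hyps unfolding S_def by (auto simp: PiE_iff extensional_def)
      next
        case False
        then show ?thesis using fun_cong[OF eq, of u] by simp
      qed
      then show "p = q" using pq fun_cong[OF eq, of w] by auto
    qed
    show "(\<lambda>(\<phi>, x). \<phi>(w := x)) ` (SIGMA \<phi>:S. X w - \<phi> ` W) \<subseteq> {\<phi> \<in> Pi\<^sub>E (insert w W) X. inj_on \<phi> (insert w W)}"
    proof clarify
      fix f x assume f: "f \<in> S" and x: "x \<in> X w" "x \<notin> f ` W"
      have "f(w := x) \<in> Pi\<^sub>E (insert w W) X" using f x by (auto simp: S_def PiE_iff extensional_def)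
      moreover have "inj_on (f(w := x)) (insert w W)"
        using f x insert.hyps by (auto simp: S_def inj_on_def)
      ultimately show "f(w := x) \<in> Pi\<^sub>E (insert w W) X \<and> inj_on (f(w := x)) (insert w W)" ..
    qed
    show "finite {\<phi> \<in> Pi\<^sub>E (insert w W) X. inj_on \<phi> (insert w W)}"
      using insert.hyps fX by (intro finite_subset[OF _ finite_PiE[of "insert w W" X]]) auto
  qed
  finally show ?case .
qed

text \<open>The code \<open>\<kappa> \<phi>\<close> determines the map on \<open>B\<close>; each
  vertex outside \<open>B\<close> has at most \<open>card V\<close> values.\<close>

lemma card_maps_le:
  assumes "finite W" "finite V" "finite T" "B \<subseteq> W" "S \<subseteq> W \<rightarrow>\<^sub>E V" "\<kappa> ` S \<subseteq> T"
    and det: "\<And>\<phi> \<psi> b. \<phi> \<in> S \<Longrightarrow> \<psi> \<in> S \<Longrightarrow> \<kappa> \<phi> = \<kappa> \<psi> \<Longrightarrow> b \<in> B \<Longrightarrow> \<phi> b = \<psi> b"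
  shows "card S \<le> card T * card V ^ (card W - card B)"
proof -
  have "card S \<le> card (T \<times> ((W - B) \<rightarrow>\<^sub>E V))"
  proof (rule card_inj_on_le[of "\<lambda>\<phi>. (\<kappa> \<phi>, restrict \<phi> (W - B))"])
    show "inj_on (\<lambda>\<phi>. (\<kappa> \<phi>, restrict \<phi> (W - B))) S"
    proof (rule inj_onI)
      fix f g assume f: "f \<in> S" and g: "g \<in> S"
        and eq: "(\<kappa> f, restrict f (W - B)) = (\<kappa> g, restrict g (W - B))"
      show "f = g"
      proof (rule PiE_ext[of f W "\<lambda>_. V" g])
        fix x assume "x \<in> W"
        have "restrict f (W - B) x = restrict g (W - B) x" using eq by simp
        then show "f x = g x" using det[OF f g, of x] eq \<open>x \<in> W\<close> by (cases "x \<in> B") auto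
      qed (use f g assms in auto)
    qed
    show "(\<lambda>\<phi>. (\<kappa> \<phi>, restrict \<phi> (W - B))) ` S \<subseteq> T \<times> ((W - B) \<rightarrow>\<^sub>E V)"
      using assms(5,6) by (auto simp: PiE_iff subset_iff)
    show "finite (T \<times> ((W - B) \<rightarrow>\<^sub>E V))"
      using assms by (auto intro: finite_PiE)
  qed
  also have "\<dots> = card T * card V ^ (card W - card B)"
    using assms by (simp add: card_cartesian_product card_PiE card_Diff_subset finite_subset)
  finally show ?thesis .
qed

lemma card_UN_le_mult:
  assumes "finite I" "\<And>x. x \<in> I \<Longrightarrow> card (F x) \<le> m"
  shows "card (\<Union>x\<in>I. F x) \<le> card I * m"
proof -
  have "card (\<Union>x\<in>I. F x) \<le> (\<Sum>x\<in>I. card (F x))" by (rule card_UN_le[OF assms(1)])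
  also have "\<dots> \<le> card I * m" using assms(2) sum_bounded_above[of I "\<lambda>x. card (F x)" m] by simp
  finally show ?thesis .
qed

text \<open>The basic error estimate: if \<open>D\<close> holds at most \<epsilon> n^2 bad pairs,
  then at most h^2 \<epsilon> n^h maps hit one, with n and h the sizes of \<open>V\<close> and
  \<open>W\<close>. The factor h^2 counts the places for the pair.\<close>

lemma card_maps_pair_le:
  assumes "finite W" "finite V" "finite D"
  shows "card {\<phi> \<in> W \<rightarrow>\<^sub>E V. \<exists>a\<in>W. \<exists>b\<in>W. a \<noteq> b \<and> (\<phi> a, \<phi> b) \<in> D}
    \<le> (card W)\<^sup>2 * (card D * card V ^ (card W - 2))"
proof -
  let ?I = "{(a, b). a \<in> W \<and> b \<in> W \<and> a \<noteq> b}"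
  let ?F = "\<lambda>(a, b). {\<phi> \<in> W \<rightarrow>\<^sub>E V. (\<phi> a, \<phi> b) \<in> D}"
  have I: "?I \<subseteq> W \<times> W" by auto
  then have "finite ?I" using assms finite_subset by blast
  moreover have "card (?F p) \<le> card D * card V ^ (card W - 2)" if p: "p \<in> ?I" for p
  proof -
    obtain a b where ab: "p = (a, b)" "a \<in> W" "b \<in> W" "a \<noteq> b" using p by auto
    then have "card {\<phi> \<in> W \<rightarrow>\<^sub>E V. (\<phi> a, \<phi> b) \<in> D} \<le> card D * card V ^ (card W - card {a, b})"
      using assms by (intro card_maps_le[where \<kappa> = "\<lambda>\<phi>. (\<phi> a, \<phi> b)"]) auto
    then show ?thesis using ab by (simp add: numeral_2_eq_2)
  qed
  ultimately have "card (\<Union>p\<in>?I. ?F p) \<le> card ?I * (card D * card V ^ (card W - 2))"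
    by (rule card_UN_le_mult)
  also have "\<dots> \<le> card (W \<times> W) * (card D * card V ^ (card W - 2))"
    using I assms by (intro mult_le_mono1 card_mono) auto
  also have "(\<Union>p\<in>?I. ?F p) = {\<phi> \<in> W \<rightarrow>\<^sub>E V. \<exists>a\<in>W. \<exists>b\<in>W. a \<noteq> b \<and> (\<phi> a, \<phi> b) \<in> D}" by auto
  finally show ?thesis by (simp add: card_cartesian_product power2_eq_square)
qed

text \<open>The same estimate for maps through a given vertex \<open>x\<close>: the pair is placed
  away from the preimage of \<open>x\<close>, so three values are restricted and three powers are
  saved.\<close>

lemma card_maps_triple_le:
  assumes "finite W" "finite V" "finite D"
  shows "card {\<phi> \<in> W \<rightarrow>\<^sub>E V. \<exists>w\<in>W. \<exists>a\<in>W. \<exists>b\<in>W. w \<noteq> a \<and> w \<noteq> b \<and> a \<noteq> b \<and> \<phi> w = x \<and> (\<phi> a, \<phi> b) \<in> D}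
    \<le> card W ^ 3 * (card D * card V ^ (card W - 3))"
proof -
  let ?I = "{(w, a, b). w \<in> W \<and> a \<in> W \<and> b \<in> W \<and> w \<noteq> a \<and> w \<noteq> b \<and> a \<noteq> b}"
  let ?F = "\<lambda>(w, a, b). {\<phi> \<in> W \<rightarrow>\<^sub>E V. \<phi> w = x \<and> (\<phi> a, \<phi> b) \<in> D}"
  have I: "?I \<subseteq> W \<times> W \<times> W" by auto
  then have "finite ?I" using assms finite_subset by blast
  moreover have "card (?F p) \<le> card D * card V ^ (card W - 3)" if p: "p \<in> ?I" for p
  proof -
    obtain w a b where ab: "p = (w, a, b)" "w \<in> W" "a \<in> W" "b \<in> W" "w \<noteq> a" "w \<noteq> b" "a \<noteq> b" using p by auto
    then have "card {\<phi> \<in> W \<rightarrow>\<^sub>E V. \<phi> w = x \<and> (\<phi> a, \<phi> b) \<in> D} \<le> card D * card V ^ (card W - card {w, a, b})"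
      using assms by (intro card_maps_le[where \<kappa> = "\<lambda>\<phi>. (\<phi> a, \<phi> b)"]) auto
    then show ?thesis using ab by (simp add: numeral_3_eq_3)
  qed
  ultimately have "card (\<Union>p\<in>?I. ?F p) \<le> card ?I * (card D * card V ^ (card W - 3))"
    by (rule card_UN_le_mult)
  also have "\<dots> \<le> card (W \<times> W \<times> W) * (card D * card V ^ (card W - 3))"
    using I assms by (intro mult_le_mono1 card_mono) auto
  also have "(\<Union>p\<in>?I. ?F p) = {\<phi> \<in> W \<rightarrow>\<^sub>E V. \<exists>w\<in>W. \<exists>a\<in>W. \<exists>b\<in>W. w \<noteq> a \<and> w \<noteq> b \<and> a \<noteq> b \<and> \<phi> w = x \<and> (\<phi> a, \<phi> b) \<in> D}"
    by auto
  finally show ?thesis by (simp add: card_cartesian_product power3_eq_cube mult.assoc)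
qed

section \<open>The cost of a small class\<close>

definition emb_crossing :: "'a set \<Rightarrow> ('a \<Rightarrow> 'a \<Rightarrow> bool) \<Rightarrow> 'b set \<Rightarrow> ('b \<Rightarrow> nat) \<Rightarrow> nat \<Rightarrow> nat \<Rightarrow> ('a \<Rightarrow> 'b) set" where
  "emb_crossing W R V c i j =
    {\<phi> \<in> emb_multi W R V c. \<exists>a\<in>W. \<exists>b\<in>W. R a b \<and> c (\<phi> a) = i \<and> c (\<phi> b) = j}"

text \<open>The first summand depends only on the size of the union of classes \<open>i\<close> and \<open>j\<close>, so all gain
  from balancing the two classes is in the crossing embeddings.\<close>

lemma card_emb_multi_merge:
  assumes "finite W" "finite V" "i \<noteq> j" and sym: "\<And>a b. R a b \<Longrightarrow> R b a"
  shows "card (emb_multi W R V c) =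
    card (emb_multi W R V (\<lambda>v. if c v = j then i else c v)) + card (emb_crossing W R V c i j)"
proof -
  let ?m = "\<lambda>v. if c v = j then i else c v"
  have "emb_multi W R V c = emb_multi W R V ?m \<union> emb_crossing W R V c i j"
  proof (intro set_eqI iffI)
    fix \<phi> assume \<phi>: "\<phi> \<in> emb_multi W R V c"
    show "\<phi> \<in> emb_multi W R V ?m \<union> emb_crossing W R V c i j"
    proof (cases "\<phi> \<in> emb_crossing W R V c i j")
      case False
      then have "\<not> (R a b \<and> c (\<phi> a) = i \<and> c (\<phi> b) = j)" if "a \<in> W" "b \<in> W" for a b
        using that \<phi> unfolding emb_crossing_def by blast
      then have "?m (\<phi> a) \<noteq> ?m (\<phi> b)" if "a \<in> W" "b \<in> W" "R a b" for a b
        using that sym[of a b] \<phi> unfolding emb_def by (smt (verit) mem_Collect_eq)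
      then show ?thesis using \<phi> by (auto simp: emb_def)
    qed simp
  next
    fix \<phi> assume "\<phi> \<in> emb_multi W R V ?m \<union> emb_crossing W R V c i j"
    then show "\<phi> \<in> emb_multi W R V c" by (auto simp: emb_crossing_def emb_def) metis
  qed
  moreover have "emb_multi W R V ?m \<inter> emb_crossing W R V c i j = {}"
    by (auto simp: emb_crossing_def emb_def)
  moreover have "finite (emb_crossing W R V c i j)" using assms by (simp add: emb_crossing_def)
  ultimately show ?thesis using assms(1,2) by (simp add: card_Un_disjoint)
qed

text \<open>A crossing embedding places a vertex in class \<open>j\<close>, so a small class
  \<open>j\<close> admits few of them.\<close>

lemma card_emb_crossing_le:
  assumes "finite W" "finite V" and "\<And>a. \<not> R a a"
  shows "card (emb_crossing W R V c i j) \<le> (card W)\<^sup>2 * (card V * card (part V c j) * card V ^ (card W - 2))"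
proof -
  have "emb_crossing W R V c i j \<subseteq>
    {\<phi> \<in> W \<rightarrow>\<^sub>E V. \<exists>a\<in>W. \<exists>b\<in>W. a \<noteq> b \<and> (\<phi> a, \<phi> b) \<in> V \<times> part V c j}" (is "_ \<subseteq> ?S")
  proof
    fix \<phi> assume "\<phi> \<in> emb_crossing W R V c i j"
    then obtain a b where *: "\<phi> \<in> W \<rightarrow>\<^sub>E V" "a \<in> W" "b \<in> W" "R a b" "c (\<phi> b) = j"
      unfolding emb_crossing_def emb_def by blast
    then have "\<phi> a \<in> V" "\<phi> b \<in> part V c j" by (auto simp: part_def)
    moreover have "a \<noteq> b" using * assms(3) by auto
    ultimately show "\<phi> \<in> ?S" using * by blast
  qed
  then have "card (emb_crossing W R V c i j) \<le> card ?S"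
    using assms by (intro card_mono) (simp add: finite_PiE)
  also have "\<dots> \<le> (card W)\<^sup>2 * (card (V \<times> part V c j) * card V ^ (card W - 2))"
    using assms by (intro card_maps_pair_le) auto
  finally show ?thesis by (simp add: card_cartesian_product)
qed

lemma ex_proper_prescribed:
  assumes "\<chi> \<in> W \<rightarrow> K" "proper W R \<chi>" "a \<in> W" "b \<in> W" "R a b" "i \<in> K" "j \<in> K" "i \<noteq> j"
  obtains \<chi>' where "\<chi>' \<in> W \<rightarrow> K" "proper W R \<chi>'" "\<chi>' a = i" "\<chi>' b = (j::nat)"
proof -
  \<comment> \<open>The first transposition moves \<open>\<chi> a\<close> to \<open>i\<close> and
    \<open>\<chi> b\<close> to some \<open>p \<noteq> i\<close>; the second moves \<open>p\<close>
    to \<open>j\<close> and, since \<open>j \<noteq> i\<close>, fixes \<open>i\<close>.\<close>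
  define p where "p = transpose (\<chi> a) i (\<chi> b)"
  define \<pi> where "\<pi> = transpose p j \<circ> transpose (\<chi> a) i"
  have ne: "\<chi> a \<noteq> \<chi> b" using assms by (auto simp: proper_def)
  have "p \<noteq> i" using ne by (auto simp: p_def transpose_def)
  have inj: "\<pi> x = \<pi> y \<longleftrightarrow> x = y" for x y
    using inj_eq[of \<pi> x y] by (simp add: \<pi>_def inj_compose)
  have "p \<in> K" using assms by (auto simp: p_def transpose_def)
  then have "\<pi> x \<in> K" if "x \<in> K" for x
    using that assms by (auto simp: \<pi>_def transpose_def)
  moreover have "\<pi> (\<chi> a) = i" "\<pi> (\<chi> b) = j"
    using \<open>p \<noteq> i\<close> assms(8) by (simp_all add: \<pi>_def p_def[symmetric])
  ultimately show ?thesis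
    using assms inj by (intro that[of "\<pi> \<circ> \<chi>"]) (auto simp: proper_def Pi_iff)
qed

text \<open>Among the colourings that lose no embeddings and keep class \<open>j\<close>, one with
  the least sum of squared class sizes works: two other classes differing by 2 or more would allow a
  move that lowers this sum.\<close>

lemma ex_balanced_except:
  assumes W: "finite W" "claw_free_rel W R" "\<And>a b. R a b \<Longrightarrow> R b a"
    and V: "finite V" "finite K" "c \<in> V \<rightarrow> K"
  obtains d where "d \<in> V \<rightarrow> K" "card (emb_multi W R V c) \<le> card (emb_multi W R V d)"
    "part V d j = part V c j"
    "\<And>p q. p \<in> K - {j} \<Longrightarrow> q \<in> K - {j} \<Longrightarrow> card (part V d p) \<le> Suc (card (part V d q))"
proof -
  define P where "P d \<longleftrightarrow> d \<in> V \<rightarrow> K \<and> card (emb_multi W R V c) \<le> card (emb_multi W R V d) \<and>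
    part V d j = part V c j" for d
  define sq where "sq d = (\<Sum>l\<in>K. (card (part V d l))\<^sup>2)" for d
  have "P c" using V by (simp add: P_def)
  then obtain d where d: "P d" and min: "\<And>e. P e \<Longrightarrow> sq d \<le> sq e"
    using ex_has_least_nat[of P c sq] by blast
  have "card (part V d p) \<le> Suc (card (part V d q))" if pq: "p \<in> K - {j}" "q \<in> K - {j}" for p q
  proof (rule ccontr)
    assume "\<not> ?thesis"
    then have lt: "card (part V d p) \<ge> Suc (Suc (card (part V d q)))" by simp
    then obtain v where v: "v \<in> part V d p" by (metis card.empty ex_in_conv not_less_eq_eq zero_le)
    have ne: "p \<noteq> q" using lt by auto
    let ?e = "d(v := q)"
    note up = card_part_fun_upd[OF V(1) v ne]
    have vV: "v \<in> V" "d v = p" using v by (auto simp: part_def)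
    have "card (emb_multi W R V d) \<le> card (emb_multi W R V ?e)"
      using card_emb_move[OF W V(1,2), of d v q] d pq vV ne lt by (auto simp: P_def)
    moreover have "part V ?e j = part V d j" using pq vV by (auto simp: part_def)
    ultimately have "P ?e" using d pq by (auto simp: P_def)
    then have "sq d \<le> sq ?e" by (rule min)
    moreover have "sq f = (card (part V f p))\<^sup>2 + ((card (part V f q))\<^sup>2 + (\<Sum>l\<in>K - {p} - {q}. (card (part V f l))\<^sup>2))" for f
      unfolding sq_def using pq ne V(2) by (simp add: sum.remove[of K p] sum.remove[of "K - {p}" q])
    moreover have "(\<Sum>l\<in>K - {p} - {q}. (card (part V ?e l))\<^sup>2) = (\<Sum>l\<in>K - {p} - {q}. (card (part V d l))\<^sup>2)"
      by (rule sum.cong) (auto simp: up)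
    ultimately have le: "(card (part V d p))\<^sup>2 + (card (part V d q))\<^sup>2 \<le> (card (part V d p) - 1)\<^sup>2 + (Suc (card (part V d q)))\<^sup>2"
      using ne by (simp add: up)
    obtain m where m: "card (part V d p) = Suc m" "m > card (part V d q)" using lt by (cases "card (part V d p)") auto
    show False using le m by (simp add: power2_eq_square)
  qed
  then show ?thesis using d that unfolding P_def by blast
qed

text \<open>After the classes other than \<open>j\<close> are balanced, half of some class
  \<open>i\<close> is moved into \<open>j\<close>. By \<open>card_emb_multi_merge\<close> only the
  crossing embeddings change in number. They were at most h^2 \<delta> n^h, as class
  \<open>j\<close> was small, and become at least (n / 4k)^h, as all classes are now large; \<delta>
  makes the former bound half of the latter.\<close>

lemma small_part_deficit:
  fixes \<delta> :: real
  assumes W: "finite W" "claw_free_rel W R" "\<And>a b. R a b \<Longrightarrow> R b a" "\<And>a. \<not> R a a"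
    and edge: "a \<in> W" "b \<in> W" "R a b" and \<chi>: "\<chi> \<in> W \<rightarrow> {..<k}" "proper W R \<chi>"
    and V: "finite V" "c \<in> V \<rightarrow> {..<k}" "finite V'" "card V' = card V" "t \<in> V' \<rightarrow> {..<k}"
    and bal: "\<And>p q. p < k \<Longrightarrow> q < k \<Longrightarrow> card (part V' t p) \<le> Suc (card (part V' t q))"
    and large: "4 * k * (card W + 2) \<le> card V"
    and j: "j < k" "real (card (part V c j)) \<le> \<delta> * card V"
    and \<delta>: "\<delta> = (1 / (4 * real k)) ^ card W / (2 * (card W)\<^sup>2)"
  shows "real (card (emb_multi W R V c)) + (1 / (4 * real k)) ^ card W / 2 * real (card V) ^ card W
    \<le> card (emb_multi W R V' t)"
proof -
  define n h where "n = card V" and "h = card W"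
  have K: "finite {..<k}" by simp
  obtain d where d: "d \<in> V \<rightarrow> {..<k}" "card (emb_multi W R V c) \<le> card (emb_multi W R V d)"
    "part V d j = part V c j"
    and dbal: "\<And>p q. p \<in> {..<k} - {j} \<Longrightarrow> q \<in> {..<k} - {j} \<Longrightarrow> card (part V d p) \<le> Suc (card (part V d q))"
    using ex_balanced_except[OF W(1-3) V(1) K V(2), of j] by metis
  have "\<chi> a \<noteq> \<chi> b" "\<chi> a < k" "\<chi> b < k" using \<chi> edge by (auto simp: proper_def)
  then obtain i where i: "i < k" "i \<noteq> j" by metis
  have h2: "h \<ge> 2"
  proof -
    have "card {a, b} \<le> h" unfolding h_def using edge W by (intro card_mono) auto
    moreover have "a \<noteq> b" using W(4) edge by auto
    ultimately show ?thesis by simp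
  qed
  have npos: "n > 0" using large j by (simp add: n_def)
  \<comment> \<open>Hence class \<open>j\<close> lies below the average size n / k, so a class of at
    least average size is among the balanced ones.\<close>
  have \<delta>k: "\<delta> < 1 / k"
  proof -
    have "1 \<le> (real h)\<^sup>2" using h2 by (intro one_le_power) simp
    then have "1 \<le> 2 * (real h)\<^sup>2" by linarith
    then have "\<delta> \<le> (1 / (4 * real k)) ^ h" unfolding \<delta> h_def[symmetric]
      using divide_left_mono[of 1 "2 * (real h)\<^sup>2" "(1 / (4 * real k)) ^ h"] h2 by simp
    also have "\<dots> \<le> (1 / (4 * real k)) ^ 1" using h2 j by (intro power_decreasing) auto
    also have "\<dots> < 1 / k" using j by (simp add: field_simps)
    finally show ?thesis .
  qed
  have "\<exists>p<k. n \<le> k * card (part V d p)"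
  proof (rule ccontr)
    assume "\<not> ?thesis"
    then have "(\<Sum>p<k. k * card (part V d p)) < (\<Sum>p<k. n)"
      using j by (intro sum_strict_mono) auto
    then show False using card_parts[OF V(1) K d(1)] by (simp add: n_def flip: sum_distrib_left)
  qed
  then obtain p where p: "p < k" "n \<le> k * card (part V d p)" by blast
  have "p \<noteq> j"
  proof
    assume "p = j"
    then have "real n \<le> k * (\<delta> * n)" using p d j
      by (smt (verit) mult_left_mono n_def of_nat_0_le_iff of_nat_le_iff of_nat_mult)
    also have "\<dots> < k * (1 / k * n)" using \<delta>k npos j by (intro mult_strict_left_mono mult_strict_right_mono) auto
    finally show False using j by simp
  qed
  have big: "n \<le> k * Suc (card (part V d q))" if "q < k" "q \<noteq> j" for q
  proof -
    have "k * card (part V d p) \<le> k * Suc (card (part V d q))"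
      using dbal[of p q] that p \<open>p \<noteq> j\<close> by (intro mult_le_mono2) auto
    then show ?thesis using p by linarith
  qed
  obtain S where S: "S \<subseteq> part V d i" "card S = card (part V d i) div 2"
    by (meson div_le_dividend obtain_subset_with_card_n)
  define e where "e v = (if v \<in> S then j else d v)" for v
  have eK: "e \<in> V \<rightarrow> {..<k}" using d j by (auto simp: e_def)
  \<comment> \<open>Moving vertices between \<open>i\<close> and \<open>j\<close> is invisible once
    the two classes are identified.\<close>
  have merge: "(\<lambda>v. if e v = j then i else e v) = (\<lambda>v. if d v = j then i else d v)"
    using S i by (intro ext) (auto simp: e_def part_def)
  have fS: "finite S" using S V finite_subset finite_part by metis
  have ei: "card (part V d q) \<le> 2 * card (part V e q) + 1" if "q < k" "q \<noteq> j" for q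
  proof (cases "q = i")
    case True
    have "part V e i = part V d i - S" using i by (auto simp: e_def part_def)
    then show ?thesis using S fS True by (simp add: card_Diff_subset)
  next
    case False
    then have "part V e q = part V d q" using S that by (auto simp: e_def part_def)
    then show ?thesis by simp
  qed
  have ej: "card (part V d i) \<le> 2 * card (part V e j) + 1"
  proof -
    have "S \<subseteq> part V e j" using S by (auto simp: e_def part_def)
    then have "card S \<le> card (part V e j)" using V by (intro card_mono) auto
    then show ?thesis using S by simp
  qed
  have le2: "n \<le> k * (2 * card (part V e q) + 2)" if "q < k" for q
  proof -
    define r where "r = (if q = j then i else q)"
    have r: "r < k" "r \<noteq> j" using i that by (auto simp: r_def)
    have "Suc (card (part V d r)) \<le> 2 * card (part V e q) + 2"
      using ei[of q] ej that unfolding r_def by (cases "q = j") simp_all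
    then have "k * Suc (card (part V d r)) \<le> k * (2 * card (part V e q) + 2)" by (rule mult_le_mono2)
    then show ?thesis using big[OF r] by linarith
  qed
  \<comment> \<open>Every class of \<open>e\<close> has at least n / (2k) - 1 elements. One half of
    the main term gives \<open>N\<close>; the other half is at least h + 2 and pays for the h used
    vertices, the rounding up and the 1.\<close>
  define N where "N = nat \<lceil>real n / (4 * real k)\<rceil>"
  have N: "N + h \<le> card (part V e q)" if "q < k" for q
  proof -
    have "real n \<le> real k * (2 * card (part V e q) + 2)"
      using le2[OF that] by (metis of_nat_le_iff of_nat_mult)
    then have "real n / (2 * real k) \<le> card (part V e q) + 1" using j by (simp add: field_simps)
    moreover have "real n / (4 * real k) \<ge> h + 2"
    proof -
      have "real (4 * k * (card W + 2)) \<le> real (card V)" using large by (rule of_nat_mono)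
      then show ?thesis using j by (simp add: field_simps n_def h_def)
    qed
    moreover have "real n / (2 * real k) = real n / (4 * real k) + real n / (4 * real k)" by (simp add: field_simps)
    moreover have "real N < real n / (4 * real k) + 1" unfolding N_def by (simp add: ceiling_correct) linarith
    ultimately show ?thesis by linarith
  qed
  obtain \<chi>' where \<chi>': "\<chi>' \<in> W \<rightarrow> {..<k}" "proper W R \<chi>'" "\<chi>' a = i" "\<chi>' b = j"
    using ex_proper_prescribed[OF \<chi> edge, of i j] i j by auto
  have "(\<Prod>w\<in>W. N) \<le> card {\<phi> \<in> Pi\<^sub>E W (\<lambda>w. part V e (\<chi>' w)). inj_on \<phi> W}"
    using W V N \<chi>' by (intro card_inj_PiE_ge) (auto simp: h_def Pi_def)
  also have "\<dots> \<le> card (emb_crossing W R V e i j)"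
  proof (rule card_mono)
    show "{\<phi> \<in> Pi\<^sub>E W (\<lambda>w. part V e (\<chi>' w)). inj_on \<phi> W} \<subseteq> emb_crossing W R V e i j"
    proof safe
      fix \<phi> assume \<phi>: "\<phi> \<in> Pi\<^sub>E W (\<lambda>w. part V e (\<chi>' w))" "inj_on \<phi> W"
      then have "\<phi> w \<in> V \<and> e (\<phi> w) = \<chi>' w" if "w \<in> W" for w using that by (auto simp: part_def PiE_iff)
      then show "\<phi> \<in> emb_crossing W R V e i j"
        using \<phi> \<chi>' edge by (auto simp: emb_crossing_def emb_def proper_def PiE_iff)
    qed
  qed (use W V in \<open>simp add: emb_crossing_def\<close>)
  finally have "N ^ h \<le> card (emb_crossing W R V e i j)" by (simp add: h_def)
  then have "real N ^ h \<le> card (emb_crossing W R V e i j)" by (metis of_nat_le_iff of_nat_power)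
  moreover have "(real n / (4 * real k)) ^ h \<le> real N ^ h"
    unfolding N_def by (intro power_mono) (auto simp: real_nat_ceiling_ge)
  ultimately have low: "(real n / (4 * real k)) ^ h \<le> card (emb_crossing W R V e i j)" by linarith
  have "real (card (emb_crossing W R V d i j)) \<le> real (h\<^sup>2 * (n * card (part V d j) * n ^ (h - 2)))"
    unfolding n_def h_def of_nat_le_iff by (rule card_emb_crossing_le) (use W V in auto)
  also have "\<dots> = real h ^ 2 * (real (card (part V c j)) * n * real n ^ (h - 2))" using d by simp
  also have "\<dots> \<le> real h ^ 2 * (\<delta> * n * n * real n ^ (h - 2))"
    using j by (intro mult_left_mono mult_right_mono) (auto simp: n_def)
  also have "\<dots> = real h ^ 2 * \<delta> * n ^ (2 + (h - 2))"
    by (simp only: power_add power2_eq_square mult_ac of_nat_mult of_nat_power)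
  also have "\<dots> = (1 / (4 * real k)) ^ h / 2 * real n ^ h"
    unfolding \<delta> h_def[symmetric] le_add_diff_inverse[OF h2] using h2 by simp
  finally have up: "real (card (emb_crossing W R V d i j)) \<le> (1 / (4 * real k)) ^ h / 2 * real n ^ h" .
  have "card (emb_multi W R V d) + card (emb_crossing W R V e i j)
      = card (emb_multi W R V e) + card (emb_crossing W R V d i j)"
  proof -
    have "card (emb_multi W R V f) = card (emb_multi W R V (\<lambda>v. if f v = j then i else f v)) +
        card (emb_crossing W R V f i j)" for f
      using W V(1) i(2) by (intro card_emb_multi_merge) auto
    from this[of d] this[of e] show ?thesis unfolding fun_cong[OF merge] by linarith
  qed
  moreover have "card (emb_multi W R V e) \<le> card (emb_multi W R V' t)"
    using V bal by (intro card_emb_le_balanced[OF W(1-3) V(1,3) _ K eK V(5), of "{..<k}"]) auto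
  moreover have "(real n / (4 * real k)) ^ h = (1 / (4 * real k)) ^ h * real n ^ h" by (simp add: power_divide)
  ultimately show ?thesis using low up d(2) unfolding n_def[symmetric] h_def[symmetric]
    by linarith
qed

section \<open>Embeddings through a vertex\<close>

definition emb_through :: "'a set \<Rightarrow> ('a \<Rightarrow> 'a \<Rightarrow> bool) \<Rightarrow> 'b set \<Rightarrow> ('b \<Rightarrow> 'b \<Rightarrow> bool) \<Rightarrow> 'b \<Rightarrow> ('a \<Rightarrow> 'b) set" where
  "emb_through W R V A x = {\<phi> \<in> emb W R V A. x \<in> \<phi> ` W}"

lemma finite_emb_through [simp]: "finite W \<Longrightarrow> finite V \<Longrightarrow> finite (emb_through W R V A x)"
  by (simp add: emb_through_def)

lemma inj_on_restrict_comp: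
  assumes "inj \<tau>" "S \<subseteq> extensional W"
  shows "inj_on (\<lambda>\<phi>. restrict (\<tau> \<circ> \<phi>) W) S"
proof (rule inj_onI)
  fix f g assume fg: "f \<in> S" "g \<in> S" and eq: "restrict (\<tau> \<circ> f) W = restrict (\<tau> \<circ> g) W"
  show "f = g"
  proof (rule extensionalityI[of _ W])
    fix x assume "x \<in> W"
    then show "f x = g x" using fun_cong[OF eq, of x] assms(1) by (simp add: inj_eq)
  qed (use fg assms in auto)
qed

section \<open>Replacing a vertex by a twin\<close>

lemma card_emb_both_le:
  assumes "finite W" "finite V" "u \<noteq> v"
  shows "card (emb_through W R V A u \<inter> emb_through W R V A v) \<le> (card W)\<^sup>2 * card V ^ (card W - 2)"
proof -
  have "emb_through W R V A u \<inter> emb_through W R V A v \<subseteq>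
      {\<phi> \<in> W \<rightarrow>\<^sub>E V. \<exists>a\<in>W. \<exists>b\<in>W. a \<noteq> b \<and> (\<phi> a, \<phi> b) \<in> {(u, v)}}"
    using assms by (auto simp: emb_through_def emb_def) metis
  then have "card (emb_through W R V A u \<inter> emb_through W R V A v) \<le>
      card {\<phi> \<in> W \<rightarrow>\<^sub>E V. \<exists>a\<in>W. \<exists>b\<in>W. a \<noteq> b \<and> (\<phi> a, \<phi> b) \<in> {(u, v)}}"
    using assms by (intro card_mono) (simp_all add: finite_PiE)
  also have "\<dots> \<le> (card W)\<^sup>2 * (card {(u, v)} * card V ^ (card W - 2))"
    using assms by (intro card_maps_pair_le) auto
  finally show ?thesis by simp
qed

text \<open>In the host pulled back along \<open>\<sigma>\<close>, \<open>v\<close> is a twin of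
  \<open>u\<close>. Two disjoint families embed there: the old embeddings avoiding \<open>v\<close>,
  and those through \<open>u\<close> but not \<open>v\<close>, with \<open>u\<close> replaced by
  \<open>v\<close>. If cloning gains nothing, then \<open>u\<close> lies in at most slightly more
  embeddings than \<open>v\<close>.\<close>

lemma card_emb_clone:
  assumes "finite W" "finite V" "u \<in> V" "v \<in> V" "u \<noteq> v"
  defines "\<sigma> \<equiv> (\<lambda>x. if x = v then u else x)"
  shows "card (emb W R V A) + card (emb_through W R V A u) \<le>
    card (emb W R V (\<lambda>x y. A (\<sigma> x) (\<sigma> y))) + card (emb_through W R V A v) +
    card (emb_through W R V A u \<inter> emb_through W R V A v)"
proof -
  let ?E = "emb W R V A" and ?E' = "emb W R V (\<lambda>x y. A (\<sigma> x) (\<sigma> y))"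
  let ?u = "emb_through W R V A u" and ?v = "emb_through W R V A v"
  let ?f = "\<lambda>\<phi>. restrict (transpose u v \<circ> \<phi>) W"
  have fin: "finite ?E" "finite ?E'" "finite ?u" "finite ?v" using assms by auto
  have inj: "inj_on ?f (?u - ?v)"
    by (rule inj_on_restrict_comp) (auto simp: emb_through_def emb_def PiE_def)
  have sub1: "?E - ?v \<subseteq> {\<phi> \<in> ?E'. v \<notin> \<phi> ` W}"
    by (auto simp: emb_through_def emb_def \<sigma>_def image_iff)
  have sub2: "?f ` (?u - ?v) \<subseteq> {\<phi> \<in> ?E'. v \<in> \<phi> ` W}"
  proof (rule image_subsetI)
    fix \<phi> assume "\<phi> \<in> ?u - ?v"
    then have \<phi>: "\<phi> \<in> W \<rightarrow>\<^sub>E V" "inj_on \<phi> W" "\<And>a b. a \<in> W \<Longrightarrow> b \<in> W \<Longrightarrow> R a b \<Longrightarrow> A (\<phi> a) (\<phi> b)"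
      and u: "u \<in> \<phi> ` W" and v: "v \<notin> \<phi> ` W"
      by (auto simp: emb_through_def emb_def)
    have \<sigma>: "\<sigma> (transpose u v (\<phi> a)) = \<phi> a" if "a \<in> W" for a
      using that v by (auto simp: \<sigma>_def transpose_def)
    have "inj_on (transpose u v \<circ> \<phi>) W" using \<phi> by (intro comp_inj_on) auto
    then have "inj_on (?f \<phi>) W" by (simp add: inj_on_def)
    moreover have "?f \<phi> \<in> W \<rightarrow>\<^sub>E V"
      using \<phi>(1) assms by (auto simp: transpose_def)
    ultimately have "?f \<phi> \<in> ?E'" using \<phi>(3) \<sigma> by (simp add: emb_def)
    moreover have "v \<in> ?f \<phi> ` W"
    proof -
      obtain a where "a \<in> W" "\<phi> a = u" using u by blast
      then show ?thesis by (intro image_eqI[of _ _ a]) auto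
    qed
    ultimately show "?f \<phi> \<in> {\<phi> \<in> ?E'. v \<in> \<phi> ` W}" by blast
  qed
  have "card (?E - ?v) + card (?u - ?v) = card (?E - ?v) + card (?f ` (?u - ?v))"
    using inj by (simp add: card_image)
  also have "\<dots> = card ((?E - ?v) \<union> ?f ` (?u - ?v))"
    using sub1 sub2 fin by (intro card_Un_disjoint[symmetric]) (simp, simp, blast)
  also have "\<dots> \<le> card ?E'" using sub1 sub2 fin by (intro card_mono) auto
  finally have "card (?E - ?v) + card (?u - ?v) \<le> card ?E'" .
  moreover have "card (?E - ?v) + card ?v = card ?E"
  proof -
    have "?v \<subseteq> ?E" by (auto simp: emb_through_def)
    then show ?thesis using fin by (metis add.commute card_Diff_subset card_mono le_add_diff_inverse)
  qed
  moreover have "card (?u - ?v) + card (?u \<inter> ?v) = card ?u"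
    using fin by (metis card_Diff_subset_Int card_mono finite_Int inf_le1 le_add_diff_inverse2)
  ultimately show ?thesis by linarith
qed

text \<open>There are at least (\<sigma> n)^q choice functions, q being the size of
  \<open>L\<close>, and by the pair estimate fewer of them hit \<open>D\<close>. When
  \<open>D\<close> collects the pairs on which a host differs from a multipartite one, a transversal
  of distinct classes that avoids \<open>D\<close> is a clique.\<close>

lemma ex_transversal_avoiding:
  fixes \<epsilon> \<sigma> :: real
  assumes "finite L" "finite V" "V \<noteq> {}" "finite D"
    and X: "\<And>l. l \<in> L \<Longrightarrow> X l \<subseteq> V" "\<And>l. l \<in> L \<Longrightarrow> \<sigma> * card V \<le> card (X l)" "\<sigma> \<ge> 0"
    and D: "card D \<le> \<epsilon> * (real (card V))\<^sup>2" "(card L)\<^sup>2 * \<epsilon> < \<sigma> ^ card L" "\<epsilon> \<ge> 0"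
  shows "\<exists>\<psi>. (\<forall>l\<in>L. \<psi> l \<in> X l) \<and> (\<forall>l\<in>L. \<forall>m\<in>L. l \<noteq> m \<longrightarrow> (\<psi> l, \<psi> m) \<notin> D)"
proof -
  define n q where "n = card V" and "q = card L"
  have n: "n > 0" using assms by (simp add: n_def card_gt_0_iff)
  let ?B = "{\<psi> \<in> L \<rightarrow>\<^sub>E V. \<exists>a\<in>L. \<exists>b\<in>L. a \<noteq> b \<and> (\<psi> a, \<psi> b) \<in> D}"
  have "real (card ?B) \<le> q\<^sup>2 * \<epsilon> * real n ^ q"
  proof (cases "q \<ge> 2")
    case True
    have pw: "(real n)\<^sup>2 * real n ^ (q - 2) = real n ^ q"
      unfolding power_add[symmetric] le_add_diff_inverse[OF True] ..
    have "real (card ?B) \<le> real (q\<^sup>2 * (card D * n ^ (q - 2)))"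
      unfolding of_nat_le_iff n_def q_def by (rule card_maps_pair_le) (use assms in auto)
    also have "\<dots> \<le> real q ^ 2 * (\<epsilon> * (real n)\<^sup>2 * real n ^ (q - 2))"
      using D by (auto intro!: mult_left_mono mult_right_mono simp: n_def)
    also have "\<dots> = real q ^ 2 * \<epsilon> * ((real n)\<^sup>2 * real n ^ (q - 2))" by (simp only: mult.assoc)
    also note pw
    finally show ?thesis by (simp add: mult.assoc)
  next
    \<comment> \<open>Here \<open>q - 2\<close> truncates, but there is no pair of distinct
      indices.\<close>
    case False
    have "?B = {}"
    proof (rule ccontr)
      assume "?B \<noteq> {}"
      then obtain a b where "a \<in> L" "b \<in> L" "a \<noteq> b" by blast
      then have "card {a, b} \<le> q" unfolding q_def using assms by (intro card_mono) auto
      then show False using False \<open>a \<noteq> b\<close> by simp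
    qed
    then show ?thesis using D by (simp only: card.empty) simp
  qed
  also have "\<dots> < \<sigma> ^ q * real n ^ q" using D n by (simp add: q_def)
  also have "\<dots> = (\<Prod>l\<in>L. \<sigma> * n)" by (simp add: power_mult_distrib q_def)
  also have "\<dots> \<le> (\<Prod>l\<in>L. real (card (X l)))"
    using X by (intro prod_mono) (auto simp: n_def)
  also have "\<dots> = card (Pi\<^sub>E L X)" using assms(1) by (simp add: card_PiE)
  finally have "card ?B < card (Pi\<^sub>E L X)" by simp
  moreover have "finite ?B" using assms by (simp add: finite_PiE)
  ultimately have "\<not> Pi\<^sub>E L X \<subseteq> ?B" using card_mono[of ?B "Pi\<^sub>E L X"] by linarith
  then obtain \<psi> where \<psi>: "\<psi> \<in> Pi\<^sub>E L X" "\<psi> \<notin> ?B" by blast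
  moreover have "\<psi> \<in> L \<rightarrow>\<^sub>E V" using \<psi> X by (auto simp: PiE_iff)
  ultimately have "(\<psi> a, \<psi> b) \<notin> D" if "a \<in> L" "b \<in> L" "a \<noteq> b" for a b using that by blast
  then show ?thesis using \<psi>(1) by (intro exI[of _ \<psi>]) (simp add: PiE_mem)
qed

section \<open>A host compared with a complete multipartite one\<close>

definition diff_pairs :: "'b set \<Rightarrow> ('b \<Rightarrow> 'b \<Rightarrow> bool) \<Rightarrow> ('b \<Rightarrow> nat) \<Rightarrow> ('b \<times> 'b) set" where
  "diff_pairs V A c = {(x, y). x \<in> V \<and> y \<in> V \<and> x \<noteq> y \<and> (A x y \<longleftrightarrow> c x = c y)}"

lemma finite_diff_pairs [simp]: "finite V \<Longrightarrow> finite (diff_pairs V A c)"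
  by (rule finite_subset[of _ "V \<times> V"]) (auto simp: diff_pairs_def)

locale host =
  fixes W :: "'a set" and R :: "'a \<Rightarrow> 'a \<Rightarrow> bool" and V :: "'b set" and A :: "'b \<Rightarrow> 'b \<Rightarrow> bool"
    and c :: "'b \<Rightarrow> nat" and k :: nat
  assumes finW: "finite W" and Rsym: "R a b \<Longrightarrow> R b a" and Rirr: "\<not> R a a"
    and finV: "finite V" and Asym: "A x y \<Longrightarrow> A y x" and Airr: "\<not> A x x"
    and col: "c \<in> V \<rightarrow> {..<k}"
begin

abbreviation "D \<equiv> diff_pairs V A c"
abbreviation "dA \<equiv> emb_through W R V A"
abbreviation "dP \<equiv> emb_through W R V (\<lambda>x y. c x \<noteq> c y)"

lemma emb_diff_sub:
  "emb W R V A - emb_multi W R V c \<subseteq> {\<phi> \<in> W \<rightarrow>\<^sub>E V. \<exists>a\<in>W. \<exists>b\<in>W. a \<noteq> b \<and> (\<phi> a, \<phi> b) \<in> D}"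
  "emb_multi W R V c - emb W R V A \<subseteq> {\<phi> \<in> W \<rightarrow>\<^sub>E V. \<exists>a\<in>W. \<exists>b\<in>W. a \<noteq> b \<and> (\<phi> a, \<phi> b) \<in> D}"
proof -
  have *: "(\<phi> a, \<phi> b) \<in> D" if "\<phi> \<in> W \<rightarrow>\<^sub>E V" "inj_on \<phi> W" "a \<in> W" "b \<in> W" "R a b"
    "A (\<phi> a) (\<phi> b) \<longleftrightarrow> c (\<phi> a) = c (\<phi> b)" for \<phi> a b
  proof -
    have "a \<noteq> b" using that Rirr by auto
    then have "\<phi> a \<noteq> \<phi> b" using that by (auto simp: inj_on_def)
    then show ?thesis using that by (auto simp: diff_pairs_def)
  qed
  show "emb W R V A - emb_multi W R V c \<subseteq> {\<phi> \<in> W \<rightarrow>\<^sub>E V. \<exists>a\<in>W. \<exists>b\<in>W. a \<noteq> b \<and> (\<phi> a, \<phi> b) \<in> D}"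
  proof
    fix \<phi> assume "\<phi> \<in> emb W R V A - emb_multi W R V c"
    then obtain a b where ab: "\<phi> \<in> W \<rightarrow>\<^sub>E V" "inj_on \<phi> W" "a \<in> W" "b \<in> W" "R a b"
      "A (\<phi> a) (\<phi> b)" "c (\<phi> a) = c (\<phi> b)" by (auto simp: emb_def)
    then have "a \<noteq> b" "(\<phi> a, \<phi> b) \<in> D" using * Rirr by auto
    then show "\<phi> \<in> {\<phi> \<in> W \<rightarrow>\<^sub>E V. \<exists>a\<in>W. \<exists>b\<in>W. a \<noteq> b \<and> (\<phi> a, \<phi> b) \<in> D}" using ab by blast
  qed
  show "emb_multi W R V c - emb W R V A \<subseteq> {\<phi> \<in> W \<rightarrow>\<^sub>E V. \<exists>a\<in>W. \<exists>b\<in>W. a \<noteq> b \<and> (\<phi> a, \<phi> b) \<in> D}"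
  proof
    fix \<phi> assume "\<phi> \<in> emb_multi W R V c - emb W R V A"
    then obtain a b where ab: "\<phi> \<in> W \<rightarrow>\<^sub>E V" "inj_on \<phi> W" "a \<in> W" "b \<in> W" "R a b"
      "\<not> A (\<phi> a) (\<phi> b)" "c (\<phi> a) \<noteq> c (\<phi> b)" by (auto simp: emb_def)
    then have "a \<noteq> b" "(\<phi> a, \<phi> b) \<in> D" using * Rirr by auto
    then show "\<phi> \<in> {\<phi> \<in> W \<rightarrow>\<^sub>E V. \<exists>a\<in>W. \<exists>b\<in>W. a \<noteq> b \<and> (\<phi> a, \<phi> b) \<in> D}" using ab by blast
  qed
qed

lemma card_emb_diff_le:
  "card (emb W R V A - emb_multi W R V c) \<le> (card W)\<^sup>2 * (card D * card V ^ (card W - 2))"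
  "card (emb_multi W R V c - emb W R V A) \<le> (card W)\<^sup>2 * (card D * card V ^ (card W - 2))"
proof -
  have f: "finite {\<phi> \<in> W \<rightarrow>\<^sub>E V. \<exists>a\<in>W. \<exists>b\<in>W. a \<noteq> b \<and> (\<phi> a, \<phi> b) \<in> D}"
    using finW finV by (simp add: finite_PiE)
  note le = card_maps_pair_le[OF finW finV finite_diff_pairs[OF finV, of A c]]
  show "card (emb W R V A - emb_multi W R V c) \<le> (card W)\<^sup>2 * (card D * card V ^ (card W - 2))"
    by (rule order.trans[OF card_mono[OF f emb_diff_sub(1)] le])
  show "card (emb_multi W R V c - emb W R V A) \<le> (card W)\<^sup>2 * (card D * card V ^ (card W - 2))"
    by (rule order.trans[OF card_mono[OF f emb_diff_sub(2)] le])
qed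

lemma card_emb_le_multi:
  "card (emb W R V A) \<le> card (emb_multi W R V c) + (card W)\<^sup>2 * (card D * card V ^ (card W - 2))"
proof -
  have "card (emb W R V A) \<le> card (emb_multi W R V c \<union> (emb W R V A - emb_multi W R V c))"
    using finW finV by (intro card_mono) auto
  also have "\<dots> \<le> card (emb_multi W R V c) + card (emb W R V A - emb_multi W R V c)"
    by (rule card_Un_le)
  finally show ?thesis using card_emb_diff_le(1) by linarith
qed

text \<open>Averaging over class \<open>j\<close>: each embedding lost in passing from the
  multipartite host to \<open>A\<close> meets at most \<open>card W\<close> vertices, so the losses
  over the class sum to at most \<open>card W\<close> times the number of lost embeddings.
  Multiplying by the class size avoids a division.\<close>

lemma ex_typical_vertex:
  assumes "part V c j \<noteq> {}"
  shows "\<exists>u\<in>part V c j. card (part V c j) * card (dP u) \<le>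
    card (part V c j) * card (dA u) + card W * ((card W)\<^sup>2 * (card D * card V ^ (card W - 2)))"
proof (rule ccontr)
  let ?P = "part V c j" and ?S = "emb_multi W R V c - emb W R V A"
  let ?B = "card W * ((card W)\<^sup>2 * (card D * card V ^ (card W - 2)))"
  assume "\<not> ?thesis"
  then have "card ?P * card (dA u) + ?B < card ?P * card (dP u)" if "u \<in> ?P" for u
    using that by (meson linorder_not_le)
  then have "(\<Sum>u\<in>?P. card ?P * card (dA u) + ?B) < (\<Sum>u\<in>?P. card ?P * card (dP u))"
    using assms finV by (intro sum_strict_mono) auto
  then have "card ?P * ((\<Sum>u\<in>?P. card (dA u)) + ?B) < card ?P * (\<Sum>u\<in>?P. card (dP u))"
    unfolding sum.distrib sum_constant of_nat_id distrib_left unfolding sum_distrib_left .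
  then have lt: "(\<Sum>u\<in>?P. card (dA u)) + ?B < (\<Sum>u\<in>?P. card (dP u))" by simp
  have "card (dP u) \<le> card (dA u) + card {\<phi> \<in> ?S. u \<in> \<phi> ` W}" for u
  proof -
    have "card (dP u) \<le> card (dA u \<union> {\<phi> \<in> ?S. u \<in> \<phi> ` W})"
      using finW finV by (intro card_mono) (auto simp: emb_through_def)
    also have "\<dots> \<le> card (dA u) + card {\<phi> \<in> ?S. u \<in> \<phi> ` W}" by (rule card_Un_le)
    finally show ?thesis .
  qed
  then have "(\<Sum>u\<in>?P. card (dP u)) \<le> (\<Sum>u\<in>?P. card (dA u)) + (\<Sum>u\<in>?P. card {\<phi> \<in> ?S. u \<in> \<phi> ` W})"
    by (simp add: sum_mono flip: sum.distrib)
  also have "(\<Sum>u\<in>?P. card {\<phi> \<in> ?S. u \<in> \<phi> ` W}) = (\<Sum>\<phi>\<in>?S. card {u \<in> ?P. u \<in> \<phi> ` W})"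
    using finW finV by (intro sum_card_swap) auto
  also have "\<dots> \<le> (\<Sum>\<phi>\<in>?S. card W)"
  proof (rule sum_mono)
    fix \<phi>
    have "card {u \<in> ?P. u \<in> \<phi> ` W} \<le> card (\<phi> ` W)" using finW by (intro card_mono) auto
    also have "\<dots> \<le> card W" using finW by (rule card_image_le)
    finally show "card {u \<in> ?P. u \<in> \<phi> ` W} \<le> card W" .
  qed
  also have "\<dots> = card W * card ?S" by simp
  also have "\<dots> \<le> ?B" by (rule mult_le_mono2[OF card_emb_diff_le(2)])
  finally show False using lt by simp
qed

text \<open>Rerouting an embedding through \<open>v\<close> to \<open>u\<close> gives an embedding into the multipartite host,
  and never one that maps an edge to a pair in \<open>{u} \<times> Y\<close>.\<close>

lemma card_emb_through_compare:
  assumes u: "u \<in> part V c j" and v: "v \<in> V" and l: "l \<noteq> j"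
  defines "Y \<equiv> {y \<in> part V c l. y \<noteq> v \<and> \<not> A v y}"
  shows "card (dA v) + card {\<psi> \<in> emb_multi W R V c. \<exists>a\<in>W. \<exists>b\<in>W. R a b \<and> \<psi> a = u \<and> \<psi> b \<in> Y} \<le>
    card (dP u)
    + card {\<phi> \<in> W \<rightarrow>\<^sub>E V. \<exists>w\<in>W. \<exists>a\<in>W. \<exists>b\<in>W. w \<noteq> a \<and> w \<noteq> b \<and> a \<noteq> b \<and> \<phi> w = v \<and> (\<phi> a, \<phi> b) \<in> D}
    + (card W)\<^sup>2 * (card {y \<in> part V c j. A v y} * card V ^ (card W - 2))
    + (card W)\<^sup>2 * card V ^ (card W - 2)"
proof -
  define M where "M = {\<psi> \<in> emb_multi W R V c. \<exists>a\<in>W. \<exists>b\<in>W. R a b \<and> \<psi> a = u \<and> \<psi> b \<in> Y}"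
  \<comment> \<open>The ways in which rerouting through \<open>u\<close> can fail: in
    \<open>E1\<close> the hosts differ on a pair away from \<open>v\<close>, in \<open>E2\<close> a
    neighbour of \<open>v\<close> in the class of \<open>u\<close> is used, in \<open>E3\<close> the
    vertex \<open>u\<close> is already used.\<close>
  define E1 where "E1 = {\<phi> \<in> W \<rightarrow>\<^sub>E V. \<exists>w\<in>W. \<exists>a\<in>W. \<exists>b\<in>W. w \<noteq> a \<and> w \<noteq> b \<and> a \<noteq> b \<and> \<phi> w = v \<and> (\<phi> a, \<phi> b) \<in> D}"
  let ?N = "{y \<in> part V c j. A v y}"
  define E2 where "E2 = {\<phi> \<in> W \<rightarrow>\<^sub>E V. \<exists>a\<in>W. \<exists>b\<in>W. a \<noteq> b \<and> (\<phi> a, \<phi> b) \<in> {v} \<times> ?N}"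
  define E3 where "E3 = {\<phi> \<in> W \<rightarrow>\<^sub>E V. \<exists>a\<in>W. \<exists>b\<in>W. a \<noteq> b \<and> (\<phi> a, \<phi> b) \<in> {(v, u)}}"
  let ?f = "\<lambda>\<phi>. restrict (transpose v u \<circ> \<phi>) W"
  define G where "G = dA v - E1 - E2 - E3"
  have uV: "u \<in> V" "c u = j" using u by (auto simp: part_def)
  have fin: "finite E1" "finite E2" "finite E3" "finite M" "finite (dP u)" "finite (dA v)"
    using finW finV by (simp_all add: E1_def E2_def E3_def M_def finite_PiE)
  have good: "?f \<phi> \<in> dP u - M" if "\<phi> \<in> G" for \<phi>
  proof -
    have \<phi>: "\<phi> \<in> W \<rightarrow>\<^sub>E V" "inj_on \<phi> W" "\<And>a b. a \<in> W \<Longrightarrow> b \<in> W \<Longrightarrow> R a b \<Longrightarrow> A (\<phi> a) (\<phi> b)"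
      and "v \<in> \<phi> ` W" using that by (auto simp: G_def emb_through_def emb_def)
    then obtain w where w: "w \<in> W" "\<phi> w = v" by auto
    have neq: "\<phi> a \<noteq> \<phi> b" if "a \<in> W" "b \<in> W" "a \<noteq> b" for a b
      using that \<phi>(2) by (auto simp: inj_on_def)
    have E3: "\<phi> a \<noteq> u" if "a \<in> W" "a \<noteq> w" for a
    proof
      assume "\<phi> a = u"
      then have "(\<phi> w, \<phi> a) \<in> {(v, u)}" using w by simp
      then have "\<exists>a\<in>W. \<exists>b\<in>W. a \<noteq> b \<and> (\<phi> a, \<phi> b) \<in> {(v, u)}"
        using w(1) that by (intro bexI[of _ w] bexI[of _ a]) auto
      then have "\<phi> \<in> E3" unfolding E3_def using \<phi>(1) by blast
      then show False using \<open>\<phi> \<in> G\<close> unfolding G_def by blast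
    qed
    have fw: "?f \<phi> w = u" using w by simp
    have fo: "?f \<phi> a = \<phi> a" if "a \<in> W" "a \<noteq> w" for a
      using E3[OF that] neq[OF that(1) w(1) that(2)] w that by simp
    have nb: "c (\<phi> b) \<noteq> j" "A v (\<phi> b)" if "b \<in> W" "R w b" for b
    proof -
      show "A v (\<phi> b)" using \<phi>(3)[OF w(1) that] w by simp
      have "\<phi> b \<notin> part V c j"
      proof
        assume "\<phi> b \<in> part V c j"
        then have "(\<phi> w, \<phi> b) \<in> {v} \<times> ?N" using \<open>A v (\<phi> b)\<close> w by simp
        moreover have "w \<noteq> b" using that Rirr by auto
        ultimately have "\<exists>a\<in>W. \<exists>b\<in>W. a \<noteq> b \<and> (\<phi> a, \<phi> b) \<in> {v} \<times> ?N"
          using w(1) that(1) by (intro bexI[of _ w] bexI[of _ b]) auto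
        then have "\<phi> \<in> E2" unfolding E2_def using \<phi>(1) by blast
        then show False using \<open>\<phi> \<in> G\<close> unfolding G_def by blast
      qed
      then show "c (\<phi> b) \<noteq> j" using \<phi>(1) that by (auto simp: part_def)
    qed
    have "c (?f \<phi> a) \<noteq> c (?f \<phi> b)" if ab: "a \<in> W" "b \<in> W" "R a b" for a b
    proof -
      have "a \<noteq> b" using ab Rirr by auto
      consider "a = w" | "b = w" | "a \<noteq> w" "b \<noteq> w" by blast
      then show ?thesis
      proof cases
        case 1
        then show ?thesis using fw fo[of b] nb(1)[of b] ab \<open>a \<noteq> b\<close> uV by metis
      next
        case 2
        then show ?thesis using fw fo[of a] nb(1)[of a] ab Rsym \<open>a \<noteq> b\<close> uV by metis
      next
        case 3
        have "(\<phi> a, \<phi> b) \<notin> D"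
        proof
          assume "(\<phi> a, \<phi> b) \<in> D"
          then have "\<exists>w\<in>W. \<exists>a\<in>W. \<exists>b\<in>W. w \<noteq> a \<and> w \<noteq> b \<and> a \<noteq> b \<and> \<phi> w = v \<and> (\<phi> a, \<phi> b) \<in> D"
            using w ab(1,2) \<open>a \<noteq> b\<close> 3 by (intro bexI[of _ w] bexI[of _ a] bexI[of _ b]) auto
          then have "\<phi> \<in> E1" unfolding E1_def using \<phi>(1) by blast
          then show False using \<open>\<phi> \<in> G\<close> unfolding G_def by blast
        qed
        then have "c (\<phi> a) \<noteq> c (\<phi> b)"
          using \<phi>(3)[OF ab] \<phi>(1) ab neq[OF ab(1,2) \<open>a \<noteq> b\<close>] by (auto simp: diff_pairs_def)
        then show ?thesis using fo 3 ab by metis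
      qed
    qed
    moreover have "inj_on (?f \<phi>) W"
    proof -
      have "inj_on (transpose v u \<circ> \<phi>) W" using \<phi> by (intro comp_inj_on) auto
      then show ?thesis by (simp add: inj_on_def)
    qed
    moreover have "?f \<phi> \<in> W \<rightarrow>\<^sub>E V" using \<phi>(1) uV v by (auto simp: transpose_def)
    ultimately have emb: "?f \<phi> \<in> emb_multi W R V c" unfolding emb_def by blast
    have "u \<in> ?f \<phi> ` W" using imageI[OF w(1), of "?f \<phi>"] unfolding fw .
    then have "?f \<phi> \<in> dP u" unfolding emb_through_def using emb by blast
    moreover have "?f \<phi> \<notin> M"
    proof
      assume "?f \<phi> \<in> M"
      then obtain a b where ab: "a \<in> W" "b \<in> W" "R a b" "?f \<phi> a = u" "?f \<phi> b \<in> Y"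
        unfolding M_def by blast
      have "a = w" using ab(1,4) fo[of a] E3[of a] by metis
      have "b \<noteq> w" using ab(3) \<open>a = w\<close> Rirr by auto
      then have "\<phi> b \<in> Y" using fo[of b] ab by metis
      then show False using nb(2)[of b] ab \<open>a = w\<close> by (simp add: Y_def)
    qed
    ultimately show ?thesis by blast
  qed
  have "inj_on ?f G"
    by (rule inj_on_restrict_comp) (auto simp: G_def emb_through_def emb_def PiE_def)
  then have "card G \<le> card (dP u - M)"
    using good fin by (intro card_inj_on_le[of ?f] image_subsetI) auto
  moreover have "card M + card (dP u - M) = card (dP u)"
  proof -
    have "M \<subseteq> dP u" by (auto simp: M_def emb_through_def)
    then show ?thesis using fin by (metis card_Diff_subset card_mono le_add_diff_inverse)
  qed
  moreover have "card (dA v) \<le> card G + card E1 + card E2 + card E3"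
  proof -
    have "card (dA v) \<le> card (G \<union> E1 \<union> E2 \<union> E3)" using fin by (intro card_mono) (auto simp: G_def)
    also have "\<dots> \<le> card (G \<union> E1 \<union> E2) + card E3" by (rule card_Un_le)
    also have "card (G \<union> E1 \<union> E2) \<le> card (G \<union> E1) + card E2" by (rule card_Un_le)
    also have "card (G \<union> E1) \<le> card G + card E1" by (rule card_Un_le)
    finally show ?thesis by simp
  qed
  moreover have "card E2 \<le> (card W)\<^sup>2 * (card ?N * card V ^ (card W - 2))"
    using card_maps_pair_le[OF finW finV, of "{v} \<times> ?N"] finV by (simp add: E2_def card_cartesian_product)
  moreover have "card E3 \<le> (card W)\<^sup>2 * card V ^ (card W - 2)"
    using card_maps_pair_le[OF finW finV, of "{(v, u)}"] by (simp add: E3_def)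
  ultimately show ?thesis unfolding M_def E1_def by linarith
qed

text \<open>Send \<open>a\<close> to \<open>u\<close> and \<open>b\<close> into \<open>Y\<close>,
  and place the other vertices greedily in the classes of a colouring of the pattern that gives
  \<open>a\<close> the colour \<open>j\<close> and \<open>b\<close> the colour \<open>l\<close>.
  Each of the \<open>card W - 1\<close> free vertices has at least \<open>m\<close> choices.\<close>

lemma card_missed_ge:
  assumes edge: "a \<in> W" "b \<in> W" "R a b" and \<chi>: "\<chi> \<in> W \<rightarrow> {..<k}" "proper W R \<chi>"
    and u: "u \<in> part V c j" and l: "l < k" "l \<noteq> j" and Y: "Y \<subseteq> part V c l" "m + card W \<le> card Y"
    and big: "\<And>q. q < k \<Longrightarrow> m + card W < card (part V c q)"
  shows "m ^ (card W - 1) \<le> card {\<psi> \<in> emb_multi W R V c. \<exists>a\<in>W. \<exists>b\<in>W. R a b \<and> \<psi> a = u \<and> \<psi> b \<in> Y}"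
    (is "_ \<le> card ?M")
proof -
  have uV: "u \<in> V" "c u = j" "j < k" using u col by (auto simp: part_def)
  obtain \<chi>' where \<chi>': "\<chi>' \<in> W \<rightarrow> {..<k}" "proper W R \<chi>'" "\<chi>' a = j" "\<chi>' b = l"
    using ex_proper_prescribed[OF \<chi> edge, of j l] uV l by auto
  have ab: "a \<noteq> b" using edge Rirr by auto
  \<comment> \<open>Injectivity is counted on \<open>W - {a}\<close> only, so \<open>u\<close> has
    to be removed from the other targets; \<open>Y\<close> does not contain it, since
    \<open>l \<noteq> j\<close>. The strict inequality in \<open>big\<close> pays for the
    removal.\<close>
  define X where "X w = (if w = b then Y else part V c (\<chi>' w) - {u})" for w
  have Yfin: "finite Y" using Y finV finite_subset finite_part by metis
  have "(\<Prod>w\<in>W - {a}. m) \<le> card {\<phi> \<in> Pi\<^sub>E (W - {a}) X. inj_on \<phi> (W - {a})}"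
  proof (rule card_inj_PiE_ge)
    fix w assume w: "w \<in> W - {a}"
    have c1: "card (part V c q) \<le> Suc (card (part V c q - {u}))" for q
      by (cases "card (part V c q)") (simp_all add: card_Diff_singleton_if)
    have "card (W - {a}) \<le> card W" using finW by (intro card_mono) auto
    moreover have "\<chi>' w < k" using \<chi>' w by auto
    ultimately have "m + card (W - {a}) \<le> card (X w)"
      using Y(2) big[of "\<chi>' w"] c1[of "\<chi>' w"] unfolding X_def by (cases "w = b") simp_all
    then show "finite (X w) \<and> m + card (W - {a}) \<le> card (X w)"
      using Yfin finV by (simp add: X_def)
  qed (use finW in auto)
  also have "(\<Prod>w\<in>W - {a}. m) = m ^ (card W - 1)" using edge finW by simp
  also have "card {\<phi> \<in> Pi\<^sub>E (W - {a}) X. inj_on \<phi> (W - {a})} \<le> card ?M"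
  proof (rule card_inj_on_le[of "\<lambda>\<phi>. \<phi>(a := u)"])
    show "inj_on (\<lambda>\<phi>. \<phi>(a := u)) {\<phi> \<in> Pi\<^sub>E (W - {a}) X. inj_on \<phi> (W - {a})}"
    proof (rule inj_onI)
      fix f g assume f: "f \<in> {\<phi> \<in> Pi\<^sub>E (W - {a}) X. inj_on \<phi> (W - {a})}"
        and g: "g \<in> {\<phi> \<in> Pi\<^sub>E (W - {a}) X. inj_on \<phi> (W - {a})}" and eq: "f(a := u) = g(a := u)"
      show "f = g"
      proof
        fix x show "f x = g x"
          using f g fun_cong[OF eq, of x] by (cases "x = a") (auto simp: PiE_iff extensional_def)
      qed
    qed
    show "(\<lambda>\<phi>. \<phi>(a := u)) ` {\<phi> \<in> Pi\<^sub>E (W - {a}) X. inj_on \<phi> (W - {a})} \<subseteq> ?M"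
    proof (rule image_subsetI)
      fix \<phi> assume "\<phi> \<in> {\<phi> \<in> Pi\<^sub>E (W - {a}) X. inj_on \<phi> (W - {a})}"
      then have \<phi>: "\<phi> \<in> Pi\<^sub>E (W - {a}) X" "inj_on \<phi> (W - {a})" by auto
      let ?\<psi> = "\<phi>(a := u)"
      have Xw: "\<phi> w \<in> V" "c (\<phi> w) = \<chi>' w" "\<phi> w \<noteq> u" if w: "w \<in> W" "w \<noteq> a" for w
      proof -
        have "\<phi> w \<in> X w" using \<phi> w by auto
        then show "\<phi> w \<in> V" "c (\<phi> w) = \<chi>' w" "\<phi> w \<noteq> u"
          using Y \<chi>' l uV by (auto simp: X_def part_def split: if_splits)
      qed
      have \<psi>V: "?\<psi> w \<in> V" "c (?\<psi> w) = \<chi>' w" if "w \<in> W" for w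
        using that Xw[of w] uV \<chi>' by (cases "w = a"; simp)+
      have "?\<psi> \<in> W \<rightarrow>\<^sub>E V" using \<phi> \<psi>V edge by (auto simp: PiE_iff extensional_def)
      moreover have "inj_on ?\<psi> W" using \<phi>(2) Xw(3) unfolding inj_on_def by auto
      moreover have "\<forall>x\<in>W. \<forall>y\<in>W. R x y \<longrightarrow> c (?\<psi> x) \<noteq> c (?\<psi> y)"
        using \<psi>V(2) \<chi>'(2) unfolding proper_def by metis
      ultimately have "?\<psi> \<in> emb_multi W R V c" unfolding emb_def by blast
      moreover have "?\<psi> b \<in> Y" using PiE_mem[OF \<phi>(1), of b] edge ab by (simp add: X_def)
      moreover have "?\<psi> a = u" by simp
      ultimately show "?\<psi> \<in> ?M" using edge by blast
    qed
    show "finite ?M" using finW finV by simp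
  qed
  finally show ?thesis .
qed

end

section \<open>From near-extremal to multipartite\<close>

text \<open>Multiplying by \<open>card V\<close> replaces the exponent \<open>card W - 3\<close>,
  which truncates for \<open>card W < 3\<close>; in that case there are no three distinct vertices
  and the set is empty.\<close>

lemma card_maps_triple_mult_le:
  assumes "finite W" "finite V" "finite D"
  shows "card {\<phi> \<in> W \<rightarrow>\<^sub>E V. \<exists>w\<in>W. \<exists>a\<in>W. \<exists>b\<in>W. w \<noteq> a \<and> w \<noteq> b \<and> a \<noteq> b \<and> \<phi> w = x \<and> (\<phi> a, \<phi> b) \<in> D} * card V
    \<le> card W ^ 3 * (card D * card V ^ (card W - 2))"
proof (cases "card W \<ge> 3")
  case True
  then have "card W - 2 = Suc (card W - 3)" by simp
  then show ?thesis
    using mult_le_mono1[OF card_maps_triple_le[OF assms, of x], of "card V"] by (simp add: mult_ac)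
next
  case False
  have "{\<phi> \<in> W \<rightarrow>\<^sub>E V. \<exists>w\<in>W. \<exists>a\<in>W. \<exists>b\<in>W. w \<noteq> a \<and> w \<noteq> b \<and> a \<noteq> b \<and> \<phi> w = x \<and> (\<phi> a, \<phi> b) \<in> D} = {}"
  proof (rule ccontr)
    assume "\<not> ?thesis"
    then obtain w a b where *: "w \<in> W" "a \<in> W" "b \<in> W" "w \<noteq> a" "w \<noteq> b" "a \<noteq> b" by blast
    then have "card {w, a, b} \<le> card W" using assms by (intro card_mono) auto
    then show False using False * by simp
  qed
  then show ?thesis by (simp only: card.empty)
qed

context host
begin

text \<open>Let \<open>u\<close> be a typical vertex of class \<open>j\<close>. By
  \<open>clone\<close>, \<open>v\<close> lies in almost as many embeddings as \<open>u\<close>,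
  hence in almost as many as \<open>u\<close> does in the multipartite host. But rerouting from
  \<open>v\<close> to \<open>u\<close> misses all embeddings with an edge in
  \<open>{u} \<times> Y\<close>, of which there are at least (\<beta> n / 2)^(h - 1) if
  \<open>Y\<close> is large. The errors in \<open>num\<close> are, in order: typicality of
  \<open>u\<close>, pairs in \<open>D\<close>, neighbours of \<open>v\<close> in class
  \<open>j\<close>, and embeddings through both \<open>u\<close> and \<open>v\<close>, once for
  rerouting and once for cloning.\<close>

lemma few_missed:
  fixes \<alpha> \<beta> \<gamma> \<epsilon> :: real
  defines "n \<equiv> card V" and "h \<equiv> card W"
  assumes edge: "a \<in> W" "b \<in> W" "R a b" and \<chi>: "\<chi> \<in> W \<rightarrow> {..<k}" "proper W R \<chi>"
    and pos: "0 < \<beta>" "\<beta> \<le> \<gamma>" "0 \<le> \<epsilon>" "n > 0"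
    and parts: "\<And>q. q < k \<Longrightarrow> \<gamma> * n \<le> card (part V c q)"
    and D: "card D \<le> \<epsilon> * (real n)\<^sup>2"
    and clone: "\<And>u v. u \<in> V \<Longrightarrow> v \<in> V \<Longrightarrow> card (dA u) \<le> card (dA v) + h\<^sup>2 * n ^ (h - 2)"
    and num: "h ^ 3 * \<epsilon> / \<gamma> + h ^ 3 * \<epsilon> + h\<^sup>2 * \<alpha> + 2 * h\<^sup>2 / n < (\<beta> / 2) ^ (h - 1)"
    and large: "2 * (h + 2) \<le> \<beta> * n"
    and v: "v \<in> V" and jl: "j < k" "l < k" "l \<noteq> j"
    and nb: "card {y \<in> part V c j. A v y} \<le> \<alpha> * n"
  shows "card {y \<in> part V c l. y \<noteq> v \<and> \<not> A v y} \<le> \<beta> * n"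
proof (rule ccontr)
  define Y where "Y = {y \<in> part V c l. y \<noteq> v \<and> \<not> A v y}"
  \<comment> \<open>Only half of \<beta> n is used, so that \<open>m\<close> together with h used
    vertices stays below \<beta> n.\<close>
  define m where "m = nat \<lceil>\<beta> * n / 2\<rceil>"
  define T where "T = real n ^ (h - 1)"
  assume "\<not> ?thesis"
  then have Y: "\<beta> * n < card Y" by (simp add: Y_def)
  have h2: "h \<ge> 2"
  proof -
    have "card {a, b} \<le> h" unfolding h_def using edge finW by (intro card_mono) auto
    moreover have "a \<noteq> b" using Rirr edge by auto
    ultimately show ?thesis by simp
  qed
  have T: "real n ^ (h - 2) * n = T"
    using h2 unfolding T_def by (metis Suc_diff_Suc Suc_1 Suc_le_eq diff_Suc_Suc diff_zero mult.commute power_Suc One_nat_def numeral_2_eq_2)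
  have Tpos: "T > 0" using pos by (simp add: T_def)
  have mge: "\<beta> * n / 2 \<le> m" unfolding m_def by (rule real_nat_ceiling_ge)
  have "\<beta> * n / 2 \<ge> 0" using pos by simp
  then have mlt: "real m < \<beta> * n / 2 + 1" unfolding m_def by linarith
  have mh: "real m + h < \<beta> * n" using mlt large by simp
  have big: "m + card W < card (part V c q)" if "q < k" for q
  proof -
    have "\<beta> * n \<le> \<gamma> * n" using pos by simp
    then show ?thesis using mh parts[OF that] unfolding h_def by linarith
  qed
  then have "part V c j \<noteq> {}" using jl by fastforce
  from ex_typical_vertex[OF this] obtain u where u: "u \<in> part V c j"
    and typc: "card (part V c j) * card (dP u) \<le> card (part V c j) * card (dA u) + h * (h\<^sup>2 * (card D * n ^ (h - 2)))"
    unfolding n_def h_def by blast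
  have Dn: "real (card D * n ^ (h - 2)) \<le> \<epsilon> * n * T"
  proof -
    have "real (card D * n ^ (h - 2)) \<le> \<epsilon> * (real n)\<^sup>2 * real n ^ (h - 2)"
      using D by (simp add: mult_right_mono)
    also have "\<dots> = \<epsilon> * n * T" by (simp add: power2_eq_square mult_ac flip: T)
    finally show ?thesis .
  qed
  let ?E1 = "{\<phi> \<in> W \<rightarrow>\<^sub>E V. \<exists>w\<in>W. \<exists>a\<in>W. \<exists>b\<in>W. w \<noteq> a \<and> w \<noteq> b \<and> a \<noteq> b \<and> \<phi> w = v \<and> (\<phi> a, \<phi> b) \<in> D}"
  have E1: "real (card ?E1) \<le> h ^ 3 * \<epsilon> * T"
  proof -
    have "real (card ?E1) * n \<le> real (h ^ 3 * (card D * n ^ (h - 2)))"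
      using card_maps_triple_mult_le[OF finW finV finite_diff_pairs[OF finV], of v A c]
      unfolding n_def h_def of_nat_mult[symmetric] of_nat_le_iff .
    also have "\<dots> \<le> real (h ^ 3) * (\<epsilon> * n * T)"
      unfolding of_nat_mult[of "h ^ 3"] by (rule mult_left_mono[OF Dn]) simp
    finally have "real (card ?E1) * n \<le> (h ^ 3 * \<epsilon> * T) * n" by (simp add: mult_ac)
    then show ?thesis using pos by simp
  qed
  \<comment> \<open>The averaged loss is divided by the class size, which is at least \<gamma>
    n.\<close>
  have typc': "real (card (dP u)) \<le> card (dA u) + h ^ 3 * \<epsilon> / \<gamma> * T"
  proof (rule ccontr)
    assume "\<not> ?thesis"
    then have gt: "h ^ 3 * \<epsilon> / \<gamma> * T < real (card (dP u)) - card (dA u)" by simp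
    have "0 \<le> h ^ 3 * \<epsilon> / \<gamma> * T" using pos Tpos by simp
    have "h ^ 3 * \<epsilon> * n * T = (\<gamma> * n) * (h ^ 3 * \<epsilon> / \<gamma> * T)" using pos by simp
    also have "\<dots> < (\<gamma> * n) * (real (card (dP u)) - card (dA u))"
      using gt pos by (intro mult_strict_left_mono) auto
    also have "\<dots> \<le> card (part V c j) * (real (card (dP u)) - card (dA u))"
      using gt \<open>0 \<le> h ^ 3 * \<epsilon> / \<gamma> * T\<close> parts[OF jl(1)] by (intro mult_right_mono) auto
    also have "\<dots> = real (card (part V c j) * card (dP u)) - real (card (part V c j) * card (dA u))"
      by (simp add: algebra_simps)
    also have "\<dots> \<le> real (h * (h\<^sup>2 * (card D * n ^ (h - 2))))"
      using of_nat_mono[OF typc, where 'a = real] by simp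
    also have "\<dots> = real (h ^ 3) * real (card D * n ^ (h - 2))"
      by (simp add: power2_eq_square power3_eq_cube)
    also have "\<dots> \<le> real (h ^ 3) * (\<epsilon> * n * T)" by (rule mult_left_mono[OF Dn]) simp
    finally show False by (simp add: mult_ac)
  qed
  have nb': "real (h\<^sup>2 * (card {y \<in> part V c j. A v y} * n ^ (h - 2))) \<le> h\<^sup>2 * \<alpha> * T"
  proof -
    have "real (h\<^sup>2 * (card {y \<in> part V c j. A v y} * n ^ (h - 2))) \<le> real (h\<^sup>2) * (\<alpha> * n * real n ^ (h - 2))"
      using nb by (simp add: mult_left_mono mult_right_mono)
    also have "\<dots> = h\<^sup>2 * \<alpha> * T" by (simp add: mult_ac flip: T)
    finally show ?thesis .
  qed
  have sq: "real (h\<^sup>2 * n ^ (h - 2)) = h\<^sup>2 / n * T" using pos by (simp flip: T)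
  have uV: "u \<in> V" using u by (simp add: part_def)
  let ?M = "{\<psi> \<in> emb_multi W R V c. \<exists>a\<in>W. \<exists>b\<in>W. R a b \<and> \<psi> a = u \<and> \<psi> b \<in> Y}"
  have "(\<beta> / 2) ^ (h - 1) * T = (\<beta> * n / 2) ^ (h - 1)" by (simp add: T_def power_mult_distrib power_divide)
  also have "\<dots> \<le> real m ^ (h - 1)" using mge pos by (intro power_mono) auto
  also have "\<dots> \<le> card ?M"
  proof -
    have "m + card W \<le> card Y" using mh Y unfolding h_def by linarith
    then have "m ^ (card W - 1) \<le> card ?M"
      using card_missed_ge[OF edge \<chi> u jl(2,3) _ _ big, of Y] by (auto simp: Y_def)
    then show ?thesis unfolding h_def of_nat_power[symmetric] of_nat_le_iff .
  qed
  also have "\<dots> \<le> (h ^ 3 * \<epsilon> / \<gamma> + h ^ 3 * \<epsilon> + h\<^sup>2 * \<alpha> + 2 * h\<^sup>2 / n) * T"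
  proof -
    have "card (dA v) + card ?M \<le> card (dP u) + card ?E1
      + h\<^sup>2 * (card {y \<in> part V c j. A v y} * n ^ (h - 2)) + h\<^sup>2 * n ^ (h - 2)"
      using card_emb_through_compare[OF u v jl(3)] unfolding Y_def n_def h_def .
    moreover have "card (dA u) \<le> card (dA v) + h\<^sup>2 * n ^ (h - 2)" using clone[OF uV v] .
    ultimately have "card (dA u) + card ?M \<le> card (dP u) + card ?E1
      + h\<^sup>2 * (card {y \<in> part V c j. A v y} * n ^ (h - 2)) + h\<^sup>2 * n ^ (h - 2) + h\<^sup>2 * n ^ (h - 2)"
      by linarith
    then have "real (card (dA u)) + card ?M \<le> card (dP u) + card ?E1
      + real (h\<^sup>2 * (card {y \<in> part V c j. A v y} * n ^ (h - 2))) + real (h\<^sup>2 * n ^ (h - 2)) + real (h\<^sup>2 * n ^ (h - 2))"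
      unfolding of_nat_add[symmetric] of_nat_le_iff .
    then have "real (card ?M) \<le> h ^ 3 * \<epsilon> / \<gamma> * T + h ^ 3 * \<epsilon> * T + h\<^sup>2 * \<alpha> * T + h\<^sup>2 / n * T + h\<^sup>2 / n * T"
      using typc' E1 nb' unfolding sq by linarith
    also have "\<dots> = (h ^ 3 * \<epsilon> / \<gamma> + h ^ 3 * \<epsilon> + h\<^sup>2 * \<alpha> + 2 * h\<^sup>2 / n) * T"
      by (simp add: algebra_simps)
    finally show ?thesis .
  qed
  also have "\<dots> < (\<beta> / 2) ^ (h - 1) * T" using num Tpos by simp
  finally show False by simp
qed

lemma ex_sparse_part:
  fixes \<alpha> \<epsilon> :: real
  assumes free: "\<And>S. S \<subseteq> V \<Longrightarrow> card S = Suc k \<Longrightarrow> \<exists>x\<in>S. \<exists>y\<in>S. x \<noteq> y \<and> \<not> A x y"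
    and D: "card D \<le> \<epsilon> * (real (card V))\<^sup>2" "k\<^sup>2 * \<epsilon> < \<alpha> ^ k" "0 \<le> \<epsilon>" "0 \<le> \<alpha>" and v: "v \<in> V"
  shows "\<exists>j<k. card {y \<in> part V c j. A v y} \<le> \<alpha> * card V"
proof (rule ccontr)
  assume "\<not> ?thesis"
  then have "\<exists>\<psi>. (\<forall>l\<in>{..<k}. \<psi> l \<in> {y \<in> part V c l. A v y}) \<and>
      (\<forall>l\<in>{..<k}. \<forall>m\<in>{..<k}. l \<noteq> m \<longrightarrow> (\<psi> l, \<psi> m) \<notin> D)"
    using assms finV by (intro ex_transversal_avoiding[where V = V and \<sigma> = \<alpha> and \<epsilon> = \<epsilon>]) (auto simp: part_def not_le less_imp_le)
  then obtain \<psi> where \<psi>: "\<And>l. l < k \<Longrightarrow> \<psi> l \<in> V \<and> c (\<psi> l) = l \<and> A v (\<psi> l)"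
    and nD: "\<And>l m. l < k \<Longrightarrow> m < k \<Longrightarrow> l \<noteq> m \<Longrightarrow> (\<psi> l, \<psi> m) \<notin> D" by (auto simp: part_def)
  have adj: "A (\<psi> l) (\<psi> m)" if "l < k" "m < k" "l \<noteq> m" for l m
    using nD[OF that] \<psi>[of l] \<psi>[of m] that by (auto simp: diff_pairs_def)
  have "inj_on \<psi> {..<k}" using \<psi> by (metis inj_onI lessThan_iff)
  moreover have "v \<notin> \<psi> ` {..<k}" using \<psi> Airr by auto
  ultimately have "card (insert v (\<psi> ` {..<k})) = Suc k" by (simp add: card_image)
  moreover have "insert v (\<psi> ` {..<k}) \<subseteq> V" using \<psi> v by auto
  ultimately show False using free[of "insert v (\<psi> ` {..<k})"] \<psi> adj Asym by (auto; metis)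
qed

text \<open>The new colour of a vertex is a class in which it has few neighbours; it may differ from
  the old one. Nothing is claimed about the sizes of the new classes, since
  \<open>card_emb_le_balanced\<close> handles any sizes.\<close>

lemma emb_le_multi:
  fixes \<alpha> \<beta> \<gamma> \<epsilon> :: real
  assumes edge: "a \<in> W" "b \<in> W" "R a b" and \<chi>: "\<chi> \<in> W \<rightarrow> {..<k}" "proper W R \<chi>"
    and free: "\<And>S. S \<subseteq> V \<Longrightarrow> card S = Suc k \<Longrightarrow> \<exists>x\<in>S. \<exists>y\<in>S. x \<noteq> y \<and> \<not> A x y"
    and pos: "0 < \<beta>" "4 * \<beta> \<le> \<gamma>" "\<gamma> \<le> 1" "0 \<le> \<epsilon>" "0 \<le> \<alpha>" "card V > 0"
    and parts: "\<And>q. q < k \<Longrightarrow> \<gamma> * card V \<le> card (part V c q)"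
    and D: "card D \<le> \<epsilon> * (real (card V))\<^sup>2" "k\<^sup>2 * \<epsilon> < \<alpha> ^ k" "k\<^sup>2 * \<epsilon> < (\<gamma> / 4) ^ k"
    and clone: "\<And>u v. u \<in> V \<Longrightarrow> v \<in> V \<Longrightarrow> card (dA u) \<le> card (dA v) + (card W)\<^sup>2 * card V ^ (card W - 2)"
    and num: "real (card W) ^ 3 * \<epsilon> / \<gamma> + real (card W) ^ 3 * \<epsilon> +
      (real (card W))\<^sup>2 * \<alpha> + 2 * (real (card W))\<^sup>2 / card V < (\<beta> / 2) ^ (card W - 1)"
    and large: "2 * (real (card W) + 2) \<le> \<beta> * card V"
  shows "\<exists>c'. c' \<in> V \<rightarrow> {..<k} \<and> emb W R V A \<subseteq> emb_multi W R V c'"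
proof -
  have "\<exists>j<k. card {y \<in> part V c j. A v y} \<le> \<alpha> * card V" if "v \<in> V" for v
    using ex_sparse_part[OF free D(1,2) pos(4,5) that] .
  then obtain c' where c': "\<And>v. v \<in> V \<Longrightarrow> c' v < k"
    "\<And>v. v \<in> V \<Longrightarrow> card {y \<in> part V c (c' v). A v y} \<le> \<alpha> * card V" by metis
  define miss where "miss v l = {y \<in> part V c l. y \<noteq> v \<and> \<not> A v y}" for v l
  have missed: "card (miss v l) \<le> \<beta> * card V" if "v \<in> V" "l < k" "l \<noteq> c' v" for v l
    unfolding miss_def
    by (rule few_missed[OF edge \<chi> _ _ _ _ _ D(1) clone num large, where j = "c' v"])
      (use that c' pos parts in auto)
  have proper: "c' x \<noteq> c' y" if xy: "x \<in> V" "y \<in> V" "A x y" for x y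
  proof
    assume eq: "c' x = c' y"
    \<comment> \<open>The vertices \<open>x\<close> and \<open>y\<close> both belong to the clique,
      so k - 1 further classes suffice. In the omitted class no bound on missed vertices is
      available.\<close>
    define L where "L = {..<k} - {c' x}"
    define X where "X l = {z \<in> part V c l. A x z \<and> A y z}" for l
    have L: "finite L" "card L = k - 1" "k \<ge> 1" using c'(1)[OF xy(1)] by (auto simp: L_def)
    have "\<exists>\<psi>. (\<forall>l\<in>L. \<psi> l \<in> X l) \<and> (\<forall>l\<in>L. \<forall>m\<in>L. l \<noteq> m \<longrightarrow> (\<psi> l, \<psi> m) \<notin> D)"
    proof (rule ex_transversal_avoiding[where V = V and \<sigma> = "\<gamma> / 4" and \<epsilon> = \<epsilon>])
      fix l assume "l \<in> L"
      then have l: "l < k" "l \<noteq> c' x" "l \<noteq> c' y" using eq by (auto simp: L_def)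
      have fm: "finite (miss z l)" for z using finV by (simp add: miss_def)
      have "part V c l \<subseteq> X l \<union> miss x l \<union> miss y l \<union> {x, y}"
        by (auto simp: X_def miss_def)
      then have "card (part V c l) \<le> card (X l \<union> miss x l \<union> miss y l \<union> {x, y})"
        using fm finV by (intro card_mono) (auto simp: X_def)
      also have "\<dots> \<le> card (X l \<union> miss x l \<union> miss y l) + card {x, y}" by (rule card_Un_le)
      also have "card (X l \<union> miss x l \<union> miss y l) \<le> card (X l \<union> miss x l) + card (miss y l)" by (rule card_Un_le)
      also have "card (X l \<union> miss x l) \<le> card (X l) + card (miss x l)" by (rule card_Un_le)
      also have "card {x, y} \<le> 2" by (simp add: card_insert_if)
      finally have "card (part V c l) \<le> card (X l) + card (miss x l) + card (miss y l) + 2" by simp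
      moreover have "4 * \<beta> * card V \<le> \<gamma> * card V" using pos by (intro mult_right_mono) auto
      moreover have "2 \<le> \<beta> * card V" using large by simp
      \<comment> \<open>Each of \<open>x\<close> and \<open>y\<close> misses at most \<beta> n
        vertices, and \<open>x\<close>, \<open>y\<close> themselves cost at most 2 \<le> \<beta> n.
        Since 4 \<beta> \<le> \<gamma>, a quarter of \<gamma> n remains.\<close>
      ultimately show "\<gamma> / 4 * card V \<le> card (X l)"
        using parts[OF l(1)] missed[OF xy(1) l(1,2)] missed[OF xy(2) l(1,3)] by linarith
    next
      have "real ((card L)\<^sup>2) * \<epsilon> \<le> real (k\<^sup>2) * \<epsilon>"
        using L pos by (intro mult_right_mono) (auto intro!: power_mono)
      also have "\<dots> < (\<gamma> / 4) ^ k" by (rule D)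
      also have "\<dots> \<le> (\<gamma> / 4) ^ card L" using L pos by (intro power_decreasing) auto
      finally show "real ((card L)\<^sup>2) * \<epsilon> < (\<gamma> / 4) ^ card L" .
    qed (use L finV pos D in \<open>auto simp: X_def part_def\<close>)
    then obtain \<psi> where \<psi>: "\<And>l. l \<in> L \<Longrightarrow> \<psi> l \<in> V \<and> c (\<psi> l) = l \<and> A x (\<psi> l) \<and> A y (\<psi> l)"
      and nD: "\<And>l m. l \<in> L \<Longrightarrow> m \<in> L \<Longrightarrow> l \<noteq> m \<Longrightarrow> (\<psi> l, \<psi> m) \<notin> D" by (auto simp: X_def part_def)
    have adj: "A (\<psi> l) (\<psi> m)" if "l \<in> L" "m \<in> L" "l \<noteq> m" for l m
      using nD[OF that] \<psi>[of l] \<psi>[of m] that by (auto simp: diff_pairs_def)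
    have "inj_on \<psi> L" using \<psi> by (metis inj_onI)
    moreover have "x \<notin> \<psi> ` L" "y \<notin> \<psi> ` L" "x \<noteq> y" using \<psi> Airr xy by auto
    ultimately have "card (insert x (insert y (\<psi> ` L))) = Suc k" using L by (simp add: card_image)
    moreover have "insert x (insert y (\<psi> ` L)) \<subseteq> V" using \<psi> xy by auto
    ultimately obtain p q where pq: "p \<in> insert x (insert y (\<psi> ` L))" "q \<in> insert x (insert y (\<psi> ` L))" "p \<noteq> q" "\<not> A p q"
      using free[of "insert x (insert y (\<psi> ` L))"] by auto
    have "A p q" using pq(1-3) \<psi> adj Asym xy by auto
    then show False using pq(4) by simp
  qed
  have "emb W R V A \<subseteq> emb_multi W R V c'"
  proof
    fix \<phi> assume \<phi>: "\<phi> \<in> emb W R V A"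
    then have "\<phi> a \<in> V" if "a \<in> W" for a using that by (auto simp: emb_def)
    then show "\<phi> \<in> emb_multi W R V c'" using \<phi> proper by (simp add: emb_def)
  qed
  then show ?thesis using c'(1) by (intro exI[of _ c']) auto
qed

end

text \<open>Extremality enters through two consequences: at least as many embeddings as the balanced
  host, and no gain from cloning. The statement can therefore speak of relations alone, with
  \<epsilon> and \<open>n0\<close> uniform over all hosts.\<close>

lemma near_multipartite_extremal:
  fixes R :: "'a \<Rightarrow> 'a \<Rightarrow> bool"
  assumes W: "finite W" "claw_free_rel W R" "symp R" "\<And>a. \<not> R a a"
    and edge: "a \<in> W" "b \<in> W" "R a b" and \<chi>: "\<chi> \<in> W \<rightarrow> {..<k}" "proper W R \<chi>"
  obtains \<epsilon> :: real and n0 where "\<epsilon> > 0" "\<And>(V :: 'b set) A c (V' :: 'b set) t. finite V \<Longrightarrow> n0 \<le> card V \<Longrightarrow>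
    (\<And>x y. A x y \<Longrightarrow> A y x) \<Longrightarrow> (\<And>x. \<not> A x x) \<Longrightarrow> c \<in> V \<rightarrow> {..<k} \<Longrightarrow>
    finite V' \<Longrightarrow> card V' = card V \<Longrightarrow> t \<in> V' \<rightarrow> {..<k} \<Longrightarrow>
    (\<And>p q. p < k \<Longrightarrow> q < k \<Longrightarrow> card (part V' t p) \<le> Suc (card (part V' t q))) \<Longrightarrow>
    card (diff_pairs V A c) \<le> \<epsilon> * (real (card V))\<^sup>2 \<Longrightarrow>
    (\<And>S. S \<subseteq> V \<Longrightarrow> card S = Suc k \<Longrightarrow> \<exists>x\<in>S. \<exists>y\<in>S. x \<noteq> y \<and> \<not> A x y) \<Longrightarrow>
    card (emb_multi W R V' t) \<le> card (emb W R V A) \<Longrightarrow>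
    (\<And>u v. u \<in> V \<Longrightarrow> v \<in> V \<Longrightarrow>
      card (emb W R V (\<lambda>x y. A (if x = v then u else x) (if y = v then u else y))) \<le> card (emb W R V A)) \<Longrightarrow>
    card (emb W R V A) \<le> card (emb_multi W R V' t)"
proof -
  have Rsym: "\<And>a b. R a b \<Longrightarrow> R b a" using W(3) by (rule sympD)
  define h where "h = card W"
  have k: "k > 0" using \<chi> edge by auto
  have h2: "h \<ge> 2"
  proof -
    have "card {a, b} \<le> h" unfolding h_def using edge W by (intro card_mono) auto
    moreover have "a \<noteq> b" using W(4) edge by auto
    ultimately show ?thesis by simp
  qed
  \<comment> \<open>\<eta> n^h is the deficit and \<gamma> the threshold in
    \<open>small_part_deficit\<close>. \<theta> n^(h - 1) bounds from below the embeddings through a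
    vertex lost by missing more than \<beta> n vertices of a class, and \<alpha> lets the sparse
    neighbours account for a quarter of it.\<close>
  define \<eta> \<gamma> \<beta> \<theta> \<alpha> where "\<eta> = (1 / (4 * real k)) ^ h / 2" and "\<gamma> = (1 / (4 * real k)) ^ h / (2 * h\<^sup>2)"
    and "\<beta> = \<gamma> / 4" and "\<theta> = (\<beta> / 2) ^ (h - 1)" and "\<alpha> = \<theta> / (4 * h\<^sup>2)"
  have pos: "\<eta> > 0" "\<gamma> > 0" "\<beta> > 0" "\<theta> > 0" "\<alpha> > 0"
    using k h2 by (auto simp: \<eta>_def \<gamma>_def \<beta>_def \<theta>_def \<alpha>_def)
  have "\<gamma> \<le> 1"
  proof -
    have "(1 / (4 * real k)) ^ h \<le> 1" using k by (intro power_le_one) auto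
    moreover have "1 \<le> (real h)\<^sup>2" using h2 by (intro one_le_power) simp
    ultimately show ?thesis by (simp add: \<gamma>_def divide_le_eq)
  qed
  \<comment> \<open>In order: the deficit of a small class outweighs the error from
    \<open>D\<close>; the two \<epsilon>-terms of \<open>few_missed\<close> are at most \<theta> / 8
    each; transversals exist in neighbourhoods of size \<alpha> n per class, and in common
    neighbourhoods of size \<gamma> n / 4 per class.\<close>
  define \<epsilon> where "\<epsilon> = Min {\<eta> / (2 * h\<^sup>2), \<theta> / (8 * h ^ 3), \<theta> * \<gamma> / (8 * h ^ 3), \<alpha> ^ k / (2 * k\<^sup>2), (\<gamma> / 4) ^ k / (2 * k\<^sup>2)}"
  have \<epsilon>: "\<epsilon> > 0" using pos h2 k by (simp add: \<epsilon>_def)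
  have \<epsilon>le: "\<epsilon> \<le> \<eta> / (2 * h\<^sup>2)" "\<epsilon> \<le> \<theta> / (8 * h ^ 3)" "\<epsilon> \<le> \<theta> * \<gamma> / (8 * h ^ 3)"
    "\<epsilon> \<le> \<alpha> ^ k / (2 * k\<^sup>2)" "\<epsilon> \<le> (\<gamma> / 4) ^ k / (2 * k\<^sup>2)"
    by (simp_all add: \<epsilon>_def)
  have e1: "h\<^sup>2 * \<epsilon> < \<eta>"
  proof -
    have "h\<^sup>2 * \<epsilon> \<le> \<eta> / 2" using \<epsilon>le(1) h2 by (simp add: field_simps)
    then show ?thesis using pos by simp
  qed
  have e2: "h ^ 3 * \<epsilon> \<le> \<theta> / 8" "h ^ 3 * \<epsilon> / \<gamma> \<le> \<theta> / 8"
    using \<epsilon>le(2,3) h2 pos by (simp_all add: field_simps)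
  have e3: "k\<^sup>2 * \<epsilon> < \<alpha> ^ k" "k\<^sup>2 * \<epsilon> < (\<gamma> / 4) ^ k"
  proof -
    have "k\<^sup>2 * \<epsilon> \<le> \<alpha> ^ k / 2" "k\<^sup>2 * \<epsilon> \<le> (\<gamma> / 4) ^ k / 2"
      using \<epsilon>le(4,5) k by (simp_all add: field_simps)
    moreover have "\<alpha> ^ k > 0" "(\<gamma> / 4) ^ k > 0" using pos by simp_all
    ultimately show "k\<^sup>2 * \<epsilon> < \<alpha> ^ k" "k\<^sup>2 * \<epsilon> < (\<gamma> / 4) ^ k" by linarith+
  qed
  have e4: "h\<^sup>2 * \<alpha> = \<theta> / 4" using h2 by (simp add: \<alpha>_def)
  \<comment> \<open>Room for the greedy embedding in \<open>small_part_deficit\<close>, then 2 h^2 /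
    n \<le> \<theta> / 4, then the size condition of \<open>few_missed\<close>; \<open>Suc\<close>
    also makes the vertex set nonempty.\<close>
  define n0 where "n0 = Suc (max (4 * k * (h + 2)) (nat \<lceil>max (8 * h\<^sup>2 / \<theta>) (2 * (h + 2) / \<beta>)\<rceil>))"
  show ?thesis
  proof (rule that[OF \<epsilon>])
    fix V :: "'b set" and A c and V' :: "'b set" and t
    assume fV: "finite V" and n0: "n0 \<le> card V" and sym: "\<And>x y. A x y \<Longrightarrow> A y x" and irr: "\<And>x. \<not> A x x"
      and c: "c \<in> V \<rightarrow> {..<k}" and V': "finite V'" "card V' = card V" "t \<in> V' \<rightarrow> {..<k}"
      and bal: "\<And>p q. p < k \<Longrightarrow> q < k \<Longrightarrow> card (part V' t p) \<le> Suc (card (part V' t q))"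
      and D: "card (diff_pairs V A c) \<le> \<epsilon> * (real (card V))\<^sup>2"
      and free: "\<And>S. S \<subseteq> V \<Longrightarrow> card S = Suc k \<Longrightarrow> \<exists>x\<in>S. \<exists>y\<in>S. x \<noteq> y \<and> \<not> A x y"
      and ext: "card (emb_multi W R V' t) \<le> card (emb W R V A)"
      and clone: "\<And>u v. u \<in> V \<Longrightarrow> v \<in> V \<Longrightarrow>
        card (emb W R V (\<lambda>x y. A (if x = v then u else x) (if y = v then u else y))) \<le> card (emb W R V A)"
    interpret host W R V A c k
      using W(1,4) Rsym fV sym irr c by unfold_locales auto
    define n where "n = card V"
    have n: "4 * k * (h + 2) \<le> n" "n > 0" using n0 by (auto simp: n0_def n_def)
    have "max (8 * h\<^sup>2 / \<theta>) (2 * (h + 2) / \<beta>) \<le> real (nat \<lceil>max (8 * h\<^sup>2 / \<theta>) (2 * (h + 2) / \<beta>)\<rceil>)"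
      by (rule real_nat_ceiling_ge)
    also have "\<dots> \<le> n" unfolding n_def of_nat_le_iff
      using n0 unfolding n0_def by (meson Suc_leD max.boundedE)
    finally have "8 * h\<^sup>2 / \<theta> \<le> n" "2 * (h + 2) / \<beta> \<le> n" by simp_all
    then have large: "8 * h\<^sup>2 \<le> \<theta> * n" "2 * (h + 2) \<le> \<beta> * n" using pos by (simp_all add: field_simps)
    have parts: "\<gamma> * n \<le> card (part V c q)" if q: "q < k" for q
    proof (rule ccontr)
      assume "\<not> ?thesis"
      then have "card (part V c q) \<le> \<gamma> * card V" by (simp add: n_def)
      then have "real (card (emb_multi W R V c)) + \<eta> * real n ^ h \<le> card (emb_multi W R V' t)"
        using small_part_deficit[OF W(1,2) Rsym W(4) edge \<chi> fV c V' _ _ q, of \<gamma>] bal n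
        by (simp add: \<eta>_def \<gamma>_def n_def h_def)
      moreover have "real (card (emb W R V A)) \<le> card (emb_multi W R V c) + h\<^sup>2 * \<epsilon> * real n ^ h"
      proof -
        have "real (card (emb W R V A)) \<le> card (emb_multi W R V c) + real (h\<^sup>2) * (card D * real n ^ (h - 2))"
          using of_nat_mono[OF card_emb_le_multi, where 'a = real] by (simp add: n_def h_def)
        also have "\<dots> \<le> card (emb_multi W R V c) + real (h\<^sup>2) * (\<epsilon> * (real n)\<^sup>2 * real n ^ (h - 2))"
          using D by (intro add_left_mono mult_left_mono mult_right_mono) (auto simp: n_def)
        also have "\<dots> = card (emb_multi W R V c) + real (h\<^sup>2) * \<epsilon> * real n ^ (2 + (h - 2))"
          by (simp only: power_add mult.assoc)
        finally show ?thesis unfolding le_add_diff_inverse[OF h2] .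
      qed
      moreover have "h\<^sup>2 * \<epsilon> * real n ^ h < \<eta> * real n ^ h" using e1 n by simp
      ultimately show False using ext by linarith
    qed
    have clone': "card (dA u) \<le> card (dA v) + h\<^sup>2 * n ^ (h - 2)" if uv: "u \<in> V" "v \<in> V" for u v
    proof (cases "u = v")
      case False
      have "card (emb W R V (\<lambda>x y. A (if x = v then u else x) (if y = v then u else y))) \<le> card (emb W R V A)"
        by (rule clone[OF uv])
      then show ?thesis
        using card_emb_clone[OF W(1) fV uv False, of R A] card_emb_both_le[OF W(1) fV False, of R A]
        unfolding n_def h_def by linarith
    qed simp
    have "\<exists>c'. c' \<in> V \<rightarrow> {..<k} \<and> emb W R V A \<subseteq> emb_multi W R V c'"
    proof (rule emb_le_multi[OF edge \<chi> free, where \<alpha> = \<alpha> and \<beta> = \<beta> and \<gamma> = \<gamma> and \<epsilon> = \<epsilon>])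
      have "2 * h\<^sup>2 / n \<le> \<theta> / 4" using large(1) n by (simp add: field_simps)
      then have "h ^ 3 * \<epsilon> / \<gamma> + h ^ 3 * \<epsilon> + h\<^sup>2 * \<alpha> + 2 * h\<^sup>2 / n \<le> \<theta> / 8 + \<theta> / 8 + \<theta> / 4 + \<theta> / 4"
        using e2 e4 by linarith
      \<comment> \<open>The four shares add up to 3 \<theta> / 4.\<close>
      also have "\<dots> < (\<beta> / 2) ^ (h - 1)" using pos by (simp add: \<theta>_def)
      finally show "real (card W) ^ 3 * \<epsilon> / \<gamma> + real (card W) ^ 3 * \<epsilon> +
      (real (card W))\<^sup>2 * \<alpha> + 2 * (real (card W))\<^sup>2 / card V < (\<beta> / 2) ^ (card W - 1)"
        by (simp add: h_def n_def)
    qed (use pos \<open>\<gamma> \<le> 1\<close> \<epsilon> parts D e3 clone' large n in \<open>auto simp: \<beta>_def n_def h_def\<close>)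
    then obtain c' where c': "c' \<in> V \<rightarrow> {..<k}" "emb W R V A \<subseteq> emb_multi W R V c'" by blast
    then have "card (emb W R V A) \<le> card (emb_multi W R V c')" using W fV by (intro card_mono) auto
    also have "\<dots> \<le> card (emb_multi W R V' t)"
      using bal by (intro card_emb_le_balanced[OF W(1,2) Rsym fV V'(1) _ _ c'(1) V'(3), of "{..<k}"]) (auto simp: V')
    finally show "card (emb W R V A) \<le> card (emb_multi W R V' t)" .
  qed
qed

section \<open>Subgraph counts as embedding counts\<close>

abbreviation adj :: "'a graph \<Rightarrow> 'a \<Rightarrow> 'a \<Rightarrow> bool" where
  "adj G x y \<equiv> {x, y} \<in> edges G"

lemma simple_graph_edge:
  assumes "simple_graph G" "e \<in> edges G"
  obtains x y where "x \<in> verts G" "y \<in> verts G" "x \<noteq> y" "e = {x, y}"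
  using assms unfolding simple_graph_def by (metis card_2_iff insert_subset)

lemma adj_irrefl: "simple_graph G \<Longrightarrow> \<not> adj G x x"
  by (auto simp: simple_graph_def)

lemma adj_sym: "adj G x y \<Longrightarrow> adj G y x"
  by (simp add: insert_commute)

lemma symp_adj: "symp (adj G)"
  by (rule sympI) (rule adj_sym)

definition image_graph :: "('a \<Rightarrow> 'b) \<Rightarrow> 'a graph \<Rightarrow> 'b graph" where
  "image_graph \<phi> H = Graph (\<phi> ` verts H) ((`) \<phi> ` edges H)"

definition automorphisms :: "'a graph \<Rightarrow> ('a \<Rightarrow> 'a) set" where
  "automorphisms H = {\<alpha> \<in> verts H \<rightarrow>\<^sub>E verts H. bij_betw \<alpha> (verts H) (verts H) \<and>
     (\<forall>a\<in>verts H. \<forall>b\<in>verts H. adj H a b \<longleftrightarrow> adj H (\<alpha> a) (\<alpha> b))}"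

lemma adj_image_graph:
  assumes "simple_graph H" "inj_on \<phi> (verts H)" "a \<in> verts H" "b \<in> verts H"
  shows "adj (image_graph \<phi> H) (\<phi> a) (\<phi> b) \<longleftrightarrow> adj H a b"
proof
  assume "adj (image_graph \<phi> H) (\<phi> a) (\<phi> b)"
  then obtain e where e: "e \<in> edges H" "\<phi> ` e = \<phi> ` {a, b}" by (auto simp: image_graph_def)
  have "e \<subseteq> verts H" using e assms by (auto simp: simple_graph_def)
  then have "e = {a, b}" using e(2) assms inj_on_image_eq_iff[OF assms(2), of e "{a, b}"] by simp
  then show "adj H a b" using e by simp
next
  assume "adj H a b"
  then show "adj (image_graph \<phi> H) (\<phi> a) (\<phi> b)"
    by (auto simp: image_graph_def intro!: image_eqI[of _ _ "{a, b}"])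
qed

lemma image_graph_copy:
  assumes "simple_graph H" "\<phi> \<in> emb (verts H) (adj H) (verts G) (adj G)"
  shows "subgraph (image_graph \<phi> H) G \<and> graph_iso (image_graph \<phi> H) H"
proof
  have \<phi>: "\<phi> \<in> verts H \<rightarrow> verts G" "inj_on \<phi> (verts H)"
    "\<And>a b. a \<in> verts H \<Longrightarrow> b \<in> verts H \<Longrightarrow> adj H a b \<Longrightarrow> adj G (\<phi> a) (\<phi> b)"
    using assms by (auto simp: emb_def)
  have sub: "\<phi> ` e \<subseteq> \<phi> ` verts H \<and> card (\<phi> ` e) = 2 \<and> \<phi> ` e \<in> edges G" if e: "e \<in> edges H" for e
  proof -
    obtain x y where xy: "x \<in> verts H" "y \<in> verts H" "x \<noteq> y" "e = {x, y}"
      using simple_graph_edge[OF assms(1) e] .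
    then have "\<phi> x \<noteq> \<phi> y" using \<phi> by (auto simp: inj_on_def)
    then show ?thesis using xy e \<phi>(3)[of x y] by auto
  qed
  then show "subgraph (image_graph \<phi> H) G"
    using \<phi> assms by (auto simp: subgraph_def simple_graph_def image_graph_def)
  have "bij_betw (inv_into (verts H) \<phi>) (\<phi> ` verts H) (verts H)"
    using \<phi> by (simp add: bij_betw_inv_into bij_betw_imageI)
  moreover have "adj (image_graph \<phi> H) u v \<longleftrightarrow> adj H (inv_into (verts H) \<phi> u) (inv_into (verts H) \<phi> v)"
    if "u \<in> \<phi> ` verts H" "v \<in> \<phi> ` verts H" for u v
    using that adj_image_graph[OF assms(1) \<phi>(2)] \<phi>(2) by auto
  ultimately show "graph_iso (image_graph \<phi> H) H"
    unfolding graph_iso_def by (intro exI[of _ "inv_into (verts H) \<phi>"]) (simp add: image_graph_def)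
qed

text \<open>Once an isomorphism from the pattern onto \<open>S\<close> is fixed, the embeddings with
  image \<open>S\<close> are its compositions with automorphisms. The size of the fibre thus does
  not depend on \<open>S\<close>.\<close>

lemma card_emb_fiber:
  assumes H: "simple_graph H" and S: "subgraph S G" "graph_iso S H"
  shows "card {\<phi> \<in> emb (verts H) (adj H) (verts G) (adj G). image_graph \<phi> H = S} = card (automorphisms H)"
proof -
  obtain f where f: "bij_betw f (verts S) (verts H)"
    and fe: "\<And>u v. u \<in> verts S \<Longrightarrow> v \<in> verts S \<Longrightarrow> adj S u v \<longleftrightarrow> adj H (f u) (f v)"
    using S(2) unfolding graph_iso_def by blast
  define g where "g = inv_into (verts S) f"
  have g: "bij_betw g (verts H) (verts S)" using f unfolding g_def by (rule bij_betw_inv_into)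
  have fg: "f (g a) = a" "g a \<in> verts S" if "a \<in> verts H" for a
    using that f g bij_betw_inv_into_right[OF f] bij_betw_apply[OF g] by (auto simp: g_def)
  have gf: "g (f u) = u" "f u \<in> verts H" if "u \<in> verts S" for u
    using that f bij_betw_inv_into_left[OF f] bij_betw_apply[OF f] by (auto simp: g_def)
  have ge: "adj S (g a) (g b) \<longleftrightarrow> adj H a b" if "a \<in> verts H" "b \<in> verts H" for a b
    using that fe[of "g a" "g b"] fg by simp
  have SG: "verts S \<subseteq> verts G" "edges S \<subseteq> edges G" "simple_graph S" using S by (auto simp: subgraph_def)
  let ?F = "{\<phi> \<in> emb (verts H) (adj H) (verts G) (adj G). image_graph \<phi> H = S}"
  have "bij_betw (\<lambda>\<alpha>. restrict (g \<circ> \<alpha>) (verts H)) (automorphisms H) ?F"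
  proof (rule bij_betw_byWitness[where f' = "\<lambda>\<phi>. restrict (f \<circ> \<phi>) (verts H)"])
    show "\<forall>\<alpha>\<in>automorphisms H. restrict (f \<circ> restrict (g \<circ> \<alpha>) (verts H)) (verts H) = \<alpha>"
    proof
      fix \<alpha> assume \<alpha>: "\<alpha> \<in> automorphisms H"
      then have "\<alpha> a \<in> verts H" if "a \<in> verts H" for a using that by (auto simp: automorphisms_def)
      then show "restrict (f \<circ> restrict (g \<circ> \<alpha>) (verts H)) (verts H) = \<alpha>"
        using \<alpha> fg by (intro PiE_ext[of _ "verts H" "\<lambda>_. verts H"]) (auto simp: automorphisms_def)
    qed
    show "\<forall>\<phi>\<in>?F. restrict (g \<circ> restrict (f \<circ> \<phi>) (verts H)) (verts H) = \<phi>"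
    proof
      fix \<phi> assume "\<phi> \<in> ?F"
      then have \<phi>: "\<phi> \<in> verts H \<rightarrow>\<^sub>E verts G" "\<phi> ` verts H = verts S"
        by (auto simp: emb_def image_graph_def)
      then have "\<phi> a \<in> verts S" if "a \<in> verts H" for a using that by blast
      then show "restrict (g \<circ> restrict (f \<circ> \<phi>) (verts H)) (verts H) = \<phi>"
        using \<phi> gf SG by (intro PiE_ext[of _ "verts H" "\<lambda>_. verts G"]) auto
    qed
    show "(\<lambda>\<alpha>. restrict (g \<circ> \<alpha>) (verts H)) ` automorphisms H \<subseteq> ?F"
    proof (rule image_subsetI)
      fix \<alpha> assume "\<alpha> \<in> automorphisms H"
      then have \<alpha>: "bij_betw \<alpha> (verts H) (verts H)"
        and \<alpha>e: "\<And>a b. a \<in> verts H \<Longrightarrow> b \<in> verts H \<Longrightarrow> adj H a b \<longleftrightarrow> adj H (\<alpha> a) (\<alpha> b)"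
        by (auto simp: automorphisms_def)
      let ?p = "restrict (g \<circ> \<alpha>) (verts H)"
      have "bij_betw (g \<circ> \<alpha>) (verts H) (verts S)" using bij_betw_trans[OF \<alpha> g] .
      then have p: "bij_betw ?p (verts H) (verts S)" by (simp add: bij_betw_cong[of _ ?p "g \<circ> \<alpha>"])
      have \<alpha>V: "\<alpha> a \<in> verts H" if "a \<in> verts H" for a using that \<alpha> by (rule bij_betw_apply[rotated])
      have pe: "adj S (?p a) (?p b) \<longleftrightarrow> adj H a b" if "a \<in> verts H" "b \<in> verts H" for a b
        using that ge[of "\<alpha> a" "\<alpha> b"] \<alpha>V \<alpha>e[of a b] by simp
      have "?p \<in> verts H \<rightarrow>\<^sub>E verts G" using fg \<alpha>V SG by auto
      moreover have inj: "inj_on ?p (verts H)" using p by (simp add: bij_betw_def)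
      moreover have "adj G (?p a) (?p b)" if "a \<in> verts H" "b \<in> verts H" "adj H a b" for a b
        using pe[OF that(1,2)] that(3) SG(2) by blast
      ultimately have emb: "?p \<in> emb (verts H) (adj H) (verts G) (adj G)" unfolding emb_def by blast
      have "(`) ?p ` edges H = edges S"
      proof
        show "(`) ?p ` edges H \<subseteq> edges S"
        proof (rule image_subsetI)
          fix e assume e: "e \<in> edges H"
          obtain x y where "x \<in> verts H" "y \<in> verts H" "x \<noteq> y" "e = {x, y}"
            using simple_graph_edge[OF H e] .
          then show "?p ` e \<in> edges S" using pe[of x y] e by simp
        qed
        show "edges S \<subseteq> (`) ?p ` edges H"
        proof
          fix e assume e: "e \<in> edges S"
          obtain x y where xy: "x \<in> verts S" "y \<in> verts S" "x \<noteq> y" "e = {x, y}"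
            using simple_graph_edge[OF SG(3) e] .
          then obtain a b where ab: "a \<in> verts H" "b \<in> verts H" "x = ?p a" "y = ?p b"
            using p unfolding bij_betw_def by (metis imageE)
          then have "{a, b} \<in> edges H" "?p ` {a, b} = e" using pe[OF ab(1,2)] e xy by auto
          then show "e \<in> (`) ?p ` edges H" by blast
        qed
      qed
      then have "image_graph ?p H = S"
        using p unfolding image_graph_def bij_betw_def by (cases S) simp
      then show "?p \<in> ?F" using emb by blast
    qed
    show "(\<lambda>\<phi>. restrict (f \<circ> \<phi>) (verts H)) ` ?F \<subseteq> automorphisms H"
    proof (rule image_subsetI)
      fix \<phi> assume "\<phi> \<in> ?F"
      then have \<phi>: "inj_on \<phi> (verts H)" "image_graph \<phi> H = S" by (auto simp: emb_def)
      have im: "\<phi> ` verts H = verts S" unfolding \<phi>(2)[symmetric] by (simp add: image_graph_def)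
      have "bij_betw (f \<circ> \<phi>) (verts H) (verts H)"
        using \<phi>(1) im f by (intro bij_betw_trans[of \<phi> _ "verts S"]) (auto simp: bij_betw_def)
      then have b: "bij_betw (restrict (f \<circ> \<phi>) (verts H)) (verts H) (verts H)"
        by (simp add: bij_betw_cong[of _ "restrict (f \<circ> \<phi>) (verts H)" "f \<circ> \<phi>"])
      have "adj H a b \<longleftrightarrow> adj H (f (\<phi> a)) (f (\<phi> b))" if "a \<in> verts H" "b \<in> verts H" for a b
        using adj_image_graph[OF H \<phi>(1) that] fe[of "\<phi> a" "\<phi> b"] that im unfolding \<phi>(2) by blast
      then show "restrict (f \<circ> \<phi>) (verts H) \<in> automorphisms H"
        using b bij_betw_apply[OF b] by (auto simp: automorphisms_def)
    qed
  qed
  from bij_betw_same_card[OF this] show ?thesis by simp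
qed

lemma card_emb_eq_subgraph_count:
  assumes H: "simple_graph H" and G: "simple_graph G"
  shows "card (emb (verts H) (adj H) (verts G) (adj G)) = card (automorphisms H) * subgraph_count H G"
proof -
  let ?E = "emb (verts H) (adj H) (verts G) (adj G)" and ?S = "{S. subgraph S G \<and> graph_iso S H}"
  have fin: "finite (verts H)" "finite (verts G)" using H G by (auto simp: simple_graph_def)
  have "?S \<subseteq> (\<lambda>(V, E). Graph V E) ` (Pow (verts G) \<times> Pow (Pow (verts G)))"
  proof
    fix S assume "S \<in> ?S"
    then have "verts S \<subseteq> verts G" "edges S \<subseteq> Pow (verts G)"
      by (auto simp: subgraph_def simple_graph_def)
    then show "S \<in> (\<lambda>(V, E). Graph V E) ` (Pow (verts G) \<times> Pow (Pow (verts G)))"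
      by (intro image_eqI[of _ _ "(verts S, edges S)"]) auto
  qed
  then have finS: "finite ?S" using fin by (meson finite_Pow_iff finite_SigmaI finite_imageI finite_subset)
  have "?E = (\<Union>S\<in>?S. {\<phi> \<in> ?E. image_graph \<phi> H = S})" using image_graph_copy[OF H] by blast
  then have "card ?E = card (\<Union>S\<in>?S. {\<phi> \<in> ?E. image_graph \<phi> H = S})" by simp
  also have "\<dots> = (\<Sum>S\<in>?S. card {\<phi> \<in> ?E. image_graph \<phi> H = S})"
    using finS fin by (intro card_UN_disjoint) auto
  also have "\<dots> = (\<Sum>S\<in>?S. card (automorphisms H))"
    by (rule sum.cong[OF refl]) (simp add: card_emb_fiber[OF H])
  finally show ?thesis by (simp add: subgraph_count_def)
qed

lemma card_automorphisms_pos: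
  assumes "simple_graph H"
  shows "card (automorphisms H) > 0"
proof -
  have "finite (automorphisms H)"
    using assms unfolding automorphisms_def simple_graph_def by (simp add: finite_PiE)
  moreover have "restrict id (verts H) \<in> automorphisms H"
    by (auto simp: automorphisms_def bij_betw_def inj_on_def)
  ultimately show ?thesis by (metis card_gt_0_iff empty_iff)
qed

text \<open>Embeddings are copies times automorphisms, with the same positive factor for every
  host.\<close>

lemma subgraph_count_le_iff:
  assumes "simple_graph H" "simple_graph G" "simple_graph G'"
  shows "subgraph_count H G \<le> subgraph_count H G' \<longleftrightarrow>
    card (emb (verts H) (adj H) (verts G) (adj G)) \<le> card (emb (verts H) (adj H) (verts G') (adj G'))"
  using assms card_automorphisms_pos[of H] by (simp add: card_emb_eq_subgraph_count)

section \<open>Graph notions restated for relations\<close>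

lemma free_of_complete_graph_iff:
  assumes "simple_graph G"
  shows "free_of (complete_graph m) G \<longleftrightarrow>
    (\<forall>S\<subseteq>verts G. card S = m \<longrightarrow> (\<exists>x\<in>S. \<exists>y\<in>S. x \<noteq> y \<and> \<not> adj G x y))"
proof -
  have fin: "finite (verts G)" using assms by (simp add: simple_graph_def)
  have K: "adj (complete_graph m) p q \<longleftrightarrow> p < m \<and> q < m \<and> p \<noteq> q" for p q
    by (auto simp: complete_graph_def card_insert_if)
  have "(\<exists>T. subgraph T G \<and> graph_iso T (complete_graph m)) \<longleftrightarrow>
    (\<exists>S\<subseteq>verts G. card S = m \<and> (\<forall>x\<in>S. \<forall>y\<in>S. x \<noteq> y \<longrightarrow> adj G x y))" (is "?L \<longleftrightarrow> ?R")
  proof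
    assume ?L
    then obtain T f where T: "subgraph T G" and f: "bij_betw f (verts T) {..<m}"
      and fe: "\<And>u v. u \<in> verts T \<Longrightarrow> v \<in> verts T \<Longrightarrow> adj T u v \<longleftrightarrow> adj (complete_graph m) (f u) (f v)"
      unfolding graph_iso_def complete_graph_def by auto
    have "card (verts T) = m" using bij_betw_same_card[OF f] by simp
    moreover have "adj G x y" if "x \<in> verts T" "y \<in> verts T" "x \<noteq> y" for x y
    proof -
      have "f x < m" "f y < m" using bij_betw_apply[OF f] that by auto
      moreover have "f x \<noteq> f y" using that f by (auto simp: bij_betw_def inj_on_def)
      ultimately show ?thesis using fe[OF that(1,2)] K T by (auto simp: subgraph_def)
    qed
    ultimately show ?R using T by (auto simp: subgraph_def)
  next
    assume ?R
    then obtain S where S: "S \<subseteq> verts G" "card S = m" "\<And>x y. x \<in> S \<Longrightarrow> y \<in> S \<Longrightarrow> x \<noteq> y \<Longrightarrow> adj G x y" by blast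
    define T where "T = Graph S {e. e \<subseteq> S \<and> card e = 2}"
    have finS: "finite S" using S fin finite_subset by blast
    obtain f where f: "bij_betw f S {..<m}"
      using finite_same_card_bij[OF finS, of "{..<m}"] S by auto
    have "edges T \<subseteq> edges G"
    proof
      fix e assume "e \<in> edges T"
      then have "e \<subseteq> S" "card e = 2" by (auto simp: T_def)
      then show "e \<in> edges G" using S(3) by (auto simp: card_2_iff)
    qed
    then have "subgraph T G" using S finS by (auto simp: subgraph_def simple_graph_def T_def)
    moreover have "graph_iso T (complete_graph m)"
      unfolding graph_iso_def
    proof (intro exI[of _ f] conjI ballI)
      show "bij_betw f (verts T) (verts (complete_graph m))" using f by (simp add: T_def complete_graph_def)
      fix u v assume uv: "u \<in> verts T" "v \<in> verts T"
      then have "f u < m" "f v < m" "f u = f v \<longleftrightarrow> u = v"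
        using bij_betw_apply[OF f] f by (auto simp: T_def bij_betw_def inj_on_def)
      then show "adj T u v \<longleftrightarrow> adj (complete_graph m) (f u) (f v)"
        using uv K by (auto simp: T_def card_insert_if)
    qed
    ultimately show ?L by blast
  qed
  then show ?thesis unfolding free_of_def by blast
qed

text \<open>Turns the relation of a cloned host back into a graph, so that it can compete in
  \<open>ex_number\<close>.\<close>

definition rel_graph :: "'b set \<Rightarrow> ('b \<Rightarrow> 'b \<Rightarrow> bool) \<Rightarrow> 'b graph" where
  "rel_graph V A = Graph V {{x, y} | x y. x \<in> V \<and> y \<in> V \<and> A x y}"

lemma rel_graph:
  assumes "finite V" "\<And>x y. A x y \<Longrightarrow> A y x" "\<And>x. \<not> A x x"
  shows "simple_graph (rel_graph V A)" "verts (rel_graph V A) = V"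
    "x \<in> V \<Longrightarrow> y \<in> V \<Longrightarrow> adj (rel_graph V A) x y \<longleftrightarrow> A x y"
proof -
  have "card {x, y} = 2" if "A x y" for x y using that assms(3) by (auto simp: card_insert_if)
  then show "simple_graph (rel_graph V A)" using assms(1) by (auto simp: simple_graph_def rel_graph_def)
  show "verts (rel_graph V A) = V" by (simp add: rel_graph_def)
  show "x \<in> V \<Longrightarrow> y \<in> V \<Longrightarrow> adj (rel_graph V A) x y \<longleftrightarrow> A x y"
    using assms(2) by (auto simp: rel_graph_def doubleton_eq_iff)
qed

lemma emb_cong:
  assumes "\<And>x y. x \<in> V \<Longrightarrow> y \<in> V \<Longrightarrow> A x y \<longleftrightarrow> B x y"
  shows "emb W R V A = emb W R V B"
proof -
  have "(\<forall>a\<in>W. \<forall>b\<in>W. R a b \<longrightarrow> A (\<phi> a) (\<phi> b)) \<longleftrightarrow> (\<forall>a\<in>W. \<forall>b\<in>W. R a b \<longrightarrow> B (\<phi> a) (\<phi> b))"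
    if "\<phi> \<in> W \<rightarrow>\<^sub>E V" for \<phi>
  proof -
    have "\<phi> a \<in> V" if "a \<in> W" for a using \<open>\<phi> \<in> W \<rightarrow>\<^sub>E V\<close> that by auto
    then show ?thesis using assms by simp
  qed
  then show ?thesis unfolding emb_def by blast
qed

lemma adj_multipartite:
  assumes "multipartite_by c k P" "x \<in> verts P" "y \<in> verts P"
  shows "adj P x y \<longleftrightarrow> c x \<noteq> c y"
  using assms unfolding multipartite_by_def by (auto simp: doubleton_eq_iff)

lemma claw_free_rel_adj:
  assumes "simple_graph H" "claw_free H"
  shows "claw_free_rel (verts H) (adj H)"
  unfolding claw_free_rel_def
proof (intro ballI impI, rule ccontr)
  fix x y1 y2 y3
  assume V: "x \<in> verts H" "y1 \<in> verts H" "y2 \<in> verts H" "y3 \<in> verts H" and d: "distinct [y1, y2, y3]"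
    and e: "adj H x y1" "adj H x y2" "adj H x y3"
    and n: "\<not> (adj H y1 y2 \<or> adj H y1 y3 \<or> adj H y2 y3)"
  have ne: "x \<noteq> y1" "x \<noteq> y2" "x \<noteq> y3" "y1 \<noteq> y2" "y1 \<noteq> y3" "y2 \<noteq> y3"
    using d e adj_irrefl[OF assms(1)] by auto
  define S where "S = Graph {x, y1, y2, y3} {e \<in> edges H. e \<subseteq> {x, y1, y2, y3}}"
  define f where "f v = (if v = x then 0 else if v = y1 then 1 else if v = y2 then 2 else 3 :: nat)" for v
  have "induced_subgraph S H" using V by (simp add: induced_subgraph_def S_def)
  moreover have "graph_iso S claw"
    unfolding graph_iso_def
  proof (intro exI[of _ f] conjI)
    show "bij_betw f (verts S) (verts claw)"
      using ne by (auto simp: bij_betw_def inj_on_def f_def S_def claw_def)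
    have "adj S u v \<longleftrightarrow> adj H u v" if "u \<in> verts S" "v \<in> verts S" for u v
      using that by (auto simp: S_def)
    moreover have "adj H u u = False" for u using adj_irrefl[OF assms(1)] by simp
    ultimately show "\<forall>u\<in>verts S. \<forall>v\<in>verts S. adj S u v \<longleftrightarrow> adj claw (f u) (f v)"
      using ne e n adj_sym[of _ _ H]
      by (simp add: S_def f_def claw_def doubleton_eq_iff insert_commute)
  qed
  ultimately show False using assms(2) unfolding claw_free_def by blast
qed

lemma colorable_chromatic:
  assumes "simple_graph H" "chromatic_number H \<le> k"
  shows "\<exists>\<chi>. \<chi> \<in> verts H \<rightarrow> {..<k} \<and> proper (verts H) (adj H) \<chi>"
proof -
  have "finite (verts H)" using assms by (simp add: simple_graph_def)
  then obtain f where f: "bij_betw f (verts H) {..<card (verts H)}"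
    by (metis atLeast0LessThan ex_bij_betw_finite_nat)
  \<comment> \<open>\<open>LEAST\<close> is meaningful only if some number of colours works; giving
    all vertices different colours does.\<close>
  have "colorable (card (verts H)) H"
    unfolding colorable_def
  proof (intro exI[of _ f] conjI ballI impI)
    fix u v assume "u \<in> verts H" "v \<in> verts H" "adj H u v"
    then show "f u \<noteq> f v" using f adj_irrefl[OF assms(1)] by (auto simp: bij_betw_def inj_on_def)
  qed (use bij_betw_apply[OF f] in auto)
  then have "colorable (chromatic_number H) H" unfolding chromatic_number_def by (rule LeastI)
  then obtain \<chi> where "\<forall>v\<in>verts H. \<chi> v < chromatic_number H"
    "\<forall>u\<in>verts H. \<forall>v\<in>verts H. adj H u v \<longrightarrow> \<chi> u \<noteq> \<chi> v" unfolding colorable_def by blast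
  then show ?thesis using assms(2) by (intro exI[of _ \<chi>]) (auto simp: proper_def)
qed

lemma turan_balanced:
  assumes "k > 0" "p < k" "q < k"
  shows "card (part {..<n} (\<lambda>v. v mod k) p) \<le> Suc (card (part {..<n} (\<lambda>v. v mod k) q))"
proof -
  have "int (card (part {..<n} (\<lambda>v. v mod k) i)) = \<lfloor>real n / real k\<rfloor> \<or>
      int (card (part {..<n} (\<lambda>v. v mod k) i)) = \<lceil>real n / real k\<rceil>" if "i < k" for i
    using turan_graph_part_sizes[OF assms(1) that, of n] by (simp add: part_def turan_graph_def)
  moreover have "\<lceil>real n / real k\<rceil> \<le> \<lfloor>real n / real k\<rfloor> + 1" by linarith
  moreover have "\<lfloor>real n / real k\<rfloor> \<le> \<lceil>real n / real k\<rceil>" by linarith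
  ultimately show ?thesis using assms(2,3) by (smt (verit) of_nat_Suc of_nat_le_iff)
qed

lemma free_of_turan_graph:
  assumes "k > 0"
  shows "free_of (complete_graph (k + 1)) (turan_graph k n)"
proof -
  have s: "simple_graph (turan_graph k n)" and m: "multipartite_by (\<lambda>v. v mod k) k (turan_graph k n)"
    using turan_graph_complete_multipartite[OF assms] by (auto simp: complete_multipartite_def)
  show ?thesis
    unfolding free_of_complete_graph_iff[OF s]
  proof (intro allI impI)
    fix S assume S: "S \<subseteq> verts (turan_graph k n)" "card S = k + 1"
    have "(\<lambda>v. v mod k) ` S \<subseteq> {..<k}" using assms by auto
    then have "card ((\<lambda>v. v mod k) ` S) \<le> card {..<k}" by (intro card_mono) auto
    then have "\<not> inj_on (\<lambda>v. v mod k) S" using S(2) by (auto dest: card_image)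
    then obtain x y where "x \<in> S" "y \<in> S" "x \<noteq> y" "x mod k = y mod k" by (auto simp: inj_on_def)
    then show "\<exists>x\<in>S. \<exists>y\<in>S. x \<noteq> y \<and> \<not> adj (turan_graph k n) x y"
      using S(1) adj_multipartite[OF m] by (metis subsetD)
  qed
qed

lemma subgraph_count_le_ex_number:
  fixes G :: "nat graph"
  assumes "k > 0" "simple_graph G" "card (verts G) = n" "free_of (complete_graph (k + 1)) G"
  shows "subgraph_count H G \<le> ex_number n H (complete_graph (k + 1))"
  unfolding ex_number_def using assms ex_number_Max_attained(1)[OF assms(1)] by (intro Max_ge) auto

text \<open>\<open>diff_pairs\<close> consists of ordered pairs, so each edited edge accounts for
  two.\<close>

lemma card_diff_pairs_le:
  assumes G: "simple_graph G" and P: "simple_graph P" "multipartite_by c k P" "verts P = verts G"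
  shows "card (diff_pairs (verts G) (adj G) c) \<le>
    2 * (card (edges P - edges G) + card (edges G - edges P))"
proof -
  let ?X = "(edges P - edges G) \<union> (edges G - edges P)"
  have fin: "finite (edges G)" "finite (edges P)"
    using G P by (auto simp: simple_graph_def intro!: finite_subset[of _ "Pow (verts G)"])
  have "diff_pairs (verts G) (adj G) c \<subseteq> (\<Union>e\<in>?X. {(x, y). x \<noteq> y \<and> e = {x, y}})"
    using adj_multipartite[OF P(2)] P(3) by (auto simp: diff_pairs_def)
  moreover have two: "finite {(x, y). x \<noteq> y \<and> e = {x, y}} \<and> card {(x, y). x \<noteq> y \<and> e = {x, y}} \<le> 2" for e :: "'a set"
  proof (cases "\<exists>p q. p \<noteq> q \<and> e = {p, q}")
    case True
    then obtain p q where "p \<noteq> q" "e = {p, q}" by blast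
    then have sub: "{(x, y). x \<noteq> y \<and> e = {x, y}} \<subseteq> {(p, q), (q, p)}"
      by (auto simp: doubleton_eq_iff)
    have "finite S \<and> card S \<le> 2" if "S \<subseteq> {(p, q), (q, p)}" for S :: "('a \<times> 'a) set"
    proof -
      have "card S \<le> card {(p, q), (q, p)}" using that by (intro card_mono) auto
      also have "\<dots> = 2" using \<open>p \<noteq> q\<close> by simp
      finally show ?thesis using finite_subset[OF that] by simp
    qed
    from this[OF sub] show ?thesis .
  next
    case False
    then have "{(x, y). x \<noteq> y \<and> e = {x, y}} = {}" by blast
    then show ?thesis by (simp only: card.empty finite.emptyI) simp
  qed
  ultimately have "card (diff_pairs (verts G) (adj G) c) \<le> card (\<Union>e\<in>?X. {(x, y). x \<noteq> y \<and> e = {x, y}})"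
    using fin by (intro card_mono) auto
  also have "\<dots> \<le> card ?X * 2" using fin two by (intro card_UN_le_mult) auto
  also have "card ?X = card (edges P - edges G) + card (edges G - edges P)"
    using fin by (intro card_Un_disjoint) auto
  finally show ?thesis by simp
qed

text \<open>Without an edge of \<open>H\<close> a small part costs nothing and the stability
  argument has no start; but then all hosts on \<open>n\<close> vertices contain equally many
  copies.\<close>

lemma turan_good_if_edgeless:
  assumes "k > 0" "simple_graph H" "edges H = {}"
  shows "turan_good k H"
  unfolding turan_good_def
proof (intro always_eventually allI)
  fix n
  have T: "simple_graph (turan_graph k n)" "verts (turan_graph k n) = {..<n}"
    using turan_graph_complete_multipartite[OF assms(1)] by (auto simp: complete_multipartite_def turan_graph_def)
  have "subgraph_count H G \<le> subgraph_count H (turan_graph k n)"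
    if G: "simple_graph G" "card (verts G) = n" for G :: "nat graph"
  proof -
    have "finite (verts G)" using G by (simp add: simple_graph_def)
    then obtain \<pi> where \<pi>: "bij_betw \<pi> (verts G) {..<n}"
      using finite_same_card_bij[of "verts G" "{..<n}"] G by auto
    have "emb (verts H) (adj H) V A = emb (verts H) (adj H) V (\<lambda>_ _. True)" for V :: "nat set" and A
      using assms(3) by (simp add: emb_def)
    moreover have "card (emb (verts H) (adj H) (verts G) (\<lambda>_ _. True)) = card (emb (verts H) (adj H) {..<n} (\<lambda>_ _. True))"
      using assms(2) G \<pi> by (intro card_emb_bij[of _ _ _ \<pi>]) (auto simp: simple_graph_def)
    ultimately show ?thesis unfolding subgraph_count_le_iff[OF assms(2) G(1) T(1)] T(2) by (metis order_refl)
  qed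
  moreover obtain G :: "nat graph" where "simple_graph G" "card (verts G) = n"
    "ex_number n H (complete_graph (k + 1)) = subgraph_count H G"
    using Max_in[OF ex_number_Max_attained[OF assms(1), of H n]] unfolding ex_number_def by auto
  moreover have "subgraph_count H (turan_graph k n) \<le> ex_number n H (complete_graph (k + 1))"
    using T free_of_turan_graph[OF assms(1)] assms(1) by (intro subgraph_count_le_ex_number) auto
  ultimately show "ex_number n H (complete_graph (k + 1)) = subgraph_count H (turan_graph k n)"
    by (metis le_antisym)
qed

theorem theorem1p9:
  fixes k :: nat and H :: "'a graph"
  assumes "k > 0"
    and "simple_graph H"
    and "claw_free H"
    and "chromatic_number H \<le> k"
    and "\<exists>(G :: nat \<Rightarrow> nat graph) P.
      (\<forall>\<^sub>F n in sequentially.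
         simple_graph (G n) \<and> card (verts (G n)) = n \<and>
         free_of (complete_graph (k + 1)) (G n) \<and>
         subgraph_count H (G n) = ex_number n H (complete_graph (k + 1)) \<and>
         complete_multipartite k (P n) \<and> verts (P n) = verts (G n)) \<and>
      (\<lambda>n. real (card (edges (P n) - edges (G n)) + card (edges (G n) - edges (P n))))
         \<in> o(\<lambda>n. real n ^ 2)"
  shows "turan_good k H"
proof (cases "edges H = {}")
  case True
  then show ?thesis using turan_good_if_edgeless assms by blast
next
  case False
  then obtain a b where edge: "a \<in> verts H" "b \<in> verts H" "adj H a b"
    using simple_graph_edge[OF assms(2)] by (metis ex_in_conv)
  obtain \<chi> where \<chi>: "\<chi> \<in> verts H \<rightarrow> {..<k}" "proper (verts H) (adj H) \<chi>"
    using colorable_chromatic[OF assms(2,4)] by blast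
  have finH: "finite (verts H)" using assms(2) by (simp add: simple_graph_def)

  show ?thesis
  proof (rule near_multipartite_extremal[of "verts H" "adj H" a b \<chi> k,
      OF finH claw_free_rel_adj[OF assms(2,3)] symp_adj adj_irrefl[OF assms(2)] edge \<chi>])
    fix \<epsilon> :: real and n0
    assume \<epsilon>: "\<epsilon> > 0" and stab: "\<And>(V :: nat set) A c (V' :: nat set) t.
      finite V \<Longrightarrow> n0 \<le> card V \<Longrightarrow>
      (\<And>x y. A x y \<Longrightarrow> A y x) \<Longrightarrow> (\<And>x. \<not> A x x) \<Longrightarrow> c \<in> V \<rightarrow> {..<k} \<Longrightarrow>
      finite V' \<Longrightarrow> card V' = card V \<Longrightarrow> t \<in> V' \<rightarrow> {..<k} \<Longrightarrow>
      (\<And>p q. p < k \<Longrightarrow> q < k \<Longrightarrow> card (part V' t p) \<le> Suc (card (part V' t q))) \<Longrightarrow>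
      card (diff_pairs V A c) \<le> \<epsilon> * (real (card V))\<^sup>2 \<Longrightarrow>
      (\<And>S. S \<subseteq> V \<Longrightarrow> card S = Suc k \<Longrightarrow> \<exists>x\<in>S. \<exists>y\<in>S. x \<noteq> y \<and> \<not> A x y) \<Longrightarrow>
      card (emb_multi (verts H) (adj H) V' t) \<le> card (emb (verts H) (adj H) V A) \<Longrightarrow>
      (\<And>u v. u \<in> V \<Longrightarrow> v \<in> V \<Longrightarrow>
        card (emb (verts H) (adj H) V (\<lambda>x y. A (if x = v then u else x) (if y = v then u else y)))
          \<le> card (emb (verts H) (adj H) V A)) \<Longrightarrow>
      card (emb (verts H) (adj H) V A) \<le> card (emb_multi (verts H) (adj H) V' t)"
    obtain G :: "nat \<Rightarrow> nat graph" and P where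
      ev: "\<forall>\<^sub>F n in sequentially. simple_graph (G n) \<and> card (verts (G n)) = n \<and>
           free_of (complete_graph (k + 1)) (G n) \<and>
           subgraph_count H (G n) = ex_number n H (complete_graph (k + 1)) \<and>
           complete_multipartite k (P n) \<and> verts (P n) = verts (G n)"
      and small: "(\<lambda>n. real (card (edges (P n) - edges (G n)) + card (edges (G n) - edges (P n)))) \<in> o(\<lambda>n. real n ^ 2)"
      using assms(5) by blast
    \<comment> \<open>Half of \<epsilon>, because \<open>diff_pairs\<close> counts each edited edge
      twice.\<close>
    have "\<forall>\<^sub>F n in sequentially. card (edges (P n) - edges (G n)) + card (edges (G n) - edges (P n)) \<le> \<epsilon> / 2 * (real n)\<^sup>2"
      using landau_o.smallD[OF small, of "\<epsilon> / 2"] \<epsilon> by simp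
    with ev eventually_ge_at_top[of n0] show ?thesis
      unfolding turan_good_def
    proof eventually_elim
      case (elim n)
      define V T where "V = verts (G n)" and "T = turan_graph k n"
      have G: "simple_graph (G n)" "card V = n" "finite V" "free_of (complete_graph (k + 1)) (G n)"
        and ex: "subgraph_count H (G n) = ex_number n H (complete_graph (k + 1))"
        using elim by (auto simp: V_def simple_graph_def)
      obtain c where P: "simple_graph (P n)" "multipartite_by c k (P n)" "verts (P n) = V"
        using elim by (auto simp: complete_multipartite_def V_def)
      have T: "simple_graph T" "verts T = {..<n}" "multipartite_by (\<lambda>v. v mod k) k T"
        using turan_graph_complete_multipartite[OF assms(1)]
        by (simp_all add: T_def complete_multipartite_def) (simp add: turan_graph_def)
      have embT: "emb (verts H) (adj H) (verts T) (adj T) = emb_multi (verts H) (adj H) {..<n} (\<lambda>v. v mod k)"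
        unfolding T(2) by (rule emb_cong) (use adj_multipartite[OF T(3)] T(2) in auto)
      have exge: "subgraph_count H T \<le> subgraph_count H (G n)"
        unfolding ex T_def by (rule subgraph_count_le_ex_number)
          (use T free_of_turan_graph assms(1) in \<open>auto simp: T_def\<close>)
      have "card (emb (verts H) (adj H) V (adj (G n))) \<le> card (emb_multi (verts H) (adj H) {..<n} (\<lambda>v. v mod k))"
      proof (rule stab)
        show "c \<in> V \<rightarrow> {..<k}" using P by (auto simp: multipartite_by_def)
        show "card (part {..<n} (\<lambda>v. v mod k) p) \<le> Suc (card (part {..<n} (\<lambda>v. v mod k) q))"
          if "p < k" "q < k" for p q using turan_balanced[OF assms(1) that] .
        have "real (card (diff_pairs V (adj (G n)) c)) \<le>
            2 * real (card (edges (P n) - edges (G n)) + card (edges (G n) - edges (P n)))"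
          using card_diff_pairs_le[OF G(1) P(1,2)] P(3) unfolding V_def
          by linarith
        then show "card (diff_pairs V (adj (G n)) c) \<le> \<epsilon> * (real (card V))\<^sup>2"
          using elim(3) G(2) by simp
        show "\<exists>x\<in>S. \<exists>y\<in>S. x \<noteq> y \<and> \<not> adj (G n) x y" if "S \<subseteq> V" "card S = Suc k" for S
          using G(4) that unfolding free_of_complete_graph_iff[OF G(1)] V_def by simp
        show "card (emb_multi (verts H) (adj H) {..<n} (\<lambda>v. v mod k)) \<le> card (emb (verts H) (adj H) V (adj (G n)))"
          using exge subgraph_count_le_iff[OF assms(2) T(1) G(1)] embT by (simp add: V_def)
        show "card (emb (verts H) (adj H) V
            (\<lambda>x y. adj (G n) (if x = v then u else x) (if y = v then u else y))) \<le> card (emb (verts H) (adj H) V (adj (G n)))"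
          if uv: "u \<in> V" "v \<in> V" for u v
        proof -
          \<comment> \<open>The edges of \<open>C\<close> are those of \<open>G n\<close> pulled
            back along \<open>\<sigma>\<close>, which makes \<open>v\<close> a non-adjacent twin of
            \<open>u\<close>.\<close>
          define \<sigma> where "\<sigma> x = (if x = v then u else x)" for x
          define C where "C = rel_graph V (\<lambda>x y. adj (G n) (\<sigma> x) (\<sigma> y))"
          have C: "simple_graph C" "verts C = V" "\<And>x y. x \<in> V \<Longrightarrow> y \<in> V \<Longrightarrow> adj C x y \<longleftrightarrow> adj (G n) (\<sigma> x) (\<sigma> y)"
            unfolding C_def by (rule rel_graph[OF G(3)]; simp add: adj_irrefl[OF G(1), simplified] insert_commute)+
          have "free_of (complete_graph (k + 1)) C"
            unfolding free_of_complete_graph_iff[OF C(1)] C(2)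
          proof (intro allI impI, rule ccontr)
            fix S assume S: "S \<subseteq> V" "card S = k + 1" and "\<not> (\<exists>x\<in>S. \<exists>y\<in>S. x \<noteq> y \<and> \<not> adj C x y)"
            then have cl: "adj (G n) (\<sigma> x) (\<sigma> y)" if "x \<in> S" "y \<in> S" "x \<noteq> y" for x y
              using that C(3) by blast
            \<comment> \<open>Distinct clique vertices with equal images would yield a loop in
              \<open>G n\<close>.\<close>
            then have "inj_on \<sigma> S" using adj_irrefl[OF G(1)] by (metis inj_onI)
            then have card: "card (\<sigma> ` S) = k + 1" using S by (simp add: card_image)
            have sub: "\<sigma> ` S \<subseteq> V" using S uv by (auto simp: \<sigma>_def)
            have "\<exists>p\<in>\<sigma> ` S. \<exists>q\<in>\<sigma> ` S. p \<noteq> q \<and> \<not> adj (G n) p q"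
              using G(4)[unfolded free_of_complete_graph_iff[OF G(1)], rule_format, of "\<sigma> ` S"] sub card
              unfolding V_def by (simp only:)
            then show False using cl by auto
          qed
          then have "subgraph_count H C \<le> subgraph_count H (G n)"
            unfolding ex using C G(2) assms(1) by (intro subgraph_count_le_ex_number) auto
          then have "card (emb (verts H) (adj H) V (adj C)) \<le> card (emb (verts H) (adj H) V (adj (G n)))"
            using subgraph_count_le_iff[OF assms(2) C(1) G(1)] C(2) by (simp add: V_def)
          moreover have "emb (verts H) (adj H) V (adj C) = emb (verts H) (adj H) V (\<lambda>x y. adj (G n) (\<sigma> x) (\<sigma> y))"
            by (rule emb_cong) (rule C(3))
          ultimately show ?thesis unfolding \<sigma>_def by simp
        qed
      qed (use G elim assms(1) adj_irrefl[OF G(1)] in \<open>auto intro: adj_sym\<close>)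
      then have "subgraph_count H (G n) \<le> subgraph_count H T"
        using subgraph_count_le_iff[OF assms(2) G(1) T(1)] embT by (simp add: V_def)
      then show ?case using exge ex by (simp add: T_def)
    qed
  qed
qed

end
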